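(* Let $p \ge 5$ be a prime, let $\tau \ge 1$ be an integer and let $k = p^\tau(p-1)$. Then for every integer $s > 2k^2$ and all integers $a_i, b_i$ ($1 \le i \le s$), the equations $$\sum_{i=1}^s a_i x_i^k = \sum_{i=1}^s b_i x_i^k = 0$$ have a non-trivial $p$-adic solution, i.e. a solution $(x_1,\dots,x_s) \in \mathbb{Q}_p^s \setminus \{\boldsymbol{0}\}$. *)

theory Defs
  imports Complex_Main "HOL-Computational_Algebra.Primes" "HOL-Algebra.QuotRing"
begin

definition padic_abs :: "nat \<Rightarrow> rat \<Rightarrow> real" where
  "padic_abs p q =
     (if q = 0 then 0
      else case quotient_of q of (a, b) \<Rightarrow>
        real p powi (int (multiplicity (int p) b) - int (multiplicity (int p) a)))"

definition padic_Cauchy :: "nat \<Rightarrow> (nat \<Rightarrow> rat) \<Rightarrow> bool" where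
  "padic_Cauchy p x \<longleftrightarrow>
     (\<forall>e>0. \<exists>N. \<forall>m\<ge>N. \<forall>n\<ge>N. padic_abs p (x m - x n) < e)"

definition padic_null :: "nat \<Rightarrow> (nat \<Rightarrow> rat) \<Rightarrow> bool" where
  "padic_null p x \<longleftrightarrow> (\<lambda>n. padic_abs p (x n)) \<longlonglongrightarrow> 0"

definition padic_Cauchy_ring :: "nat \<Rightarrow> (nat \<Rightarrow> rat) ring" where
  "padic_Cauchy_ring p =
     \<lparr>carrier = {x. padic_Cauchy p x},
      monoid.mult = (\<lambda>x y n. x n * y n),
      one = (\<lambda>_. 1),
      zero = (\<lambda>_. 0),
      add = (\<lambda>x y n. x n + y n)\<rparr>"

(* The field of p-adic numbers, as the completion of the rationals with respect to the
   p-adic absolute value. The prime is an ordinary argument (rather than a type parameter),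
   so elements are cosets of null sequences and live in the carrier of a ring record. *)
definition padic_field :: "nat \<Rightarrow> (nat \<Rightarrow> rat) set ring" where
  "padic_field p = padic_Cauchy_ring p Quot {x. padic_null p x}"

lemma padic_abs_0 [simp]: "padic_abs p 0 = 0"
  by (simp add: padic_abs_def)

context
  fixes p :: nat
  assumes p: "prime p"
begin

lemma p_int: "prime (int p)" "prime_elem (int p)" "\<not> is_unit (int p)"
  using p by (auto dest: not_prime_unit)

lemma p_real: "real p > 1"
  using prime_gt_1_nat[OF p] by simp

lemma padic_abs_frac:
  assumes "a \<noteq> 0" "b \<noteq> 0"
  shows "padic_abs p (of_int a / of_int b) =
           real p powi (int (multiplicity (int p) b) - int (multiplicity (int p) a))"
proof -
  obtain c d where cd: "quotient_of (of_int a / of_int b) = (c, d)"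
    by (cases "quotient_of (of_int a / of_int b)") auto
  have d: "d > 0" using cd by (rule quotient_of_denom_pos)
  have eq: "(of_int a / of_int b :: rat) = of_int c / of_int d"
    using cd by (rule quotient_of_div)
  have c: "c \<noteq> 0" using eq assms d by auto
  have "(of_int (a * d) :: rat) = of_int (c * b)"
    using eq assms d by (simp add: field_simps)
  hence "a * d = c * b" by (simp only: of_int_eq_iff)
  hence "multiplicity (int p) (a * d) = multiplicity (int p) (c * b)" by simp
  hence "multiplicity (int p) a + multiplicity (int p) d = multiplicity (int p) c + multiplicity (int p) b"
    using assms c d p_int by (simp add: prime_elem_multiplicity_mult_distrib)
  hence "int (multiplicity (int p) b) - int (multiplicity (int p) a) =
         int (multiplicity (int p) d) - int (multiplicity (int p) c)" by linarith
  thus ?thesis using assms by (simp add: padic_abs_def cd)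
qed

lemma rat_frac:
  obtains a b where "(q::rat) = of_int a / of_int b" "b > 0"
  by (cases "quotient_of q") (use quotient_of_div quotient_of_denom_pos in blast)

lemma padic_abs_pos: "q \<noteq> 0 \<Longrightarrow> padic_abs p q > 0"
  using p_real by (auto simp: padic_abs_def split: prod.splits)

lemma padic_abs_nonneg [simp]: "padic_abs p q \<ge> 0"
  using padic_abs_pos[of q] by (cases "q = 0") auto

lemma padic_abs_1 [simp]: "padic_abs p 1 = 1"
  using padic_abs_frac[of 1 1] by simp

lemma padic_abs_mult: "padic_abs p (q * r) = padic_abs p q * padic_abs p r"
proof (cases "q = 0 \<or> r = 0")
  case False
  obtain a b where q: "q = of_int a / of_int b" "b > 0" by (rule rat_frac)
  obtain c d where r: "r = of_int c / of_int d" "d > 0" by (rule rat_frac)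
  have nz: "a \<noteq> 0" "b \<noteq> 0" "c \<noteq> 0" "d \<noteq> 0" using False q r by auto
  have "q * r = of_int (a * c) / of_int (b * d)" by (simp add: q r)
  hence "padic_abs p (q * r) = real p powi (int (multiplicity (int p) (b * d)) - int (multiplicity (int p) (a * c)))"
    using padic_abs_frac[of "a * c" "b * d"] nz by simp
  also have "\<dots> = real p powi ((int (multiplicity (int p) b) - int (multiplicity (int p) a))
                       + (int (multiplicity (int p) d) - int (multiplicity (int p) c)))"
    using nz p_int by (simp add: prime_elem_multiplicity_mult_distrib algebra_simps)
  also have "\<dots> = padic_abs p q * padic_abs p r"
    using p_real nz by (simp add: power_int_add q r padic_abs_frac)
  finally show ?thesis .
qed auto

lemma padic_abs_minus [simp]: "padic_abs p (- q) = padic_abs p q"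
proof -
  have "padic_abs p (- 1) = 1" using padic_abs_frac[of "-1" 1]
    by (simp add: multiplicity_unit_right)
  thus ?thesis using padic_abs_mult[of "-1" q] by simp
qed

lemma padic_abs_inverse: "padic_abs p (inverse q) = inverse (padic_abs p q)"
proof (cases "q = 0")
  case False
  hence "padic_abs p q * padic_abs p (inverse q) = 1"
    by (simp flip: padic_abs_mult)
  thus ?thesis using inverse_unique by metis
qed auto

lemma padic_abs_add: "padic_abs p (q + r) \<le> max (padic_abs p q) (padic_abs p r)"
proof (cases "q = 0 \<or> r = 0 \<or> q + r = 0")
  case False
  obtain a b where q: "q = of_int a / of_int b" "b > 0" by (rule rat_frac)
  obtain c d where r: "r = of_int c / of_int d" "d > 0" by (rule rat_frac)
  define u v w where "u = a * d" and "v = c * b" and "w = b * d"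
  have nz: "a \<noteq> 0" "b \<noteq> 0" "c \<noteq> 0" "d \<noteq> 0" using False q r by auto
  hence nz': "u \<noteq> 0" "v \<noteq> 0" "w \<noteq> 0" by (auto simp: u_def v_def w_def)
  have q': "q = of_int u / of_int w" and r': "r = of_int v / of_int w"
    using nz by (auto simp: q r u_def v_def w_def)
  have s': "q + r = of_int (u + v) / of_int w"
    by (simp add: q' r' add_divide_distrib)
  have nzs: "u + v \<noteq> 0" using False s' by auto
  let ?m = "multiplicity (int p)"
  have "int p ^ min (?m u) (?m v) dvd u + v"
    by (intro dvd_add multiplicity_dvd') auto
  hence "?m (u + v) \<ge> min (?m u) (?m v)"
    using nzs p_int by (intro multiplicity_geI) auto
  hence "?m (u + v) \<ge> ?m u \<or> ?m (u + v) \<ge> ?m v" by linarith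
  moreover have "padic_abs p q = real p powi (int (?m w) - int (?m u))"
    "padic_abs p r = real p powi (int (?m w) - int (?m v))"
    "padic_abs p (q + r) = real p powi (int (?m w) - int (?m (u + v)))"
    using padic_abs_frac[OF nz'(1,3)] padic_abs_frac[OF nz'(2,3)] padic_abs_frac[OF nzs nz'(3)]
    by (simp_all only: q'[symmetric] r'[symmetric] s'[symmetric])
  ultimately have "padic_abs p (q + r) \<le> padic_abs p q \<or> padic_abs p (q + r) \<le> padic_abs p r"
    using p_real by (auto intro!: power_int_increasing)
  thus ?thesis by auto
next
  case True
  have "padic_abs p (q + r) \<le> max (padic_abs p q) (padic_abs p r)" if "q + r = 0"
    unfolding that by (simp add: le_max_iff_disj)
  with True show ?thesis by (auto simp: max_def)
qed

lemma padic_abs_triangle: "padic_abs p (q + r) \<le> padic_abs p q + padic_abs p r"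
  using padic_abs_add[of q r] padic_abs_nonneg[of q] padic_abs_nonneg[of r] by linarith

lemma padic_CauchyD:
  assumes "padic_Cauchy p x" "e > 0"
  obtains N where "\<And>m n. m \<ge> N \<Longrightarrow> n \<ge> N \<Longrightarrow> padic_abs p (x m - x n) < e"
  using assms unfolding padic_Cauchy_def by blast

lemma padic_null_iff: "padic_null p x \<longleftrightarrow> (\<forall>e>0. \<exists>N. \<forall>n\<ge>N. padic_abs p (x n) < e)"
  by (simp add: padic_null_def LIMSEQ_iff)

lemma padic_Cauchy_const: "padic_Cauchy p (\<lambda>_. c)"
  by (auto simp: padic_Cauchy_def)

lemma padic_Cauchy_add:
  assumes "padic_Cauchy p x" "padic_Cauchy p y"
  shows "padic_Cauchy p (\<lambda>n. x n + y n)"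
  unfolding padic_Cauchy_def
proof (intro allI impI)
  fix e :: real assume e: "e > 0"
  obtain N M where
    N: "\<And>m n. m \<ge> N \<Longrightarrow> n \<ge> N \<Longrightarrow> padic_abs p (x m - x n) < e" and
    M: "\<And>m n. m \<ge> M \<Longrightarrow> n \<ge> M \<Longrightarrow> padic_abs p (y m - y n) < e"
    using padic_CauchyD[OF assms(1) e] padic_CauchyD[OF assms(2) e] by metis
  have "padic_abs p (x m + y m - (x n + y n)) < e" if "m \<ge> max N M" "n \<ge> max N M" for m n
    using padic_abs_add[of "x m - x n" "y m - y n"] N[of m n] M[of m n] that
    by (simp add: algebra_simps)
  thus "\<exists>N. \<forall>m\<ge>N. \<forall>n\<ge>N. padic_abs p (x m + y m - (x n + y n)) < e" by blast
qed

lemma padic_Cauchy_minus: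
  assumes "padic_Cauchy p x" shows "padic_Cauchy p (\<lambda>n. - x n)"
proof -
  have "padic_abs p (- x m - - x n) = padic_abs p (x m - x n)" for m n
    using padic_abs_minus[of "x m - x n"] by (simp add: algebra_simps)
  thus ?thesis using assms by (simp add: padic_Cauchy_def)
qed

lemma padic_Cauchy_bounded:
  assumes "padic_Cauchy p x"
  obtains B where "B > 0" "\<And>n. padic_abs p (x n) \<le> B"
proof -
  obtain N where N: "\<And>m n. m \<ge> N \<Longrightarrow> n \<ge> N \<Longrightarrow> padic_abs p (x m - x n) < 1"
    using padic_CauchyD[OF assms, of 1] by auto
  define B where "B = 1 + (\<Sum>n\<le>N. padic_abs p (x n))"
  have le: "padic_abs p (x n) \<le> (\<Sum>n\<le>N. padic_abs p (x n))" if "n \<le> N" for n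
    using that by (intro member_le_sum) auto
  have "padic_abs p (x n) \<le> B" for n
  proof (cases "n \<le> N")
    case True thus ?thesis using le[of n] by (simp add: B_def)
  next
    case False
    have "padic_abs p (x n) \<le> padic_abs p (x n - x N) + padic_abs p (x N)"
      using padic_abs_triangle[of "x n - x N" "x N"] by simp
    thus ?thesis using False N[of n N] le[of N] by (simp add: B_def)
  qed
  moreover have "B > 0" by (auto simp: B_def intro!: add_pos_nonneg sum_nonneg)
  ultimately show ?thesis using that by blast
qed

lemma padic_Cauchy_mult:
  assumes "padic_Cauchy p x" "padic_Cauchy p y"
  shows "padic_Cauchy p (\<lambda>n. x n * y n)"
  unfolding padic_Cauchy_def
proof (intro allI impI)
  fix e :: real assume e: "e > 0"
  obtain A where A: "A > 0" "\<And>n. padic_abs p (x n) \<le> A"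
    using padic_Cauchy_bounded[OF assms(1)] by blast
  obtain B where B: "B > 0" "\<And>n. padic_abs p (y n) \<le> B"
    using padic_Cauchy_bounded[OF assms(2)] by blast
  have e': "e / B > 0" "e / A > 0" using e A B by auto
  obtain N M where
    N: "\<And>m n. m \<ge> N \<Longrightarrow> n \<ge> N \<Longrightarrow> padic_abs p (x m - x n) < e / B" and
    M: "\<And>m n. m \<ge> M \<Longrightarrow> n \<ge> M \<Longrightarrow> padic_abs p (y m - y n) < e / A"
    using padic_CauchyD[OF assms(1) e'(1)] padic_CauchyD[OF assms(2) e'(2)] by metis
  have "padic_abs p (x m * y m - x n * y n) < e" if "m \<ge> max N M" "n \<ge> max N M" for m n
  proof -
    have "padic_abs p (x m - x n) * padic_abs p (y m) \<le> padic_abs p (x m - x n) * B"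
      using B by (intro mult_left_mono) auto
    also have "\<dots> < e" using N[of m n] that B(1) by (simp add: field_simps)
    finally have 1: "padic_abs p ((x m - x n) * y m) < e" by (simp add: padic_abs_mult)
    have "padic_abs p (x n) * padic_abs p (y m - y n) \<le> A * padic_abs p (y m - y n)"
      using A by (intro mult_right_mono) auto
    also have "\<dots> < e" using M[of m n] that A(1) by (simp add: field_simps)
    finally have 2: "padic_abs p (x n * (y m - y n)) < e" by (simp add: padic_abs_mult)
    show ?thesis
      using padic_abs_add[of "(x m - x n) * y m" "x n * (y m - y n)"] 1 2
      by (simp add: algebra_simps)
  qed
  thus "\<exists>N. \<forall>m\<ge>N. \<forall>n\<ge>N. padic_abs p (x m * y m - x n * y n) < e" by blast
qed

lemma padic_null_imp_Cauchy:
  assumes "padic_null p x" shows "padic_Cauchy p x"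
  unfolding padic_Cauchy_def
proof (intro allI impI)
  fix e :: real assume "e > 0"
  then obtain N where N: "\<And>n. n \<ge> N \<Longrightarrow> padic_abs p (x n) < e"
    using assms unfolding padic_null_iff by blast
  have "padic_abs p (x m - x n) < e" if "m \<ge> N" "n \<ge> N" for m n
    using padic_abs_add[of "x m" "- x n"] N[of m] N[of n] that by simp
  thus "\<exists>N. \<forall>m\<ge>N. \<forall>n\<ge>N. padic_abs p (x m - x n) < e" by blast
qed

lemma padic_null_add:
  assumes "padic_null p x" "padic_null p y" shows "padic_null p (\<lambda>n. x n + y n)"
  unfolding padic_null_iff
proof (intro allI impI)
  fix e :: real assume "e > 0"
  then obtain N M where N: "\<And>n. n \<ge> N \<Longrightarrow> padic_abs p (x n) < e"
    and M: "\<And>n. n \<ge> M \<Longrightarrow> padic_abs p (y n) < e"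
    using assms unfolding padic_null_iff by metis
  have "padic_abs p (x n + y n) < e" if "n \<ge> max N M" for n
    using padic_abs_add[of "x n" "y n"] N[of n] M[of n] that by simp
  thus "\<exists>N. \<forall>n\<ge>N. padic_abs p (x n + y n) < e" by blast
qed

lemma padic_null_minus: "padic_null p x \<Longrightarrow> padic_null p (\<lambda>n. - x n)"
  by (simp add: padic_null_def)

lemma padic_null_mult:
  assumes "padic_null p x" "padic_Cauchy p y" shows "padic_null p (\<lambda>n. y n * x n)"
  unfolding padic_null_iff
proof (intro allI impI)
  fix e :: real assume e: "e > 0"
  obtain B where B: "B > 0" "\<And>n. padic_abs p (y n) \<le> B"
    using padic_Cauchy_bounded[OF assms(2)] by blast
  have "e / B > 0" using e B(1) by simp
  then obtain N where N: "\<And>n. n \<ge> N \<Longrightarrow> padic_abs p (x n) < e / B"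
    using assms(1) unfolding padic_null_iff by blast
  have "padic_abs p (y n * x n) < e" if "n \<ge> N" for n
  proof -
    have "padic_abs p (y n) * padic_abs p (x n) \<le> B * padic_abs p (x n)"
      using B(2) by (intro mult_right_mono) auto
    also have "\<dots> < e" using N[OF that] B(1) by (simp add: field_simps)
    finally show ?thesis by (simp add: padic_abs_mult)
  qed
  thus "\<exists>N. \<forall>n\<ge>N. padic_abs p (y n * x n) < e" by blast
qed

lemma padic_Cauchy_away:
  assumes "padic_Cauchy p x" "\<not> padic_null p x"
  obtains e N where "e > 0" "\<And>n. n \<ge> N \<Longrightarrow> padic_abs p (x n) \<ge> e"
proof -
  obtain e where e: "e > 0" "\<And>N. \<exists>n\<ge>N. padic_abs p (x n) \<ge> e"
    using assms(2) unfolding padic_null_iff by (meson not_le)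
  obtain N where N: "\<And>m n. m \<ge> N \<Longrightarrow> n \<ge> N \<Longrightarrow> padic_abs p (x m - x n) < e"
    using padic_CauchyD[OF assms(1) e(1)] by blast
  obtain k where k: "k \<ge> N" "padic_abs p (x k) \<ge> e" using e(2) by blast
  have "padic_abs p (x n) \<ge> e" if "n \<ge> N" for n
    using padic_abs_add[of "x k - x n" "x n"] N[of k n] k that by (simp add: max_def split: if_splits)
  thus ?thesis using that e(1) by blast
qed

lemma padic_Cauchy_inverse:
  assumes "padic_Cauchy p x" "\<not> padic_null p x"
  shows "padic_Cauchy p (\<lambda>n. inverse (x n))"
  unfolding padic_Cauchy_def
proof (intro allI impI)
  fix d :: real assume d: "d > 0"
  obtain e M where e: "e > 0" and M: "\<And>n. n \<ge> M \<Longrightarrow> padic_abs p (x n) \<ge> e"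
    using padic_Cauchy_away[OF assms] by blast
  have "d * (e * e) > 0" using d e by simp
  then obtain N where N: "\<And>m n. m \<ge> N \<Longrightarrow> n \<ge> N \<Longrightarrow> padic_abs p (x m - x n) < d * (e * e)"
    using padic_CauchyD[OF assms(1)] by blast
  have "padic_abs p (inverse (x m) - inverse (x n)) < d" if "m \<ge> max N M" "n \<ge> max N M" for m n
  proof -
    have mn: "padic_abs p (x m) \<ge> e" "padic_abs p (x n) \<ge> e" using M that by auto
    hence nz: "x m \<noteq> 0" "x n \<noteq> 0" using e by auto
    have "padic_abs p (inverse (x m) - inverse (x n)) * (e * e) \<le>
          padic_abs p (inverse (x m) - inverse (x n)) * (padic_abs p (x m) * padic_abs p (x n))"
      using mn e by (intro mult_left_mono mult_mono) auto
    also have "\<dots> = padic_abs p ((inverse (x m) - inverse (x n)) * (x m * x n))"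
      by (simp add: padic_abs_mult)
    also have "(inverse (x m) - inverse (x n)) * (x m * x n) = x n - x m"
      using nz by (simp add: field_simps)
    also have "padic_abs p (x n - x m) < d * (e * e)" using N that by simp
    finally show ?thesis using e by simp
  qed
  thus "\<exists>N. \<forall>m\<ge>N. \<forall>n\<ge>N. padic_abs p (inverse (x m) - inverse (x n)) < d" by blast
qed

lemma cring_padic_Cauchy_ring: "cring (padic_Cauchy_ring p)"
proof (rule cringI)
  show "abelian_group (padic_Cauchy_ring p)"
  proof (rule abelian_groupI)
    fix x assume "x \<in> carrier (padic_Cauchy_ring p)"
    thus "\<exists>y\<in>carrier (padic_Cauchy_ring p).
            y \<oplus>\<^bsub>padic_Cauchy_ring p\<^esub> x = \<zero>\<^bsub>padic_Cauchy_ring p\<^esub>"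
      by (intro bexI[of _ "\<lambda>n. - x n"]) (auto simp: padic_Cauchy_ring_def padic_Cauchy_minus)
  qed (auto simp: padic_Cauchy_ring_def padic_Cauchy_add padic_Cauchy_const algebra_simps)
  show "comm_monoid (padic_Cauchy_ring p)"
    by (rule comm_monoidI)
       (auto simp: padic_Cauchy_ring_def padic_Cauchy_mult padic_Cauchy_const algebra_simps)
qed (auto simp: padic_Cauchy_ring_def algebra_simps)

lemma maximalideal_padic_null: "maximalideal {x. padic_null p x} (padic_Cauchy_ring p)"
proof (rule maximalidealI)
  let ?R = "padic_Cauchy_ring p" and ?I = "{x. padic_null p x}"
  interpret R: cring ?R by (rule cring_padic_Cauchy_ring)
  have neg: "\<ominus>\<^bsub>?R\<^esub> x = (\<lambda>n. - x n)" if "padic_Cauchy p x" for x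
    using that by (intro R.minus_equality) (auto simp: padic_Cauchy_ring_def padic_Cauchy_minus)
  show ideal: "ideal ?I ?R"
  proof (rule idealI)
    show "ring ?R" by (rule R.ring_axioms)
    show "subgroup ?I (add_monoid ?R)"
    proof (rule R.add.subgroupI)
      show "?I \<subseteq> carrier ?R"
        by (auto simp: padic_Cauchy_ring_def padic_null_imp_Cauchy)
      show "?I \<noteq> {}" by (auto simp: padic_null_def intro!: exI[of _ "\<lambda>_. 0"])
      show "\<ominus>\<^bsub>?R\<^esub> x \<in> ?I" if "x \<in> ?I" for x
        using that by (simp add: neg padic_null_imp_Cauchy padic_null_minus)
      show "x \<oplus>\<^bsub>?R\<^esub> y \<in> ?I" if "x \<in> ?I" "y \<in> ?I" for x y
        using that by (simp add: padic_Cauchy_ring_def padic_null_add)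
    qed
  next
    fix a x assume "a \<in> ?I" "x \<in> carrier ?R"
    thus "x \<otimes>\<^bsub>?R\<^esub> a \<in> ?I" "a \<otimes>\<^bsub>?R\<^esub> x \<in> ?I"
      using padic_null_mult[of a x] by (auto simp: padic_Cauchy_ring_def mult.commute)
  qed
  have "(\<lambda>_. 1) \<in> carrier ?R" by (simp add: padic_Cauchy_ring_def padic_Cauchy_const)
  moreover have "(\<lambda>_. 1) \<notin> ?I" by (simp add: padic_null_def LIMSEQ_const_iff)
  ultimately show "carrier ?R \<noteq> ?I" by blast
  fix J assume J: "ideal J ?R" "?I \<subseteq> J" "J \<subseteq> carrier ?R"
  interpret J: ideal J ?R by (rule J(1))
  show "J = ?I \<or> J = carrier ?R"
  proof (rule disjCI)
    assume "J \<noteq> carrier ?R"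
    have "padic_null p x" if "x \<in> J" for x
    proof (rule ccontr)
      assume nn: "\<not> padic_null p x"
      have xC: "padic_Cauchy p x" using that J(3) by (auto simp: padic_Cauchy_ring_def)
      define y where "y = (\<lambda>n. inverse (x n))"
      have y: "y \<in> carrier ?R"
        using padic_Cauchy_inverse[OF xC nn] by (simp add: padic_Cauchy_ring_def y_def)
      obtain e N where e: "e > 0" "\<And>n. n \<ge> N \<Longrightarrow> padic_abs p (x n) \<ge> e"
        using padic_Cauchy_away[OF xC nn] by blast
      have "x n \<noteq> 0" if "n \<ge> N" for n using e(1) e(2)[OF that] by auto
      hence "eventually (\<lambda>n. padic_abs p (1 - y n * x n) = 0) sequentially"
        unfolding eventually_sequentially y_def by (intro exI[of _ N]) auto
      hence "padic_null p (\<lambda>n. 1 - y n * x n)"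
        unfolding padic_null_def by (rule tendsto_eventually)
      hence 1: "(\<lambda>n. 1 - y n * x n) \<in> J" using J(2) by auto
      have 2: "y \<otimes>\<^bsub>?R\<^esub> x \<in> J" using that y by (rule J.I_l_closed)
      have "(\<lambda>n. 1 - y n * x n) \<oplus>\<^bsub>?R\<^esub> (y \<otimes>\<^bsub>?R\<^esub> x) = \<one>\<^bsub>?R\<^esub>"
        by (simp add: padic_Cauchy_ring_def)
      hence "\<one>\<^bsub>?R\<^esub> \<in> J" using J.a_closed[OF 1 2] by simp
      hence "J = carrier ?R" by (rule J.one_imp_carrier)
      thus False using \<open>J \<noteq> carrier ?R\<close> by contradiction
    qed
    thus "J = ?I" using J(2) by auto
  qed
qed

lemma field_padic_field: "field (padic_field p)"
  unfolding padic_field_def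
  by (rule maximalideal.quotient_is_field[OF maximalideal_padic_null cring_padic_Cauchy_ring])

end

end

(* The k-th powers of p-adic units are exactly the numbers congruent to 1 modulo q = p^(tau+1), so a
   solution is found as soon as a set S of coefficient vectors (after scaling by powers of p^k and a
   linear change of the two equations) has sum 0 modulo q and contains two vectors independent modulo p.

   Zero sums: in the group ring of (Z/q)^2 over F_p, which is F_p[X,Y]/(X^q,Y^q), consider the product of
   the elements 1 - (1+X)^x (1+Y)^y over a set W of vectors (x,y). If it is a nonzero multiple of the socle
   element X^(q-1) Y^(q-1), then every element of (Z/q)^2 is a subset sum of W; adding two independent
   spare vectors outside W gives S. A vector divisible by p^i exactly contributes a p^i-th power of a linear
   form as its leading term, so few vectors divisible by p already carry a large degree.

   Normalisation: choose the lattice in Q_p^2 (linear change and scaling) that minimises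
   2k * (total scaling exponent) + s * v_p(det). Comparing with sublattices of index p, p^2 and p^4 shows
   that more than 2k vectors are nonzero mod p, more than 4k nonzero mod p^2, and that more than k
   (respectively 2k) of them are nonzero under any given primitive linear form mod p (mod p^2). These counts
   suffice to assemble a product reaching the socle. If more than half of the vectors are proportional the
   minimum need not exist, but then it suffices to solve a single equation. *)

theory Submission
  imports Defs "HOL-Number_Theory.Cong"
begin

text \<open>With \<open>P = p ^ \<tau>\<close> we have q = k + P, and this P is the obstacle.
  Minimality guarantees only slightly more than 2k vectors that are nonzero modulo p, whereas
  factors with linear leading terms would have to number 2(q - 1) = 2k + 2P - 2, besides the two
  spare vectors. The deficit has to come from factors whose leading term has degree p. Total degree
  alone does not suffice either: an exponent that passes q - 1 kills the product, so the degree must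
  be distributed over X and Y. How this can be done depends on the spread of the vectors over the p
  + 1 directions modulo p; where no pure monomials can be assigned in advance, the factors are
  treated as linear forms and chosen one by one.

  The quantity minimised is the natural one: if variable i is scaled by the exponent e_i and the
  determinant has valuation v, the determinant of columns i and j gains valuation k e_i + k e_j + v,
  and the sum of this over all ordered pairs is s times that quantity.\<close>

section \<open>Coefficients of products in the group ring\<close>

text \<open>The coefficient of \<^term>\<open>X ^ l * Y ^ m\<close> in the product of
  \<^term>\<open>1 - (1 + X) ^ x w * (1 + Y) ^ y w\<close> over \<^term>\<open>w \<in> W\<close>, expanded over subsets.\<close>

definition pcoeff :: "('i \<Rightarrow> nat) \<Rightarrow> ('i \<Rightarrow> nat) \<Rightarrow> 'i set \<Rightarrow> nat \<Rightarrow> nat \<Rightarrow> int" where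
  "pcoeff x y W l m =
     (\<Sum>S\<in>Pow W. (-1) ^ card S * int (sum x S choose l) * int (sum y S choose m))"

definition mcoeff :: "('i \<Rightarrow> nat) \<Rightarrow> ('i \<Rightarrow> nat) \<Rightarrow> 'i \<Rightarrow> nat \<Rightarrow> nat \<Rightarrow> int" where
  "mcoeff x y w i j = int (x w choose i) * int (y w choose j)"

lemma mcoeff_0 [simp]: "mcoeff x y w 0 0 = 1"
  by (simp add: mcoeff_def)

lemma pcoeff_empty: "pcoeff x y {} l m = (if l = 0 \<and> m = 0 then 1 else 0)"
  by (cases l; cases m) (auto simp: pcoeff_def)

text \<open>Subsets containing \<open>w\<close> are split by Vandermonde's identity; the (0, 0) term
  of the resulting convolution cancels the subsets without \<open>w\<close>. Thus each new factor
  has no constant term.\<close>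

lemma pcoeff_insert:
  assumes "finite W" "w \<notin> W"
  shows "pcoeff x y (insert w W) l m =
           - (\<Sum>(i, j)\<in>{..l} \<times> {..m} - {(0, 0)}. mcoeff x y w i j * pcoeff x y W (l - i) (m - j))"
proof -
  let ?g = "\<lambda>S. (-1) ^ card S * int (sum x S choose l) * int (sum y S choose m) :: int"
  have inj: "inj_on (insert w) (Pow W)"
    using assms by (auto simp: inj_on_def)
  have S: "finite S" "w \<notin> S" if "S \<in> Pow W" for S
    using that assms finite_subset by auto
  have "pcoeff x y (insert w W) l m = (\<Sum>S\<in>Pow W. ?g S) + (\<Sum>S\<in>insert w ` Pow W. ?g S)"
    unfolding pcoeff_def Pow_insert using assms by (intro sum.union_disjoint) auto
  also have "(\<Sum>S\<in>insert w ` Pow W. ?g S) = (\<Sum>S\<in>Pow W. ?g (insert w S))"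
    using sum.reindex[OF inj] by simp
  also have "\<dots> = (\<Sum>S\<in>Pow W. - (\<Sum>i\<le>l. \<Sum>j\<le>m. mcoeff x y w i j *
        ((-1) ^ card S * int (sum x S choose (l - i)) * int (sum y S choose (m - j)))))"
  proof (rule sum.cong[OF refl])
    fix S assume "S \<in> Pow W"
    note S = S[OF this]
    have "int ((x w + sum x S) choose l) = (\<Sum>i\<le>l. int (x w choose i) * int (sum x S choose (l - i)))"
      by (simp flip: vandermonde)
    moreover have "int ((y w + sum y S) choose m) = (\<Sum>i\<le>m. int (y w choose i) * int (sum y S choose (m - i)))"
      by (simp flip: vandermonde)
    ultimately show "?g (insert w S) = - (\<Sum>i\<le>l. \<Sum>j\<le>m. mcoeff x y w i j *
        ((-1) ^ card S * int (sum x S choose (l - i)) * int (sum y S choose (m - j))))"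
      using S by (simp add: sum_product sum_distrib_left sum_distrib_right sum_negf mcoeff_def mult_ac)
  qed
  also have "\<dots> = - (\<Sum>i\<le>l. \<Sum>j\<le>m. mcoeff x y w i j * pcoeff x y W (l - i) (m - j))"
    unfolding pcoeff_def sum_negf sum_distrib_left
    by (subst sum.swap, rule arg_cong[of _ _ uminus], rule sum.cong[OF refl], subst sum.swap) simp
  also have "\<dots> = - (\<Sum>(i, j)\<in>{..l} \<times> {..m}. mcoeff x y w i j * pcoeff x y W (l - i) (m - j))"
    by (simp add: sum.cartesian_product)
  also have "(\<Sum>(i, j)\<in>{..l} \<times> {..m}. mcoeff x y w i j * pcoeff x y W (l - i) (m - j)) =
      pcoeff x y W l m +
      (\<Sum>(i, j)\<in>{..l} \<times> {..m} - {(0, 0)}. mcoeff x y w i j * pcoeff x y W (l - i) (m - j))"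
    by (subst sum.remove[of _ "(0, 0)"]) auto
  finally show ?thesis
    by (simp add: pcoeff_def)
qed

text \<open>A monomial order with weight 1 for \<^term>\<open>X\<close> and \<^term>\<open>\<mu>\<close> for \<^term>\<open>Y\<close>; varying
  \<^term>\<open>\<mu>\<close> makes different terms of the factors lead.\<close>

definition before :: "nat \<Rightarrow> nat \<Rightarrow> nat \<Rightarrow> nat \<Rightarrow> nat \<Rightarrow> bool" where
  "before \<mu> l m l' m' \<longleftrightarrow>
     l + \<mu> * m < l' + \<mu> * m' \<or> l + \<mu> * m = l' + \<mu> * m' \<and> l < l'"

definition lowest :: "nat \<Rightarrow> nat \<Rightarrow> (nat \<Rightarrow> nat \<Rightarrow> int) \<Rightarrow> nat \<Rightarrow> nat \<Rightarrow> bool" where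
  "lowest p \<mu> f L M \<longleftrightarrow>
     \<not> int p dvd f L M \<and> (\<forall>l m. before \<mu> l m L M \<longrightarrow> int p dvd f l m)"

text \<open>For \<^term>\<open>e\<close> the coefficients of \<^term>\<open>(1 + X) ^ x w * (1 + Y) ^ y w\<close>, whose constant term
  cancels in the factor.\<close>

definition leads :: "nat \<Rightarrow> nat \<Rightarrow> (nat \<Rightarrow> nat \<Rightarrow> int) \<Rightarrow> nat \<Rightarrow> nat \<Rightarrow> bool" where
  "leads p \<mu> e r t \<longleftrightarrow> (r, t) \<noteq> (0, 0) \<and> \<not> int p dvd e r t \<and>
     (\<forall>i j. (i, j) \<noteq> (0, 0) \<longrightarrow> before \<mu> i j r t \<longrightarrow> int p dvd e i j)"

lemma lowest_empty:
  assumes "prime p" shows "lowest p \<mu> (pcoeff x y {}) 0 0"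
  using assms prime_gt_1_nat[of p] by (auto simp: lowest_def pcoeff_empty before_def)

text \<open>The order is compatible with multiplication, so lowest monomials add, and the
  coefficient there is the product of two units modulo the prime.\<close>

lemma lowest_insert:
  assumes "prime p" "\<mu> > 0" "finite W" "w \<notin> W"
    and low: "lowest p \<mu> (pcoeff x y W) L M"
    and lead: "leads p \<mu> (mcoeff x y w) r t"
  shows "lowest p \<mu> (pcoeff x y (insert w W)) (L + r) (M + t)"
proof -
  let ?e = "mcoeff x y w" and ?f = "pcoeff x y W"
  have pp: "prime (int p)" using assms(1) by simp
  \<comment> \<open>Unless both cofactors are the lowest monomials themselves, one of them comes
    before the lowest monomial of its factor.\<close>
  have key: "int p dvd ?e i j * ?f (l - i) (m - j)"
    if "(i, j) \<noteq> (0, 0)" "i \<le> l" "j \<le> m"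
      "before \<mu> l m (L + r) (M + t) \<or> l = L + r \<and> m = M + t \<and> (i, j) \<noteq> (r, t)" for l m i j
  proof -
    obtain l' m' where lm: "l = i + l'" "m = j + m'"
      using \<open>i \<le> l\<close> \<open>j \<le> m\<close> le_Suc_ex by metis
    have "before \<mu> i j r t \<or> before \<mu> l' m' L M"
    proof (rule ccontr)
      assume "\<not> ?thesis"
      hence a: "r + \<mu> * t < i + \<mu> * j \<or> r + \<mu> * t = i + \<mu> * j \<and> r \<le> i"
        and b: "L + \<mu> * M < l' + \<mu> * m' \<or> L + \<mu> * M = l' + \<mu> * m' \<and> L \<le> l'"
        unfolding before_def by linarith+
      have e: "l + \<mu> * m = (i + \<mu> * j) + (l' + \<mu> * m')"
        "(L + r) + \<mu> * (M + t) = (r + \<mu> * t) + (L + \<mu> * M)"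
        by (simp_all add: lm algebra_simps)
      have nb: "\<not> before \<mu> l m (L + r) (M + t)"
        unfolding before_def using a b e lm by linarith
      with that(4) have c: "l = L + r" "m = M + t" "(i, j) \<noteq> (r, t)" by auto
      have "(i + \<mu> * j) + (l' + \<mu> * m') = (r + \<mu> * t) + (L + \<mu> * M)"
        using e c by simp
      hence "r + \<mu> * t = i + \<mu> * j" "r \<le> i" "L \<le> l'" using a b by linarith+
      hence "r = i" using c lm by linarith
      with \<open>r + \<mu> * t = i + \<mu> * j\<close> \<open>\<mu> > 0\<close> c(3) show False by simp
    qed
    moreover have "int p dvd ?e i j" if "before \<mu> i j r t"
      using lead that \<open>(i, j) \<noteq> (0, 0)\<close> unfolding leads_def by blast
    moreover have "int p dvd ?f l' m'" if "before \<mu> l' m' L M"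
      using low that unfolding lowest_def by blast
    ultimately show ?thesis by (auto simp: lm)
  qed
  have 1: "int p dvd pcoeff x y (insert w W) l m" if "before \<mu> l m (L + r) (M + t)" for l m
    unfolding pcoeff_insert[OF assms(3,4)] dvd_minus_iff
  proof (rule dvd_sum)
    fix z assume z: "z \<in> {..l} \<times> {..m} - {(0, 0)}"
    obtain i j where ij: "z = (i, j)" by (cases z)
    have "(i, j) \<noteq> (0, 0)" "i \<le> l" "j \<le> m" using z ij by auto
    hence "int p dvd ?e i j * ?f (l - i) (m - j)" using that by (intro key disjI1)
    thus "int p dvd (case z of (i, j) \<Rightarrow> ?e i j * ?f (l - i) (m - j))" by (simp add: ij)
  qed
  have 2: "\<not> int p dvd pcoeff x y (insert w W) (L + r) (M + t)"
  proof
    assume d: "int p dvd pcoeff x y (insert w W) (L + r) (M + t)"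
    let ?A = "{..L + r} \<times> {..M + t} - {(0, 0)}"
    have rt: "(r, t) \<in> ?A" using lead unfolding leads_def by auto
    have "pcoeff x y (insert w W) (L + r) (M + t) = - (?e r t * ?f L M +
        (\<Sum>(i, j)\<in>?A - {(r, t)}. ?e i j * ?f (L + r - i) (M + t - j)))"
      unfolding pcoeff_insert[OF assms(3,4)] by (subst sum.remove[OF _ rt]) auto
    with d have "int p dvd ?e r t * ?f L M +
        (\<Sum>(i, j)\<in>?A - {(r, t)}. ?e i j * ?f (L + r - i) (M + t - j))"
      by (simp only: dvd_minus_iff)
    moreover have "int p dvd (\<Sum>(i, j)\<in>?A - {(r, t)}. ?e i j * ?f (L + r - i) (M + t - j))"
    proof (rule dvd_sum)
      fix z assume z: "z \<in> ?A - {(r, t)}"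
      obtain i j where ij: "z = (i, j)" by (cases z)
      have "(i, j) \<noteq> (0, 0)" "i \<le> L + r" "j \<le> M + t" "(i, j) \<noteq> (r, t)" using z ij by auto
      hence "int p dvd ?e i j * ?f (L + r - i) (M + t - j)" by (intro key disjI2 conjI refl)
      thus "int p dvd (case z of (i, j) \<Rightarrow> ?e i j * ?f (L + r - i) (M + t - j))" by (simp add: ij)
    qed
    ultimately have "int p dvd ?e r t * ?f L M"
      using dvd_add_left_iff by blast
    thus False using low lead pp unfolding lowest_def leads_def by (simp add: prime_dvd_mult_iff)
  qed
  show ?thesis unfolding lowest_def using 1 2 by blast
qed

lemma lowest_union:
  assumes "prime p" "\<mu> > 0" "finite U" "finite W" "W \<inter> U = {}"
    and "lowest p \<mu> (pcoeff x y W) L M"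
    and "\<And>w. w \<in> U \<Longrightarrow> leads p \<mu> (mcoeff x y w) r t"
  shows "lowest p \<mu> (pcoeff x y (W \<union> U)) (L + card U * r) (M + card U * t)"
  using assms(3,5,7)
proof (induction U rule: finite_induct)
  case empty
  then show ?case using assms(6) by simp
next
  case (insert u U)
  have "lowest p \<mu> (pcoeff x y (insert u (W \<union> U))) (L + card U * r + r) (M + card U * t + t)"
    by (rule lowest_insert) (use insert assms in auto)
  then show ?case using insert.hyps by (simp add: algebra_simps)
qed

section \<open>Binomial coefficients modulo p and the resulting leading terms\<close>

lemma dvd_binomial_prime_power:
  assumes "prime p" "p ^ e dvd x" "0 < l" "l < p ^ e"
  shows "p dvd (x choose l)"
proof (rule ccontr)
  assume nd: "\<not> p dvd (x choose l)"
  have "l * (x choose l) = x * (x - 1 choose (l - 1))"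
    using \<open>0 < l\<close> binomial_absorption[of "l - 1" x] by simp
  hence "p ^ e dvd l * (x choose l)" using assms(2) by simp
  moreover have "coprime (p ^ e) (x choose l)"
    using nd assms(1) by (simp add: prime_imp_coprime)
  ultimately have "p ^ e dvd l" by (simp add: coprime_dvd_mult_left_iff)
  thus False using assms(3,4) by (simp add: dvd_imp_le leD)
qed

text \<open>Modulo p, C(n, q - 1) with q = p^e detects n = -1 modulo q; this turns a nonvanishing
  coefficient into a congruence. It follows from (n + 1) C(n, q - 1) = q C(n + 1, q).\<close>

lemma not_dvd_binomial_top:
  assumes "prime p" "\<not> p dvd (n choose (p ^ e - 1))"
  shows "p ^ e dvd Suc n"
proof -
  have pos: "p ^ e > 0" using assms(1) prime_gt_0_nat by simp
  have "Suc n * (n choose (p ^ e - 1)) = (Suc n choose (p ^ e)) * p ^ e"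
    using Suc_times_binomial_eq[of n "p ^ e - 1"] pos by (metis Suc_diff_1)
  hence "p ^ e dvd Suc n * (n choose (p ^ e - 1))" by simp
  moreover have "coprime (p ^ e) (n choose (p ^ e - 1))"
    using assms by (simp add: prime_imp_coprime)
  ultimately show ?thesis using coprime_dvd_mult_left_iff by blast
qed

text \<open>A case of Lucas' theorem. It identifies the coefficient of X^p in (1 + X)^(p x) with x
  modulo p, so leading forms see directions modulo p^2.\<close>

lemma binomial_mult_prime_cong:
  assumes "prime p"
  shows "int p dvd int ((p * x) choose p) - int x"
proof (cases "x = 0")
  case False
  have p0: "p > 0" "p > 1" using assms prime_gt_1_nat[of p] by auto
  let ?N = "p * x"
  have "p * (?N choose p) = ?N * (?N - 1 choose (p - 1))"
    using binomial_absorption[of "p - 1" ?N] p0 by simp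
  hence e1: "(?N choose p) = x * (?N - 1 choose (p - 1))" using p0 by simp
  obtain x' where x': "x = Suc x'" using False by (cases x) auto
  have split: "?N - 1 = (p - 1) + p * x'" using p0 by (simp add: x')
  have "(?N - 1 choose (p - 1)) = (\<Sum>k\<le>p - 1. ((p * x') choose k) * ((p - 1) choose (p - 1 - k)))"
    unfolding vandermonde using split by (simp add: add.commute)
  also have "\<dots> = 1 + (\<Sum>k\<in>{..p - 1} - {0}. ((p * x') choose k) * ((p - 1) choose (p - 1 - k)))"
    by (subst sum.remove[of _ 0]) auto
  finally have e2: "(?N - 1 choose (p - 1)) = 1 + (\<Sum>k\<in>{..p - 1} - {0}. ((p * x') choose k) * ((p - 1) choose (p - 1 - k)))" .
  have "p dvd (\<Sum>k\<in>{..p - 1} - {0}. ((p * x') choose k) * ((p - 1) choose (p - 1 - k)))"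
  proof (rule dvd_sum)
    fix k assume "k \<in> {..p - 1} - {0}"
    hence "0 < k" "k < p ^ 1" using p0 by auto
    hence "p dvd ((p * x') choose k)"
      by (intro dvd_binomial_prime_power[OF assms, of 1]) auto
    thus "p dvd ((p * x') choose k) * ((p - 1) choose (p - 1 - k))" by simp
  qed
  then obtain c where "(?N - 1 choose (p - 1)) = 1 + p * c" using e2 by (auto elim: dvdE)
  hence "int (?N choose p) - int x = int p * (int x * int c)"
    using e1 by (simp add: algebra_simps)
  thus ?thesis by simp
qed (use prime_gt_0_nat[OF assms] in \<open>simp add: binomial_eq_0\<close>)

lemma leads_Y:
  assumes "prime p" "\<mu> > 0" "t > 0" "\<not> p dvd (y w choose t)"
    and "\<And>m. 0 < m \<Longrightarrow> m < t \<Longrightarrow> p dvd (y w choose m)"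
    and "\<And>l. 0 < l \<Longrightarrow> l < \<mu> * t \<Longrightarrow> p dvd (x w choose l)"
  shows "leads p \<mu> (mcoeff x y w) 0 t"
  unfolding leads_def
proof (intro conjI allI impI)
  show "(0, t) \<noteq> (0, 0)" using assms by simp
  show "\<not> int p dvd mcoeff x y w 0 t" using assms(4) by (simp add: mcoeff_def)
  fix i j assume ij: "(i, j) \<noteq> (0, 0)" "before \<mu> i j 0 t"
  have lt: "i + \<mu> * j < \<mu> * t" using ij(2) unfolding before_def by auto
  show "int p dvd mcoeff x y w i j"
  proof (cases "i = 0")
    case True
    hence "0 < j" "j < t" using ij lt by auto
    thus ?thesis using assms(5)[of j] by (simp add: mcoeff_def)
  next
    case False
    hence "p dvd (x w choose i)" using lt by (intro assms(6)) auto
    thus ?thesis by (simp add: mcoeff_def)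
  qed
qed

text \<open>In contrast to \<open>leads_Y\<close> the bound on \<open>\<mu> * m\<close> is not
  strict: at equal weight a power of Y comes before a power of X.\<close>

lemma leads_X:
  assumes "prime p" "\<mu> > 0" "r > 0" "\<not> p dvd (x w choose r)"
    and "\<And>l. 0 < l \<Longrightarrow> l < r \<Longrightarrow> p dvd (x w choose l)"
    and "\<And>m. 0 < m \<Longrightarrow> \<mu> * m \<le> r \<Longrightarrow> p dvd (y w choose m)"
  shows "leads p \<mu> (mcoeff x y w) r 0"
  unfolding leads_def
proof (intro conjI allI impI)
  show "(r, 0) \<noteq> (0, 0)" using assms by simp
  show "\<not> int p dvd mcoeff x y w r 0" using assms(4) by (simp add: mcoeff_def)
  fix i j assume ij: "(i, j) \<noteq> (0, 0)" "before \<mu> i j r 0"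
  have lt: "i + \<mu> * j < r \<or> i + \<mu> * j = r \<and> i < r" using ij(2) unfolding before_def by auto
  show "int p dvd mcoeff x y w i j"
  proof (cases "j = 0")
    case True
    hence "0 < i" "i < r" using ij lt by auto
    thus ?thesis using assms(5)[of i] by (simp add: mcoeff_def)
  next
    case False
    hence "p dvd (y w choose j)" using lt by (intro assms(6)) auto
    thus ?thesis by (simp add: mcoeff_def)
  qed
qed

text \<open>The alternating sum \<open>N\<close> expands by Vandermonde into coefficients of the
  product, of which only the socle coefficient survives modulo p. So \<open>N\<close> is nonzero,
  and some subset has both of its binomials prime to p.\<close>

lemma subset_sums_cover:
  assumes "prime p" "q = p ^ e" "finite W"
    and top: "\<not> int p dvd pcoeff x y W (q - 1) (q - 1)"
    and low: "\<And>l m. l \<le> q - 1 \<Longrightarrow> m \<le> q - 1 \<Longrightarrow> (l, m) \<noteq> (q - 1, q - 1) \<Longrightarrow>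
                int p dvd pcoeff x y W l m"
  obtains S where "S \<subseteq> W" "q dvd Suc (u + sum x S)" "q dvd Suc (v + sum y S)"
proof -
  define N where "N = (\<Sum>S\<in>Pow W. (-1) ^ card S *
     int ((u + sum x S) choose (q - 1)) * int ((v + sum y S) choose (q - 1)))"
  let ?A = "{..q - 1} \<times> {..q - 1}"
  let ?c = "\<lambda>i j. int (u choose i) * int (v choose j)"
  have "N = (\<Sum>S\<in>Pow W. \<Sum>i\<le>q - 1. \<Sum>j\<le>q - 1. ?c i j *
     ((-1) ^ card S * int (sum x S choose (q - 1 - i)) * int (sum y S choose (q - 1 - j))))"
    unfolding N_def
  proof (rule sum.cong[OF refl])
    fix S
    have "int ((u + sum x S) choose (q - 1)) = (\<Sum>i\<le>q - 1. int (u choose i) * int (sum x S choose (q - 1 - i)))"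
      by (simp flip: vandermonde)
    moreover have "int ((v + sum y S) choose (q - 1)) = (\<Sum>i\<le>q - 1. int (v choose i) * int (sum y S choose (q - 1 - i)))"
      by (simp flip: vandermonde)
    ultimately show "(-1) ^ card S *
     int ((u + sum x S) choose (q - 1)) * int ((v + sum y S) choose (q - 1)) =
      (\<Sum>i\<le>q - 1. \<Sum>j\<le>q - 1. ?c i j *
     ((-1) ^ card S * int (sum x S choose (q - 1 - i)) * int (sum y S choose (q - 1 - j))))"
      by (simp add: sum_product sum_distrib_left sum_distrib_right mult_ac)
  qed
  also have "\<dots> = (\<Sum>i\<le>q - 1. \<Sum>S\<in>Pow W. \<Sum>j\<le>q - 1. ?c i j *
     ((-1) ^ card S * int (sum x S choose (q - 1 - i)) * int (sum y S choose (q - 1 - j))))"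
    by (rule sum.swap)
  also have "\<dots> = (\<Sum>i\<le>q - 1. \<Sum>j\<le>q - 1. \<Sum>S\<in>Pow W. ?c i j *
     ((-1) ^ card S * int (sum x S choose (q - 1 - i)) * int (sum y S choose (q - 1 - j))))"
    by (intro sum.cong refl sum.swap)
  also have "\<dots> = (\<Sum>i\<le>q - 1. \<Sum>j\<le>q - 1. ?c i j * pcoeff x y W (q - 1 - i) (q - 1 - j))"
    unfolding pcoeff_def by (simp add: sum_distrib_left)
  also have "\<dots> = (\<Sum>(i, j)\<in>?A. ?c i j * pcoeff x y W (q - 1 - i) (q - 1 - j))"
    by (simp add: sum.cartesian_product)
  also have "\<dots> = pcoeff x y W (q - 1) (q - 1) +
      (\<Sum>(i, j)\<in>?A - {(0, 0)}. ?c i j * pcoeff x y W (q - 1 - i) (q - 1 - j))"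
    by (subst sum.remove[of _ "(0, 0)"]) auto
  finally have N: "N = \<dots>" .
  have "int p dvd (\<Sum>(i, j)\<in>?A - {(0, 0)}. ?c i j * pcoeff x y W (q - 1 - i) (q - 1 - j))"
  proof (rule dvd_sum)
    fix z assume z: "z \<in> ?A - {(0, 0)}"
    obtain i j where ij: "z = (i, j)" by (cases z)
    have "i \<noteq> 0 \<or> j \<noteq> 0" "i \<le> q - 1" "j \<le> q - 1" using z ij by auto
    hence "(q - 1 - i, q - 1 - j) \<noteq> (q - 1, q - 1)" by (simp, linarith)
    hence "int p dvd pcoeff x y W (q - 1 - i) (q - 1 - j)" by (rule low[rotated 2]) simp_all
    thus "int p dvd (case z of (i, j) \<Rightarrow> ?c i j * pcoeff x y W (q - 1 - i) (q - 1 - j))"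
      by (simp add: ij)
  qed
  hence "\<not> int p dvd N" using top N by (simp add: dvd_add_left_iff)
  then obtain S where S: "S \<in> Pow W" "\<not> int p dvd (-1) ^ card S *
     int ((u + sum x S) choose (q - 1)) * int ((v + sum y S) choose (q - 1))"
    unfolding N_def by (meson dvd_sum)
  hence "\<not> p dvd ((u + sum x S) choose (q - 1))" "\<not> p dvd ((v + sum y S) choose (q - 1))"
    by (auto simp: mult.assoc)
  hence "q dvd Suc (u + sum x S)" "q dvd Suc (v + sum y S)"
    using not_dvd_binomial_top[OF assms(1)] assms(2) by auto
  thus ?thesis using that S(1) by blast
qed

section \<open>Extending products to the socle\<close>

text \<open>Proportionality of the leading forms
  \<^term>\<open>int (x w choose \<mu>) * X ^ \<mu> + int (y w) * Y\<close>.\<close>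

definition parallel :: "nat \<Rightarrow> nat \<Rightarrow> ('i \<Rightarrow> nat) \<Rightarrow> ('i \<Rightarrow> nat) \<Rightarrow> 'i \<Rightarrow> 'i \<Rightarrow> bool" where
  "parallel p \<mu> x y v w \<longleftrightarrow>
     int p dvd int (x v choose \<mu>) * int (y w) - int (x w choose \<mu>) * int (y v)"

text \<open>Weighted orders add, and the new factor has order at least \<open>\<mu>\<close>.\<close>

lemma pcoeff_low_insert:
  assumes "finite W" "w \<notin> W" "\<mu> > 0"
    and low: "\<And>l m. l + \<mu> * m < V \<Longrightarrow> int p dvd pcoeff x y W l m"
    and w: "\<And>i. 0 < i \<Longrightarrow> i < \<mu> \<Longrightarrow> p dvd (x w choose i)"
    and lm: "l + \<mu> * m < V + \<mu>"
  shows "int p dvd pcoeff x y (insert w W) l m"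
  unfolding pcoeff_insert[OF assms(1,2)] dvd_minus_iff
proof (rule dvd_sum)
  fix z assume z: "z \<in> {..l} \<times> {..m} - {(0, 0)}"
  obtain i j where ij: "z = (i, j)" by (cases z)
  have ij': "i > 0 \<or> j > 0" "i \<le> l" "j \<le> m" using z ij by auto
  have "int p dvd mcoeff x y w i j * pcoeff x y W (l - i) (m - j)"
  proof (cases "i + \<mu> * j < \<mu>")
    case True
    hence "j = 0" by (cases j) auto
    hence "p dvd (x w choose i)" using w[of i] ij' True by auto
    thus ?thesis by (simp add: mcoeff_def)
  next
    case False
    obtain l' m' where lm': "l = i + l'" "m = j + m'" using ij' le_Suc_ex by metis
    have "(i + \<mu> * j) + (l' + \<mu> * m') < V + \<mu>" using lm by (simp add: lm' algebra_simps)
    hence "l' + \<mu> * m' < V" using False by linarith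
    thus ?thesis using low by (simp add: lm')
  qed
  thus "int p dvd (case z of (i, j) \<Rightarrow> mcoeff x y w i j * pcoeff x y W (l - i) (m - j))"
    by (simp add: ij)
qed

text \<open>The only monomials of weight \<open>\<mu>\<close> are X^\<mu> and Y. Hence on initial
  forms the new factor acts as multiplication by a linear form in these two, up to sign; heavier
  terms meet a cofactor of weight below \<open>V\<close>.\<close>

lemma pcoeff_form_insert:
  assumes "finite W" "w \<notin> W" "\<mu> > 0"
    and low: "\<And>l m. l + \<mu> * m < V \<Longrightarrow> int p dvd pcoeff x y W l m"
    and w: "\<And>i. 0 < i \<Longrightarrow> i < \<mu> \<Longrightarrow> p dvd (x w choose i)"
    and lm: "l + \<mu> * m = V + \<mu>"
  shows "int p dvd pcoeff x y (insert w W) l m +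
           ((if \<mu> \<le> l then int (x w choose \<mu>) * pcoeff x y W (l - \<mu>) m else 0) +
            (if 1 \<le> m then int (y w) * pcoeff x y W l (m - 1) else 0))"
proof -
  let ?A = "{..l} \<times> {..m} - {(0, 0)}" and ?B = "{(\<mu>, 0), (0, 1)} :: (nat \<times> nat) set"
  let ?t = "\<lambda>(i, j). mcoeff x y w i j * pcoeff x y W (l - i) (m - j)"
  have "sum ?t ?A = sum ?t (?A \<inter> ?B) + sum ?t (?A - ?B)"
    by (rule sum.Int_Diff) simp
  moreover have "sum ?t (?A \<inter> ?B) =
        (if \<mu> \<le> l then int (x w choose \<mu>) * pcoeff x y W (l - \<mu>) m else 0) +
            (if 1 \<le> m then int (y w) * pcoeff x y W l (m - 1) else 0)"
  proof -
    have "sum ?t (?A \<inter> ?B) = sum ?t (?A \<inter> {(\<mu>, 0)}) + sum ?t (?A \<inter> {(0, 1)})"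
    proof -
      have "?A \<inter> ?B = (?A \<inter> {(\<mu>, 0)}) \<union> (?A \<inter> {(0, 1)})" by auto
      thus ?thesis using \<open>\<mu> > 0\<close> by (simp only:) (rule sum.union_disjoint, auto)
    qed
    moreover have "?A \<inter> {(\<mu>, 0)} = (if \<mu> \<le> l then {(\<mu>, 0)} else {})"
      "?A \<inter> {(0, 1)} = (if 1 \<le> m then {(0, 1)} else {})"
      using \<open>\<mu> > 0\<close> by auto
    ultimately show ?thesis by (cases "\<mu> \<le> l"; cases m) (simp_all add: mcoeff_def)
  qed
  moreover have "int p dvd sum ?t (?A - ?B)"
  proof (rule dvd_sum)
    fix z assume z: "z \<in> ?A - ?B"
    obtain i j where ij: "z = (i, j)" by (cases z)
    have ij': "i > 0 \<or> j > 0" "i \<le> l" "j \<le> m" "\<not> (i = \<mu> \<and> j = 0)" "\<not> (i = 0 \<and> j = 1)"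
      using z ij by auto
    have "int p dvd mcoeff x y w i j * pcoeff x y W (l - i) (m - j)"
    proof (cases "i + \<mu> * j < \<mu>")
      case True
      hence "j = 0" by (cases j) auto
      hence "p dvd (x w choose i)" using w[of i] ij' True by auto
      thus ?thesis by (simp add: mcoeff_def)
    next
      case False
      have ne: "i + \<mu> * j \<noteq> \<mu>"
      proof
        assume e: "i + \<mu> * j = \<mu>"
        show False
        proof (cases j)
          case (Suc j')
          hence "i + \<mu> * j' = 0" using e by simp
          thus False using ij' Suc \<open>\<mu> > 0\<close> by auto
        qed (use e ij' in auto)
      qed
      obtain l' m' where lm': "l = i + l'" "m = j + m'" using ij' le_Suc_ex by metis
      have "(i + \<mu> * j) + (l' + \<mu> * m') = V + \<mu>" using lm by (simp add: lm' algebra_simps)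
      hence "l' + \<mu> * m' < V" using False ne by linarith
      thus ?thesis using low by (simp add: lm')
    qed
    thus "int p dvd ?t z" by (simp add: ij)
  qed
  ultimately show ?thesis unfolding pcoeff_insert[OF assms(1,2)] by simp
qed

text \<open>Two independent linear forms can only both kill a nonzero form in the socle of
  the truncated polynomial ring, so the product can be extended as long as two directions remain.\<close>

lemma greedy:
  fixes x y :: "'i \<Rightarrow> nat"
  assumes "prime p" "\<mu> > 0" "\<mu> dvd q" "q > 0" "finite W" "finite G" "W \<inter> G = {}"
    and lowest: "lowest p \<mu> (pcoeff x y W) L M" and LM: "L \<le> q - 1" "M \<le> q - 1" "\<mu> dvd Suc L"
    and G: "\<And>w i. w \<in> G \<Longrightarrow> 0 < i \<Longrightarrow> i < \<mu> \<Longrightarrow> p dvd (x w choose i)"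
    and many: "\<And>w. w \<in> G \<Longrightarrow>
      (q - 1) * (1 + \<mu>) < L + \<mu> * M + \<mu> * card {v \<in> G. \<not> parallel p \<mu> x y v w}"
    and many': "(q - 1) * (1 + \<mu>) < L + \<mu> * M + \<mu> * card G"
  obtains W' w1 w2 where "W' \<subseteq> G" "w1 \<in> G - W'" "w2 \<in> G - W'" "\<not> parallel p \<mu> x y w1 w2"
    "\<not> int p dvd pcoeff x y (W \<union> W') (q - 1) (q - 1)"
    "\<And>l m. l \<le> q - 1 \<Longrightarrow> m \<le> q - 1 \<Longrightarrow> (l, m) \<noteq> (q - 1, q - 1) \<Longrightarrow>
        int p dvd pcoeff x y (W \<union> W') l m"
proof -
  have pp: "prime (int p)" using assms(1) by simp
  define V where "V U = L + \<mu> * M + \<mu> * card U" for U :: "'i set"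
  define f where "f U = pcoeff x y (W \<union> U)" for U
  \<comment> \<open>The initial form of weight \<open>V U\<close> survives the truncation at
    exponents above q - 1.\<close>
  define live where "live U \<longleftrightarrow> U \<subseteq> G \<and>
    (\<exists>l m. l \<le> q - 1 \<and> m \<le> q - 1 \<and> l + \<mu> * m = V U \<and> \<not> int p dvd f U l m)" for U
  have fin: "finite U" if "U \<subseteq> G" for U using that assms(6) finite_subset by auto
  have low: "int p dvd f U l m" if "U \<subseteq> G" "l + \<mu> * m < V U" for U l m
    using fin[OF that(1)] that
  proof (induction U arbitrary: l m rule: finite_induct)
    case empty
    thus ?case using lowest unfolding lowest_def before_def f_def V_def by simp
  next
    case (insert w U)
    have "int p dvd pcoeff x y (insert w (W \<union> U)) l m"
    proof (rule pcoeff_low_insert)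
      show "int p dvd pcoeff x y (W \<union> U) l m" if "l + \<mu> * m < V U" for l m
        using insert.IH[of l m] insert.prems that unfolding f_def by auto
      show "p dvd (x w choose i)" if "0 < i" "i < \<mu>" for i using G that insert by auto
      show "l + \<mu> * m < V U + \<mu>" using insert by (simp add: V_def)
    qed (use insert assms in auto)
    thus ?case by (simp add: f_def)
  qed
  have bound: "V U \<le> (q - 1) * (1 + \<mu>)" if lU: "live U" for U
  proof -
    obtain l m where "l \<le> q - 1" "m \<le> q - 1" "l + \<mu> * m = V U" using lU unfolding live_def by auto
    moreover from this have "\<mu> * m \<le> \<mu> * (q - 1)" by simp
    moreover have "(q - 1) * (1 + \<mu>) = (q - 1) + \<mu> * (q - 1)" by (simp only: distrib_left mult_1_right mult.commute)
    ultimately show ?thesis by linarith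
  qed
  have "live {}"
    using lowest LM unfolding live_def lowest_def V_def f_def by auto
  moreover have "\<forall>U. live U \<longrightarrow> card U < Suc (card G)"
    using card_mono[OF assms(6)] by (auto simp: live_def less_Suc_eq_le)
  ultimately obtain U where U: "live U" "\<And>U'. live U' \<Longrightarrow> card U' \<le> card U"
    using ex_has_greatest_nat[of live "{}" card "Suc (card G)"] by auto
  have UG: "U \<subseteq> G" using U(1) unfolding live_def by auto
  obtain l0 m0 where lm0: "l0 \<le> q - 1" "m0 \<le> q - 1" "l0 + \<mu> * m0 = V U" "\<not> int p dvd f U l0 m0"
    using U(1) unfolding live_def by auto
  have dead: "int p dvd (if \<mu> \<le> l then int (x w choose \<mu>) * f U (l - \<mu>) m else 0) +
            (if 1 \<le> m then int (y w) * f U l (m - 1) else 0)"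
    if w: "w \<in> G - U" and lm: "l \<le> q - 1" "m \<le> q - 1" "l + \<mu> * m = V U + \<mu>" for w l m
  proof -
    have c: "card (insert w U) = Suc (card U)" using w fin[OF UG] by simp
    hence "\<not> live (insert w U)" using U(2)[of "insert w U"] by auto
    hence "int p dvd f (insert w U) l m"
      using w lm UG c unfolding live_def V_def by (auto simp: algebra_simps)
    moreover have "int p dvd f (insert w U) l m +
           ((if \<mu> \<le> l then int (x w choose \<mu>) * f U (l - \<mu>) m else 0) +
            (if 1 \<le> m then int (y w) * f U l (m - 1) else 0))"
      unfolding f_def Un_insert_right
      by (rule pcoeff_form_insert[where V = "V U"])
         (use w lm UG fin assms low[OF UG] in \<open>auto simp: f_def\<close>)
    ultimately show ?thesis using dvd_add_right_iff by blast
  qed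
  \<comment> \<open>A live set weighs at most as much as the socle, so by \<open>many\<close> it
    cannot contain all vectors that are not parallel to some leftover \<open>w\<close>.\<close>
  have ex: "\<exists>w1\<in>G - U. \<exists>w2\<in>G - U. \<not> parallel p \<mu> x y w1 w2"
  proof (rule ccontr)
    assume np: "\<not> ?thesis"
    show False
    proof (cases "G - U = {}")
      case True
      hence "U = G" using UG by auto
      thus False using bound[OF U(1)] many' unfolding V_def by simp
    next
      case False
      then obtain w where w: "w \<in> G - U" by auto
      have "{v \<in> G. \<not> parallel p \<mu> x y v w} \<subseteq> U" using np w by auto
      hence "card {v \<in> G. \<not> parallel p \<mu> x y v w} \<le> card U" by (intro card_mono fin UG)
      hence "\<mu> * card {v \<in> G. \<not> parallel p \<mu> x y v w} \<le> \<mu> * card U" by simp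
      thus False using bound[OF U(1), unfolded V_def] many[OF DiffD1[OF w]] by linarith
    qed
  qed
  then obtain w1 w2 where w12: "w1 \<in> G - U" "w2 \<in> G - U" "\<not> parallel p \<mu> x y w1 w2" by auto
  let ?a = "\<lambda>w. int (x w choose \<mu>)" and ?b = "\<lambda>w. int (y w)"
  have kill: False if "int p dvd (?a w1 * ?b w2 - ?a w2 * ?b w1) * f U l0 m0"
    using that w12(3) lm0(4) pp by (simp add: prime_dvd_mult_iff parallel_def)
  \<comment> \<open>By maximality the forms of \<open>w1\<close> and \<open>w2\<close> both kill the
    initial form. If multiplication by Y stays inside the box, the two relations at that place
    involve the coefficient at (l0, m0) and one other; eliminating the latter leaves the determinant
    times the former.\<close>
  have m0: "m0 = q - 1"
  proof (rule ccontr)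
    assume "m0 \<noteq> q - 1"
    hence "m0 + 1 \<le> q - 1" using lm0 by simp
    define g where "g = (if \<mu> \<le> l0 then f U (l0 - \<mu>) (m0 + 1) else 0)"
    have "int p dvd ?a w * g + ?b w * f U l0 m0" if "w \<in> G - U" for w
      using dead[OF that lm0(1) \<open>m0 + 1 \<le> q - 1\<close>] lm0(3) by (auto simp: g_def algebra_simps split: if_splits)
    hence "int p dvd ?a w1 * (?a w2 * g + ?b w2 * f U l0 m0) - ?a w2 * (?a w1 * g + ?b w1 * f U l0 m0)"
      using w12 by (intro dvd_diff dvd_mult) auto
    thus False by (intro kill) (simp add: algebra_simps)
  qed
  have "\<not> l0 + \<mu> \<le> q - 1"
  proof
    assume le: "l0 + \<mu> \<le> q - 1"
    define g where "g = (if 1 \<le> m0 then f U (l0 + \<mu>) (m0 - 1) else 0)"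
    have "int p dvd ?a w * f U l0 m0 + ?b w * g" if "w \<in> G - U" for w
      using dead[OF that le lm0(2)] lm0(3) by (auto simp: g_def algebra_simps split: if_splits)
    hence "int p dvd ?b w2 * (?a w1 * f U l0 m0 + ?b w1 * g) - ?b w1 * (?a w2 * f U l0 m0 + ?b w2 * g)"
      using w12 by (intro dvd_diff dvd_mult) auto
    thus False by (intro kill) (simp add: algebra_simps)
  qed
  \<comment> \<open>The same elimination with X^\<mu> only confines \<open>l0\<close> to the last
    \<open>\<mu>\<close> exponents; the residue class inherited from \<open>L\<close> then singles
    out q - 1.\<close>
  moreover have "\<mu> dvd Suc l0"
  proof -
    have "Suc l0 + \<mu> * m0 = Suc L + \<mu> * (M + card U)" using lm0(3) by (simp add: V_def algebra_simps)
    hence "\<mu> dvd Suc l0 + \<mu> * m0" using LM(3) by (metis dvd_add dvd_triv_left)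
    thus ?thesis by (metis dvd_add_left_iff dvd_triv_left)
  qed
  ultimately have l0: "l0 = q - 1"
  proof -
    assume a: "\<not> l0 + \<mu> \<le> q - 1" and d: "\<mu> dvd Suc l0"
    have "\<mu> dvd q - Suc l0" using d assms(3) by (simp add: dvd_diff_nat)
    moreover have "q - Suc l0 < \<mu>" using a \<open>\<mu> > 0\<close> by linarith
    ultimately have "q - Suc l0 = 0" using dvd_imp_le[of \<mu> "q - Suc l0"] by linarith
    thus ?thesis using lm0(1) \<open>q > 0\<close> by linarith
  qed
  show ?thesis
  proof (rule that[of U w1 w2])
    show "\<not> int p dvd pcoeff x y (W \<union> U) (q - 1) (q - 1)" using lm0(4) m0 l0 by (simp add: f_def)
    fix l m assume lm: "l \<le> q - 1" "m \<le> q - 1" "(l, m) \<noteq> (q - 1, q - 1)"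
    have "l + \<mu> * m < (q - 1) + \<mu> * (q - 1)"
    proof (cases "m = q - 1")
      case True thus ?thesis using lm by auto
    next
      case False
      hence "\<mu> * m < \<mu> * (q - 1)" using lm \<open>\<mu> > 0\<close> by simp
      thus ?thesis using lm by linarith
    qed
    hence "l + \<mu> * m < V U" using lm0(3) l0 m0 by simp
    thus "int p dvd pcoeff x y (W \<union> U) l m" using low[OF UG] by (simp add: f_def)
  qed (use UG w12 in auto)
qed

section \<open>Zero sums from leading monomials\<close>

definition good :: "nat \<Rightarrow> nat \<Rightarrow> 'i set \<Rightarrow> ('i \<Rightarrow> int) \<Rightarrow> ('i \<Rightarrow> int) \<Rightarrow> bool" where
  "good p q I x y \<longleftrightarrow> (\<exists>S\<subseteq>I. int q dvd sum x S \<and> int q dvd sum y S \<and>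
     (\<exists>i\<in>S. \<exists>j\<in>S. \<not> int p dvd x i * y j - x j * y i))"

abbreviation natgood :: "nat \<Rightarrow> nat \<Rightarrow> 'i set \<Rightarrow> ('i \<Rightarrow> nat) \<Rightarrow> ('i \<Rightarrow> nat) \<Rightarrow> bool" where
  "natgood p q I x y \<equiv> good p q I (\<lambda>i. int (x i)) (\<lambda>i. int (y i))"

lemma good_swap:
  assumes "good p q I y x" shows "good p q I x y"
proof -
  obtain S i j where "S \<subseteq> I" "int q dvd sum x S" "int q dvd sum y S" "i \<in> S" "j \<in> S"
    "\<not> int p dvd y i * x j - y j * x i"
    using assms unfolding good_def by blast
  moreover have "y i * x j - y j * x i = x j * y i - x i * y j" by (simp add: mult.commute)
  ultimately show ?thesis unfolding good_def by metis
qed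

lemma good_shear:
  assumes "good p q I (\<lambda>i. x i + c * y i) y" shows "good p q I x y"
proof -
  obtain S i j where S: "S \<subseteq> I" "int q dvd (\<Sum>i\<in>S. x i + c * y i)" "int q dvd sum y S" "i \<in> S" "j \<in> S"
    "\<not> int p dvd (x i + c * y i) * y j - (x j + c * y j) * y i"
    using assms unfolding good_def by blast
  have "(\<Sum>i\<in>S. x i + c * y i) = sum x S + c * sum y S"
    by (simp add: sum.distrib sum_distrib_left)
  hence "int q dvd sum x S" using S(2,3) by (metis dvd_add_left_iff dvd_mult)
  moreover have "(x i + c * y i) * y j - (x j + c * y j) * y i = x i * y j - x j * y i"
    by (simp add: algebra_simps)
  ultimately show ?thesis using S unfolding good_def by metis
qed

lemma natgood_of_top:
  assumes "prime p" "q = p ^ e" "finite I" "W \<subseteq> I" "i \<in> I - W" "j \<in> I - W"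
    and det: "\<not> int p dvd int (x i) * int (y j) - int (x j) * int (y i)"
    and top: "\<not> int p dvd pcoeff x y W (q - 1) (q - 1)"
    and low: "\<And>l m. l \<le> q - 1 \<Longrightarrow> m \<le> q - 1 \<Longrightarrow> (l, m) \<noteq> (q - 1, q - 1) \<Longrightarrow>
                int p dvd pcoeff x y W l m"
  shows "natgood p q I x y"
proof -
  have q0: "q > 0" using assms(1,2) prime_gt_0_nat by simp
  have fW: "finite W" using assms(3,4) finite_subset by blast
  \<comment> \<open>The subset sum is to cancel vectors \<open>i\<close> and \<open>j\<close>; the
    summand \<open>q - 1\<close> absorbs the \<open>Suc\<close> of
    \<open>subset_sums_cover\<close>.\<close>
  obtain S where S: "S \<subseteq> W" "q dvd Suc (x i + x j + (q - 1) + sum x S)"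
    "q dvd Suc (y i + y j + (q - 1) + sum y S)"
    using subset_sums_cover[OF assms(1,2) fW top low] by blast
  have fS: "finite S" using S(1) fW finite_subset by blast
  have ij: "i \<noteq> j" using det by auto
  have "Suc (x i + x j + (q - 1) + sum x S) = (x i + x j + sum x S) + q"
    "Suc (y i + y j + (q - 1) + sum y S) = (y i + y j + sum y S) + q" using q0 by simp_all
  hence "q dvd (x i + x j + sum x S)" "q dvd (y i + y j + sum y S)"
    using S by (metis dvd_add_triv_right_iff)+
  moreover have "i \<notin> S" "j \<notin> S" using S(1) assms(5,6) by auto
  hence "sum f (insert i (insert j S)) = f i + f j + sum f S" for f :: "'a \<Rightarrow> nat"
    using fS ij by auto
  ultimately have "q dvd sum x (insert i (insert j S))" "q dvd sum y (insert i (insert j S))"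
    by metis+
  hence "int q dvd (\<Sum>i\<in>insert i (insert j S). int (x i))"
    "int q dvd (\<Sum>i\<in>insert i (insert j S). int (y i))"
    by (metis int_dvd_int_iff of_nat_sum)+
  moreover have "insert i (insert j S) \<subseteq> I" using S assms by auto
  ultimately show ?thesis unfolding good_def using det by blast
qed

text \<open>Among the monomials with both exponents at most q - 1 the socle has strictly the largest
  weight, so all others precede it.\<close>

lemma natgood_of_lowest:
  assumes "prime p" "q = p ^ e" "finite I" "W \<subseteq> I" "i \<in> I - W" "j \<in> I - W" "\<mu> > 0"
    and det: "\<not> int p dvd int (x i) * int (y j) - int (x j) * int (y i)"
    and low: "lowest p \<mu> (pcoeff x y W) (q - 1) (q - 1)"
  shows "natgood p q I x y"
proof (rule natgood_of_top[OF assms(1-6) det])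
  show "\<not> int p dvd pcoeff x y W (q - 1) (q - 1)" using low by (simp add: lowest_def)
  fix l m assume lm: "l \<le> q - 1" "m \<le> q - 1" "(l, m) \<noteq> (q - 1, q - 1)"
  have "l + \<mu> * m < (q - 1) + \<mu> * (q - 1)"
  proof (cases "m = q - 1")
    case True thus ?thesis using lm by auto
  next
    case False
    hence "\<mu> * m < \<mu> * (q - 1)" using lm \<open>\<mu> > 0\<close> by simp
    thus ?thesis using lm by linarith
  qed
  thus "int p dvd pcoeff x y W l m" using low unfolding lowest_def before_def by blast
qed

section \<open>Leading monomials according to divisibility by p and p^2\<close>

lemma prime_sq_not_dvd_choose:
  assumes "prime p" "p dvd x" "\<not> p\<^sup>2 dvd x" shows "\<not> p dvd (x choose p)"
proof
  assume d: "p dvd (x choose p)"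
  obtain a where a: "x = p * a" using assms(2) by auto
  have "int p dvd int (x choose p) - int a" using binomial_mult_prime_cong[OF assms(1)] a by simp
  moreover have "int p dvd int (x choose p)" using d by simp
  ultimately have "int p dvd int (x choose p) - (int (x choose p) - int a)" by (rule dvd_diff[rotated])
  hence "p dvd a" by simp
  thus False using assms(3) a by (simp add: power2_eq_square)
qed

lemma leads_X1:
  assumes "prime p" "\<mu> > 0" "\<not> p dvd x w" "2 \<le> \<mu> \<or> p dvd y w"
  shows "leads p \<mu> (mcoeff x y w) 1 0"
proof (rule leads_X)
  fix m assume m: "0 < m" "\<mu> * m \<le> 1"
  hence "\<not> 2 \<le> \<mu>" by (cases m) auto
  moreover have "m \<le> \<mu> * m" using \<open>\<mu> > 0\<close> by simp
  hence "m = 1" using m by linarith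
  ultimately show "p dvd (y w choose m)" using assms(4) by auto
qed (use assms in auto)

lemma leads_Xp:
  assumes "prime p" "\<mu> > 0" "p dvd x w" "\<not> p\<^sup>2 dvd x w"
    and "2 \<le> \<mu> \<and> p dvd y w \<or> p\<^sup>2 dvd y w \<or> p < \<mu>"
  shows "leads p \<mu> (mcoeff x y w) p 0"
proof (rule leads_X)
  show "p > 0" using assms prime_gt_0_nat by simp
  show "\<not> p dvd (x w choose p)" using prime_sq_not_dvd_choose assms by blast
  show "p dvd (x w choose l)" if "0 < l" "l < p" for l
    using dvd_binomial_prime_power[OF assms(1), of 1] that assms(3) by simp
  fix m assume m: "0 < m" "\<mu> * m \<le> p"
  have mp: "m \<le> p" using m(2) \<open>\<mu> > 0\<close> le_trans[of m "\<mu> * m" p] by simp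
  have p1: "p > 1" using assms prime_gt_1_nat by simp
  consider "2 \<le> \<mu>" "p dvd y w" | "p\<^sup>2 dvd y w" | "p < \<mu>" using assms(5) by auto
  thus "p dvd (y w choose m)"
  proof cases
    case 1
    hence "2 * m \<le> \<mu> * m" by simp
    hence "m < p" using m by linarith
    thus ?thesis using dvd_binomial_prime_power[OF assms(1), of 1] 1 m by simp
  next
    case 2
    have "m < p ^ 2" using mp p1 by (simp add: power2_eq_square le_less_trans)
    thus ?thesis using dvd_binomial_prime_power[OF assms(1), of 2] 2 m by simp
  next
    case 3
    hence "\<mu> \<le> \<mu> * m" using m by simp
    thus ?thesis using 3 m by linarith
  qed
qed (use assms in auto)

lemma leads_Y1:
  assumes "prime p" "\<mu> > 0" "\<not> p dvd y w"
    and "\<mu> = 1 \<or> p dvd x w \<and> \<mu> \<le> p \<or> p\<^sup>2 dvd x w \<and> \<mu> \<le> p\<^sup>2"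
  shows "leads p \<mu> (mcoeff x y w) 0 1"
proof (rule leads_Y)
  fix l assume l: "0 < l" "l < \<mu> * 1"
  consider "p dvd x w" "\<mu> \<le> p" | "p\<^sup>2 dvd x w" "\<mu> \<le> p\<^sup>2" using assms(4) l by auto
  thus "p dvd (x w choose l)"
    by cases (use l dvd_binomial_prime_power[OF assms(1), of 1 "x w" l]
      dvd_binomial_prime_power[OF assms(1), of 2 "x w" l] in auto)
qed (use assms in auto)

lemma leads_Yp:
  assumes "prime p" "\<mu> > 0" "p dvd y w" "\<not> p\<^sup>2 dvd y w"
    and "\<mu> = 1 \<and> p dvd x w \<or> \<mu> \<le> p \<and> p\<^sup>2 dvd x w"
  shows "leads p \<mu> (mcoeff x y w) 0 p"
proof (rule leads_Y)
  show "p > 0" using assms prime_gt_0_nat by simp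
  show "\<not> p dvd (y w choose p)" using prime_sq_not_dvd_choose assms by blast
  show "p dvd (y w choose l)" if "0 < l" "l < p" for l
    using dvd_binomial_prime_power[OF assms(1), of 1] that assms(3) by simp
  fix l assume l: "0 < l" "l < \<mu> * p"
  consider "p dvd x w" "\<mu> = 1" | "p\<^sup>2 dvd x w" "\<mu> \<le> p" using assms(5) by auto
  thus "p dvd (x w choose l)"
  proof cases
    case 1
    thus ?thesis using l dvd_binomial_prime_power[OF assms(1), of 1 "x w" l] by simp
  next
    case 2
    have "\<mu> * p \<le> p * p" using 2 by (intro mult_le_mono1)
    hence "l < p * p" using l by linarith
    hence "l < p ^ 2" by (simp add: power2_eq_square)
    thus ?thesis using l 2 dvd_binomial_prime_power[OF assms(1), of 2 "x w" l] by simp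
  qed
qed (use assms in auto)

text \<open>With respect to the direction of the second axis modulo \<^term>\<open>p\<close>: the vectors in this direction
  (D) and not in this direction (N), among those not divisible by \<^term>\<open>p\<close> (0) and those divisible
  by \<^term>\<open>p\<close> but not by \<^term>\<open>p\<^sup>2\<close> (1).\<close>

definition N0 :: "nat \<Rightarrow> 'i set \<Rightarrow> ('i \<Rightarrow> 'a::comm_semiring_1) \<Rightarrow> ('i \<Rightarrow> 'a) \<Rightarrow> 'i set" where
  "N0 p I x y = {i \<in> I. \<not> of_nat p dvd x i}"

definition D0 :: "nat \<Rightarrow> 'i set \<Rightarrow> ('i \<Rightarrow> 'a::comm_semiring_1) \<Rightarrow> ('i \<Rightarrow> 'a) \<Rightarrow> 'i set" where
  "D0 p I x y = {i \<in> I. of_nat p dvd x i \<and> \<not> of_nat p dvd y i}"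

definition N1 :: "nat \<Rightarrow> 'i set \<Rightarrow> ('i \<Rightarrow> 'a::comm_semiring_1) \<Rightarrow> ('i \<Rightarrow> 'a) \<Rightarrow> 'i set" where
  "N1 p I x y = {i \<in> I. of_nat p dvd x i \<and> of_nat p dvd y i \<and> \<not> (of_nat p)\<^sup>2 dvd x i}"

definition D1 :: "nat \<Rightarrow> 'i set \<Rightarrow> ('i \<Rightarrow> 'a::comm_semiring_1) \<Rightarrow> ('i \<Rightarrow> 'a) \<Rightarrow> 'i set" where
  "D1 p I x y = {i \<in> I. (of_nat p)\<^sup>2 dvd x i \<and> of_nat p dvd y i \<and> \<not> (of_nat p)\<^sup>2 dvd y i}"

lemmas class_defs = N0_def D0_def N1_def D1_def

lemma class_sets:
  fixes x y :: "'i \<Rightarrow> 'a::comm_semiring_1"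
  shows "N0 p I x y \<subseteq> I" "D0 p I x y \<subseteq> I" "N1 p I x y \<subseteq> I" "D1 p I x y \<subseteq> I"
  "N0 p I x y \<inter> D0 p I x y = {}" "N0 p I x y \<inter> N1 p I x y = {}" "N0 p I x y \<inter> D1 p I x y = {}"
  "D0 p I x y \<inter> N1 p I x y = {}" "D0 p I x y \<inter> D1 p I x y = {}" "N1 p I x y \<inter> D1 p I x y = {}"
proof -
  have "of_nat p dvd z" if "(of_nat p)\<^sup>2 dvd z" for z :: 'a
    using that by (metis dvd_mult_left power2_eq_square)
  thus "N0 p I x y \<subseteq> I" "D0 p I x y \<subseteq> I" "N1 p I x y \<subseteq> I" "D1 p I x y \<subseteq> I"
  "N0 p I x y \<inter> D0 p I x y = {}" "N0 p I x y \<inter> N1 p I x y = {}" "N0 p I x y \<inter> D1 p I x y = {}"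
  "D0 p I x y \<inter> N1 p I x y = {}" "D0 p I x y \<inter> D1 p I x y = {}" "N1 p I x y \<inter> D1 p I x y = {}"
    by (auto simp: class_defs)
qed

lemma det_unit:
  fixes x y :: "'i \<Rightarrow> int"
  assumes "prime p" "i \<in> N0 p I x y" "j \<in> D0 p I x y"
  shows "\<not> int p dvd x i * y j - x j * y i"
proof -
  have "int p dvd x j * y i" "\<not> int p dvd x i * y j"
    using assms by (auto simp: class_defs prime_dvd_mult_iff)
  thus ?thesis by (metis diff_add_cancel dvd_add)
qed

lemma det_unit_nat:
  fixes x y :: "'i \<Rightarrow> nat"
  assumes "prime p" "i \<in> N0 p I x y" "j \<in> D0 p I x y"
  shows "\<not> int p dvd int (x i) * int (y j) - int (x j) * int (y i)"
  by (rule det_unit[of p i I _ _ j]) (use assms in \<open>auto simp: class_defs\<close>)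

section \<open>Products reaching the socle, by the distribution over the classes\<close>

lemma obtain_sub:
  assumes "n \<le> card A"
  obtains B where "B \<subseteq> A" "card B = n" "finite B"
proof -
  obtain B where "B \<subseteq> A" "card B = n" "finite B"
    using obtain_subset_with_card_n[OF assms] by blast
  thus ?thesis using that by blast
qed

text \<open>Fills the exponent q - 1 with \<open>n'\<close> linear terms and \<open>c'\<close> terms
  of degree p. If there are P - 1 of the latter, p - 1 linear ones complete them; otherwise all of
  the latter are used. Strictness of \<open>n' < n\<close> keeps a spare vector.\<close>

lemma digits:
  fixes p q P n c :: nat
  assumes "p > 0" "q = p * P" "P > 0" "p \<le> n" "q \<le> n + p * c"
  obtains n' c' where "n' < n" "c' \<le> c" "n' + p * c' = q - 1"
proof (cases "c \<ge> P - 1")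
  case True
  have "p * P = p * (P - 1) + p" using assms(3) mult_Suc_right[of p "P - 1"] by simp
  hence "p - 1 + p * (P - 1) = q - 1" using assms(1,2) by linarith
  thus ?thesis using True assms by (intro that[of "p - 1" "P - 1"]) auto
next
  case False
  have "p * Suc c \<le> p * P" using False by (intro mult_le_mono2) auto
  hence "p * c + p \<le> q" using assms by simp
  thus ?thesis using assms by (intro that[of "q - 1 - p * c" c]) auto
qed

text \<open>Weight 2 gives pure leading monomials: Y on \<open>D0\<close>, Y^p on \<open>D1\<close>,
  X on \<open>N0\<close>, X^p on \<open>N1\<close>. The two exponents are therefore filled
  independently, and one vector each of \<open>D0\<close> and \<open>N0\<close> is left as the
  independent pair.\<close>

lemma case_rich:
  fixes x y :: "'i \<Rightarrow> nat"
  assumes p: "prime p" "p \<ge> 3" and q: "q = p ^ e" "q = p * P" "P > 0" and I: "finite I"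
    and D: "p \<le> card (D0 p I x y)" "q \<le> card (D0 p I x y) + p * card (D1 p I x y)"
    and N: "p \<le> card (N0 p I x y)" "q \<le> card (N0 p I x y) + p * card (N1 p I x y)"
  shows "natgood p q I x y"
proof -
  let ?N0 = "N0 p I x y" and ?D0 = "D0 p I x y" and ?N1 = "N1 p I x y" and ?D1 = "D1 p I x y"
  note [simp] = class_sets[of p I x y]
  have p0: "p > 0" using p by simp
  have fin: "finite ?N0" "finite ?D0" using I class_sets(1,2) finite_subset by metis+
  obtain a b where ab: "a < card ?D0" "b \<le> card ?D1" "a + p * b = q - 1"
    using digits[OF p0 q(2,3) D] by blast
  obtain c d where cd: "c < card ?N0" "d \<le> card ?N1" "c + p * d = q - 1"
    using digits[OF p0 q(2,3) N] by blast
  obtain A where A: "A \<subseteq> ?D0" "card A = a" "finite A" using obtain_sub less_imp_le[OF ab(1)] by metis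
  obtain B where B: "B \<subseteq> ?D1" "card B = b" "finite B" using obtain_sub ab(2) by metis
  obtain C where C: "C \<subseteq> ?N0" "card C = c" "finite C" using obtain_sub less_imp_le[OF cd(1)] by metis
  obtain E where E: "E \<subseteq> ?N1" "card E = d" "finite E" using obtain_sub cd(2) by metis
  have "A \<noteq> ?D0" using A(2) ab(1) by auto
  then obtain j where j: "j \<in> ?D0" "j \<notin> A" using A(1) by blast
  have "C \<noteq> ?N0" using C(2) cd(1) by auto
  then obtain i where i: "i \<in> ?N0" "i \<notin> C" using C(1) by blast
  have l0: "lowest p 2 (pcoeff x y {}) 0 0" by (rule lowest_empty[OF p(1)])
  have l1: "lowest p 2 (pcoeff x y ({} \<union> A)) (0 + card A * 0) (0 + card A * 1)"
    by (rule lowest_union[OF p(1) _ _ _ _ l0]; (rule leads_Y1)?)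
       (use A p in \<open>auto simp: class_defs\<close>)
  have l2: "lowest p 2 (pcoeff x y ({} \<union> A \<union> B)) (0 + card A * 0 + card B * 0) (0 + card A * 1 + card B * p)"
    by (rule lowest_union[OF p(1) _ _ _ _ l1]; (rule leads_Yp)?)
       (use A B p class_sets(9)[of p I x y] in \<open>auto simp: D1_def\<close>)
  have l3: "lowest p 2 (pcoeff x y ({} \<union> A \<union> B \<union> C)) (0 + card A * 0 + card B * 0 + card C * 1)
     (0 + card A * 1 + card B * p + card C * 0)"
    by (rule lowest_union[OF p(1) _ _ _ _ l2]; (rule leads_X1)?)
       (use A B C p class_sets(5,7)[of p I x y] in \<open>auto simp: N0_def\<close>)
  have l4: "lowest p 2 (pcoeff x y ({} \<union> A \<union> B \<union> C \<union> E)) (0 + card A * 0 + card B * 0 + card C * 1 + card E * p)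
     (0 + card A * 1 + card B * p + card C * 0 + card E * 0)"
    by (rule lowest_union[OF p(1) _ _ _ _ l3]; (rule leads_Xp)?)
       (use A B C E p class_sets(6,8,10)[of p I x y] in \<open>auto simp: N1_def\<close>)
  have low: "lowest p 2 (pcoeff x y (A \<union> B \<union> C \<union> E)) (q - 1) (q - 1)"
    using l4 A(2) B(2) C(2) E(2) ab(3) cd(3) by (simp add: mult.commute)
  show ?thesis
  proof (rule natgood_of_lowest[OF p(1) q(1) I _ _ _ _ det_unit_nat[OF p(1) i(1) j(1)] low])
    show "A \<union> B \<union> C \<union> E \<subseteq> I" using A B C E class_sets(1-4)[of p I x y] by blast
    show "i \<in> I - (A \<union> B \<union> C \<union> E)"
      using i A B C E class_sets(1,5,6,7)[of p I x y] by blast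
    show "j \<in> I - (A \<union> B \<union> C \<union> E)"
      using j A B C E class_sets(2,5,8,9)[of p I x y] by blast
  qed simp
qed

text \<open>Modulo p^2 the determinant with \<open>j\<close> vanishes on \<open>D1\<close> and on
  multiples of p^2. On \<open>D0\<close> it is p times the determinant of the leading forms, by
  \<open>binomial_mult_prime_cong\<close>, so there it vanishes exactly on the parallel
  vectors.\<close>

lemma card_parallel_bound:
  fixes x y :: "'i \<Rightarrow> nat"
  assumes p: "prime p" and I: "finite I" and j: "j \<in> D0 p I x y"
    and many: "m \<le> card {i \<in> I. \<not> (int p)\<^sup>2 dvd int (x i) * int (y j) - int (x j) * int (y i)}"
  shows "m \<le> card (N0 p I x y) + card (N1 p I x y) + card {i \<in> D0 p I x y. \<not> parallel p p x y i j}"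
proof -
  let ?R = "{i \<in> D0 p I x y. \<not> parallel p p x y i j}"
  have "{i \<in> I. \<not> (int p)\<^sup>2 dvd int (x i) * int (y j) - int (x j) * int (y i)}
      \<subseteq> N0 p I x y \<union> N1 p I x y \<union> ?R"
  proof
    fix i assume "i \<in> {i \<in> I. \<not> (int p)\<^sup>2 dvd int (x i) * int (y j) - int (x j) * int (y i)}"
    hence i: "i \<in> I" "\<not> (int p)\<^sup>2 dvd int (x i) * int (y j) - int (x j) * int (y i)" by auto
    show "i \<in> N0 p I x y \<union> N1 p I x y \<union> ?R"
    proof (rule ccontr)
      assume not: "i \<notin> N0 p I x y \<union> N1 p I x y \<union> ?R"
      hence xi: "p dvd x i" using i by (auto simp: class_defs)
      have xj: "p dvd x j" using j by (auto simp: class_defs)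
      show False
      proof (cases "p dvd y i")
        case True
        hence "p\<^sup>2 dvd x i" using not i xi by (auto simp: class_defs)
        hence "(int p)\<^sup>2 dvd int (x i)" by (metis int_dvd_int_iff of_nat_power)
        moreover have "(int p)\<^sup>2 dvd int (x j) * int (y i)"
          unfolding power2_eq_square using xj True by (intro mult_dvd_mono) auto
        ultimately show False using i by simp
      next
        case False
        hence par: "parallel p p x y i j" using not i xi by (auto simp: class_defs)
        obtain a b where ab: "x i = p * a" "x j = p * b" using xi xj unfolding dvd_def by blast
        let ?u = "int (x i choose p) - int a" and ?v = "int (x j choose p) - int b"
        have "int p dvd ?u" "int p dvd ?v" using binomial_mult_prime_cong[OF p] ab by auto
        hence "int p dvd (int (x i choose p) * int (y j) - int (x j choose p) * int (y i)) - (?u * int (y j) - ?v * int (y i))"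
          using par unfolding parallel_def by (meson dvd_diff dvd_mult2)
        hence "int p dvd int a * int (y j) - int b * int (y i)" by (simp add: algebra_simps)
        hence "int p * int p dvd int p * (int a * int (y j) - int b * int (y i))" by (rule mult_dvd_mono[OF dvd_refl])
        hence "(int p)\<^sup>2 dvd int (x i) * int (y j) - int (x j) * int (y i)"
          by (simp add: ab power2_eq_square algebra_simps)
        thus False using i by simp
      qed
    qed
  qed
  hence "card {i \<in> I. \<not> (int p)\<^sup>2 dvd int (x i) * int (y j) - int (x j) * int (y i)}
      \<le> card (N0 p I x y \<union> N1 p I x y \<union> ?R)"
    using I by (intro card_mono) (auto simp: class_defs)
  also have "\<dots> \<le> card (N0 p I x y) + card (N1 p I x y) + card ?R"
    by (meson add_le_mono1 card_Un_le le_trans)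
  finally show ?thesis using many by linarith
qed

text \<open>With x j = p b, solve b + (c / p) y j = 0 modulo p; the factor \<open>p - 1\<close>
  plays the role of -1 in the naturals. As p divides \<open>c\<close>, the shear does not change x
  modulo p.\<close>

lemma obtain_cancelling_shear:
  fixes x y :: "'i \<Rightarrow> nat"
  assumes p: "prime p" and j: "j \<in> D0 p I x y"
  obtains c where "p dvd c" "p\<^sup>2 dvd x j + c * y j"
proof -
  have "coprime (y j) p" using assms by (auto simp: class_defs prime_imp_coprime coprime_commute)
  then obtain z where z: "[y j * z = 1] (mod p)" using cong_solve_coprime_nat[of "y j" p] by auto
  obtain b where b: "x j = p * b" using j by (auto simp: class_defs)
  have p1: "p > 1" using p prime_gt_1_nat by simp
  define c where "c = p * (z * b * (p - 1))"
  have "[b + z * b * (p - 1) * y j = b + b * (p - 1) * 1] (mod p)"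
    using cong_mult[OF cong_refl z, of "b * (p - 1)"]
    by (intro cong_add cong_refl) (simp add: mult_ac)
  moreover have "b + b * (p - 1) * 1 = p * b" using p1 by (cases p) auto
  ultimately have "p dvd b + z * b * (p - 1) * y j"
    by (metis cong_dvd_iff dvd_triv_left)
  hence "p * p dvd p * (b + z * b * (p - 1) * y j)" by (rule mult_dvd_mono[OF dvd_refl])
  hence "p\<^sup>2 dvd x j + c * y j" by (simp add: b c_def power2_eq_square algebra_simps)
  thus ?thesis using that[of c] by (simp add: c_def)
qed

text \<open>Weight \<^term>\<open>p + 1\<close> separates the vectors of \<^term>\<open>D0\<close> further: after a shear, those parallel
  to \<^term>\<open>j\<close> modulo \<^term>\<open>p\<^sup>2\<close> lead with \<^term>\<open>Y\<close>, the others with \<^term>\<open>X ^ p\<close>.\<close>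

lemma case_concentrated_rich:
  fixes x y :: "'i \<Rightarrow> nat"
  assumes p: "prime p" and q: "q = p ^ e" "q = p * P" "P = p * h" "h > 0" and I: "finite I"
    and j: "j \<in> D0 p I x y"
    and par: "q \<le> card {i \<in> D0 p I x y. parallel p p x y i j}"
    and npar: "h \<le> card {i \<in> D0 p I x y. \<not> parallel p p x y i j}"
    and N: "q - P \<le> card (N0 p I x y)"
  shows "natgood p q I x y"
proof -
  obtain c where c: "p dvd c" "p\<^sup>2 dvd x j + c * y j" using obtain_cancelling_shear[OF p j] by blast
  define x' where "x' i = x i + c * y i" for i
  let ?N0 = "N0 p I x y" and ?D0 = "D0 p I x y"
  let ?Z = "{i \<in> ?D0. parallel p p x y i j}" and ?R = "{i \<in> ?D0. \<not> parallel p p x y i j}"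
  have fin: "finite ?N0" "finite ?D0" using I by (auto simp: class_defs)
  have p2: "p \<ge> 2" using p prime_ge_2_nat by simp
  have yj: "\<not> p dvd y j" "p dvd x j" using j by (auto simp: class_defs)
  have det: "int (x' u) * int (y v) - int (x' v) * int (y u) = int (x u) * int (y v) - int (x v) * int (y u)" for u v
    by (simp add: x'_def algebra_simps)
  have xp: "p dvd x' i \<longleftrightarrow> p dvd x i" for i
    using c(1) by (simp add: x'_def dvd_add_left_iff)
  \<comment> \<open>On \<open>D0\<close>, parallel to \<open>j\<close> means that the determinant
    with \<open>j\<close> is divisible by p^2. The shear makes \<open>x' j\<close> vanish modulo
    p^2, so \<open>x' i\<close> alone decides.\<close>
  have par_iff: "p\<^sup>2 dvd x' i \<longleftrightarrow> parallel p p x y i j" if i: "i \<in> ?D0" for i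
  proof -
    have xi: "p dvd x i" using i by (auto simp: class_defs)
    obtain a b where ab: "x i = p * a" "x j = p * b" using xi yj(2) unfolding dvd_def by blast
    let ?u = "int (x i choose p) - int a" and ?v = "int (x j choose p) - int b"
    have "int p dvd ?u" "int p dvd ?v" using binomial_mult_prime_cong[OF p] ab by auto
    hence d: "int p dvd ?u * int (y j) - ?v * int (y i)" by (meson dvd_diff dvd_mult2)
    have "int (x i choose p) * int (y j) - int (x j choose p) * int (y i) =
       (int a * int (y j) - int b * int (y i)) + (?u * int (y j) - ?v * int (y i))"
      by (simp add: algebra_simps)
    hence "parallel p p x y i j \<longleftrightarrow> int p dvd int a * int (y j) - int b * int (y i)"
      unfolding parallel_def using d by (metis dvd_add_left_iff)
    also have "\<dots> \<longleftrightarrow> int p * int p dvd int p * (int a * int (y j) - int b * int (y i))"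
      using p2 by simp
    also have "int p * (int a * int (y j) - int b * int (y i)) = int (x' i) * int (y j) - int (x' j) * int (y i)"
      unfolding det by (simp add: ab algebra_simps)
    also have "int p * int p dvd \<dots> \<longleftrightarrow> int p * int p dvd int (x' i) * int (y j)"
    proof -
      have "int (p\<^sup>2) dvd int (x' j)" unfolding int_dvd_int_iff x'_def by (rule c(2))
      hence "int p * int p dvd int (x' j) * int (y i)" by (simp add: power2_eq_square)
      thus ?thesis by (metis diff_add_cancel dvd_add_left_iff)
    qed
    also have "\<dots> \<longleftrightarrow> p\<^sup>2 dvd x' i * y j"
      by (metis int_dvd_int_iff of_nat_mult power2_eq_square)
    also have "\<dots> \<longleftrightarrow> p\<^sup>2 dvd x' i"
    proof -
      have "coprime (p\<^sup>2) (y j)" using p yj by (simp add: prime_imp_coprime)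
      thus ?thesis by (rule coprime_dvd_mult_left_iff)
    qed
    finally show ?thesis by simp
  qed
  \<comment> \<open>The exponent of X is made of h terms X^p, worth p h = P, and q - 1 - P linear
    ones.\<close>
  have Pp: "q - 1 = (q - 1 - P) + h * p" "q - 1 - P < q - P" "0 < q"
  proof -
    have "2 * P \<le> q" unfolding q(2) using p2 by (intro mult_le_mono1)
    moreover have "P > 0" using q(3,4) p2 by simp
    moreover have "h * p = P" using q(3) by (simp add: mult.commute)
    ultimately show "q - 1 = (q - 1 - P) + h * p" "q - 1 - P < q - P" "0 < q"
      by linarith+
  qed
  have le: "q - 1 \<le> card ?Z" "q - 1 - P \<le> card ?N0" using par N Pp by linarith+
  obtain Z where Z: "Z \<subseteq> ?Z" "card Z = q - 1" "finite Z" by (rule obtain_sub[OF le(1)])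
  obtain C where C: "C \<subseteq> ?N0" "card C = q - 1 - P" "finite C" by (rule obtain_sub[OF le(2)])
  obtain R where R: "R \<subseteq> ?R" "card R = h" "finite R" by (rule obtain_sub[OF npar])
  have "Z \<noteq> ?Z" using Z(2) par Pp by auto
  then obtain w where w: "w \<in> ?D0" "w \<notin> Z" "parallel p p x y w j" using Z(1) by blast
  have "C \<noteq> ?N0" using C(2) N Pp by auto
  then obtain i where i: "i \<in> ?N0" "i \<notin> C" using C(1) by blast
  have "2 * p \<le> p * p" using p2 by (intro mult_le_mono1)
  hence pp: "p + 1 \<le> p\<^sup>2" using p2 unfolding power2_eq_square by linarith
  have l0: "lowest p (p + 1) (pcoeff x' y {}) 0 0" by (rule lowest_empty[OF p(1)])
  have l1: "lowest p (p + 1) (pcoeff x' y ({} \<union> Z)) (0 + card Z * 0) (0 + card Z * 1)"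
    by (rule lowest_union[OF p(1) _ _ _ _ l0]; (rule leads_Y1)?)
       (use Z p pp par_iff in \<open>auto simp: D0_def\<close>)
  have l2: "lowest p (p + 1) (pcoeff x' y ({} \<union> Z \<union> R)) (0 + card Z * 0 + card R * p) (0 + card Z * 1 + card R * 0)"
    by (rule lowest_union[OF p(1) _ _ _ _ l1]; (rule leads_Xp)?)
       (use Z R p par_iff xp in \<open>auto simp: D0_def\<close>)
  have l3: "lowest p (p + 1) (pcoeff x' y ({} \<union> Z \<union> R \<union> C)) (0 + card Z * 0 + card R * p + card C * 1)
     (0 + card Z * 1 + card R * 0 + card C * 0)"
    by (rule lowest_union[OF p(1) _ _ _ _ l2]; (rule leads_X1)?)
       (use Z R C p p2 xp class_sets(5)[of p I x y] in \<open>auto simp: N0_def\<close>)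
  have low: "lowest p (p + 1) (pcoeff x' y (Z \<union> R \<union> C)) (q - 1) (q - 1)"
    using l3 Z(2) R(2) C(2) Pp(1) by (simp add: add.commute)
  have "natgood p q I x' y"
  proof (rule natgood_of_lowest[OF p(1) q(1) I _ _ _ _ _ low])
    show "Z \<union> R \<union> C \<subseteq> I" using Z R C class_sets(1,2)[of p I x y] by blast
    show "i \<in> I - (Z \<union> R \<union> C)"
      using i Z R C class_sets(1,5)[of p I x y] by blast
    show "w \<in> I - (Z \<union> R \<union> C)"
      using w Z R C class_sets(2,5)[of p I x y] by blast
    show "\<not> int p dvd int (x' i) * int (y w) - int (x' w) * int (y i)"
      unfolding det by (rule det_unit_nat[OF p i(1) w(1)])
  qed simp
  hence "good p q I (\<lambda>i. int (x i) + int c * int (y i)) (\<lambda>i. int (y i))"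
    by (simp add: x'_def)
  thus ?thesis by (rule good_shear)
qed

text \<open>The vectors outside the direction supply \<^term>\<open>X ^ (q - 1 - P)\<close> only; with weight \<^term>\<open>p\<close> the
  vectors of \<^term>\<open>D0\<close> become linear forms in \<^term>\<open>X ^ p\<close> and \<^term>\<open>Y\<close>, which fill in the rest.\<close>

lemma case_concentrated:
  fixes x y :: "'i \<Rightarrow> nat"
  assumes p: "prime p" "p \<ge> 5" and q: "q = p ^ e" "q = p * P" "P = p * h" "h > 0" and I: "finite I"
    and D: "p \<le> card (D0 p I x y)"
    and N: "q - P < card (N0 p I x y)" "card (N0 p I x y) + p * card (N1 p I x y) < q"
    and lev: "4 * (q - P) < card (N0 p I x y) + card (D0 p I x y) + card (N1 p I x y) + card (D1 p I x y)"
    and lift: "\<And>j. j \<in> D0 p I x y \<Longrightarrow>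
      2 * (q - P) < card {i \<in> I. \<not> (int p)\<^sup>2 dvd int (x i) * int (y j) - int (x j) * int (y i)}"
  shows "natgood p q I x y"
proof -
  let ?N0 = "N0 p I x y" and ?D0 = "D0 p I x y" and ?N1 = "N1 p I x y" and ?D1 = "D1 p I x y"
  let ?np = "\<lambda>j. {i \<in> ?D0. \<not> parallel p p x y i j}" and ?pa = "\<lambda>j. {i \<in> ?D0. parallel p p x y i j}"
  have fin: "finite ?N0" "finite ?D0" using I by (auto simp: class_defs)
  have ph: "5 * P \<le> q" "5 * h \<le> P" "p \<le> P" unfolding q(2) using p(2) q(3,4) by (auto intro: mult_le_mono1)
  have pP: "p * (P - 1) + p = q"
    using ph p q(2) mult_Suc_right[of p "P - 1"] by simp
  have N1: "card ?N1 \<le> p * card ?N1" using p(2) by simp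
  \<comment> \<open>Of the more than 2(q - P) vectors counted by \<open>lift\<close>, fewer than q
    lie in \<open>N0\<close> and \<open>N1\<close>.\<close>
  have np1: "q + 2 \<le> card (?np j) + 2 * P" if j: "j \<in> ?D0" for j
    using card_parallel_bound[OF p(1) I j, of "2 * (q - P) + 1"] lift[OF j] N N1 ph by linarith
  have split: "card ?D0 = card (?pa j) + card (?np j)" for j
  proof -
    have "?D0 = ?pa j \<union> ?np j" by auto
    thus ?thesis using card_Un_disjoint[of "?pa j" "?np j"] fin by auto
  qed
  show ?thesis
  proof (cases "\<exists>j\<in>?D0. q \<le> card (?pa j)")
    case True
    then obtain j where j: "j \<in> ?D0" "q \<le> card (?pa j)" by auto
    have "h \<le> card (?np j)" using np1[OF j(1)] ph by linarith
    thus ?thesis using case_concentrated_rich[OF p(1) q I j] N by simp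
  next
    case False
    \<comment> \<open>At most P - 1 factors leading with Y^p fit below the exponent q = p P.\<close>
    define E where "E = min (card ?D1) (P - 1)"
    have many: "q + h \<le> p * E + card (?np j)" if j: "j \<in> ?D0" for j
    proof (cases "card ?D1 \<ge> P - 1")
      case True
      hence "E = P - 1" by (simp add: E_def)
      hence "p * E + p = q" using pP by simp
      thus ?thesis using np1[OF j] ph q(4) by linarith
    next
      case f: False
      have "card (?pa j) < q" using False j by auto
      moreover have "card ?D1 \<le> p * E" using f p(2) by (simp add: E_def)
      ultimately show ?thesis using lev N N1 ph split[of j] by linarith
    qed
    have "P \<le> q" using ph by linarith
    have le: "E \<le> card ?D1" "q - 1 - P \<le> card ?N0" using N by (auto simp: E_def)
    obtain B where B: "B \<subseteq> ?D1" "card B = E" "finite B" by (rule obtain_sub[OF le(1)])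
    obtain C where C: "C \<subseteq> ?N0" "card C = q - 1 - P" "finite C" by (rule obtain_sub[OF le(2)])
    have "C \<noteq> ?N0" using C(2) N by auto
    then obtain i where i: "i \<in> ?N0" "i \<notin> C" using C(1) by blast
    have p0: "p > 0" using p by simp
    have l0: "lowest p p (pcoeff x y {}) 0 0" by (rule lowest_empty[OF p(1)])
    have l1: "lowest p p (pcoeff x y ({} \<union> B)) (0 + card B * 0) (0 + card B * p)"
      by (rule lowest_union[OF p(1) _ _ _ _ l0]; (rule leads_Yp)?)
         (use B p in \<open>auto simp: D1_def\<close>)
    have l2: "lowest p p (pcoeff x y ({} \<union> B \<union> C)) (0 + card B * 0 + card C * 1) (0 + card B * p + card C * 0)"
      by (rule lowest_union[OF p(1) _ _ _ _ l1]; (rule leads_X1)?)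
         (use B C p class_sets(7)[of p I x y] in \<open>auto simp: N0_def\<close>)
    have low: "lowest p p (pcoeff x y (B \<union> C)) (q - 1 - P) (p * E)"
      using l2 B(2) C(2) by (simp add: mult.commute)
    \<comment> \<open>The surplus \<open>h\<close>, at weight p per factor, repays precisely the P
      by which the exponent of X falls short.\<close>
    have big: "(q - 1) * (1 + p) < (q - 1 - P) + p * (p * E) + p * m" if "q + h \<le> p * E + m" for m
    proof -
      have "p * (q + h) \<le> p * (p * E + m)" using that by (rule mult_le_mono2)
      hence "p * q + P \<le> p * (p * E) + p * m" by (simp add: distrib_left q(3))
      moreover have "(q - 1) * (1 + p) = (q - 1) + p * (q - 1)" by (simp only: distrib_left mult_1_right mult.commute)
      moreover have "p * (q - 1) + p = p * q" using ph q(3,4) p by (cases q) auto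
      ultimately show ?thesis using ph q(3,4) p by linarith
    qed
    obtain j where j: "j \<in> ?D0" using D p by fastforce
    have sub: "card (?np j) \<le> card ?D0" using fin by (intro card_mono) auto
    show ?thesis
    proof (rule greedy[OF p(1) p0 _ _ _ fin(2) _ low])
      show "p dvd q" using q(2) by simp
      show "q > 0" using ph p by linarith
      show "finite (B \<union> C)" "(B \<union> C) \<inter> ?D0 = {}"
        using B C class_sets(5,9)[of p I x y] by blast+
      show "p * E \<le> q - 1"
      proof -
        have "p * E \<le> p * (P - 1)" by (simp add: E_def)
        thus ?thesis using pP p by linarith
      qed
      have "Suc (q - 1 - P) = q - P" using ph q(3,4) p by linarith
      moreover have "p dvd q" "p dvd P" using q(2) dvd_triv_left[of p h] unfolding q(3) by simp_all
      ultimately show "p dvd Suc (q - 1 - P)" by (metis dvd_diff_nat)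
      show "p dvd (x w choose l)" if "w \<in> ?D0" "0 < l" "l < p" for w l
        using dvd_binomial_prime_power[OF p(1), of 1 "x w" l] that by (auto simp: class_defs)
      show "(q - 1) * (1 + p) < (q - 1 - P) + p * (p * E) + p * card (?np w)" if "w \<in> ?D0" for w
        by (rule big[OF many[OF that]])
      show "(q - 1) * (1 + p) < (q - 1 - P) + p * (p * E) + p * card ?D0"
        by (rule big) (use many[OF j] sub in linarith)
      fix W' w1 w2
      assume W': "W' \<subseteq> ?D0" "w1 \<in> ?D0 - W'" "w2 \<in> ?D0 - W'"
        and top: "\<not> int p dvd pcoeff x y (B \<union> C \<union> W') (q - 1) (q - 1)"
        and rest: "\<And>l m. l \<le> q - 1 \<Longrightarrow> m \<le> q - 1 \<Longrightarrow> (l, m) \<noteq> (q - 1, q - 1) \<Longrightarrow>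
          int p dvd pcoeff x y (B \<union> C \<union> W') l m"
      show ?thesis
      proof (rule natgood_of_top[OF p(1) q(1) I _ _ _ _ top rest])
        show "B \<union> C \<union> W' \<subseteq> I" using B C W' class_sets(1-4)[of p I x y] by blast
        show "i \<in> I - (B \<union> C \<union> W')" using i B C W' class_sets(1,5,7)[of p I x y] by blast
        show "w1 \<in> I - (B \<union> C \<union> W')" using W' B C class_sets(2,5,9)[of p I x y] by blast
        show "\<not> int p dvd int (x i) * int (y w1) - int (x w1) * int (y i)"
          using det_unit_nat[OF p(1) i(1)] W' by blast
      qed auto
    qed simp
  qed
qed

text \<open>\<open>D1\<close> fills one exponent up to q - p and \<open>N0\<close> fills the other;
  \<open>U\<close> and \<open>V\<close> provide the missing p - 1. Since the vectors of
  \<open>U\<close> are independent of those of \<open>V\<close>, at least p vectors of the union are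
  not parallel to any given one, as \<open>greedy\<close> requires.\<close>

lemma case_level_one:
  fixes x y :: "'i \<Rightarrow> nat"
  assumes p: "prime p" "p \<ge> 5" and q: "q = p ^ e" "q = p * P" "P > 0" and I: "finite I"
    and D: "P - 1 \<le> card (D1 p I x y)" and N: "q + 2 * p \<le> card (N0 p I x y)"
    and U: "U \<subseteq> N0 p I x y \<union> D0 p I x y" "card U = p"
    and V: "V \<subseteq> N0 p I x y \<union> D0 p I x y" "card V = p"
    and UV: "\<And>i j. i \<in> U \<Longrightarrow> j \<in> V \<Longrightarrow> \<not> int p dvd int (x i) * int (y j) - int (x j) * int (y i)"
  shows "natgood p q I x y"
\<comment> \<open>At weight 1 ties go to Y, so after the swap a vector of \<open>N0\<close> leads
  with its coordinate that is prime to p, whatever the other one is.\<close>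
proof (rule good_swap)
  let ?N0 = "N0 p I x y" and ?D0 = "D0 p I x y" and ?N1 = "N1 p I x y" and ?D1 = "D1 p I x y"
  have fin: "finite ?N0" "finite ?D0" using I by (auto simp: class_defs)
  hence finUV: "finite U" "finite V" using U(1) V(1) finite_subset by (metis finite_UnI)+
  have p0: "p > 0" "q > 0" using p q by auto
  have pP: "p * (P - 1) + p = q" using q(2,3) mult_Suc_right[of p "P - 1"] by simp
  have "card (?N0 - (U \<union> V)) \<ge> card ?N0 - card (U \<union> V)"
    using finUV by (intro diff_card_le_card_Diff) auto
  hence le: "q - 1 \<le> card (?N0 - (U \<union> V))"
    using card_Un_le[of U V] U(2) V(2) N by linarith
  obtain B where B: "B \<subseteq> ?D1" "card B = P - 1" "finite B" by (rule obtain_sub[OF D])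
  obtain C where C: "C \<subseteq> ?N0 - (U \<union> V)" "card C = q - 1" "finite C" by (rule obtain_sub[OF le])
  have l0: "lowest p 1 (pcoeff y x {}) 0 0" by (rule lowest_empty[OF p(1)])
  have l1: "lowest p 1 (pcoeff y x ({} \<union> B)) (0 + card B * p) (0 + card B * 0)"
    by (rule lowest_union[OF p(1) _ _ _ _ l0]; (rule leads_Xp)?)
       (use B p in \<open>auto simp: D1_def\<close>)
  have l2: "lowest p 1 (pcoeff y x ({} \<union> B \<union> C)) (0 + card B * p + card C * 0) (0 + card B * 0 + card C * 1)"
    by (rule lowest_union[OF p(1) _ _ _ _ l1]; (rule leads_Y1)?)
       (use B C p class_sets(7)[of p I x y] in \<open>auto simp: N0_def\<close>)
  have low: "lowest p 1 (pcoeff y x (B \<union> C)) (p * (P - 1)) (q - 1)"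
    using l2 B(2) C(2) by (simp add: mult.commute)
  have par: "\<not> parallel p 1 y x v w" if "v \<in> U \<and> w \<in> V \<or> v \<in> V \<and> w \<in> U" for v w
  proof
    assume "parallel p 1 y x v w"
    hence d: "int p dvd int (y v) * int (x w) - int (y w) * int (x v)" by (simp add: parallel_def)
    hence d': "int p dvd int (y w) * int (x v) - int (y v) * int (x w)"
      by (metis dvd_minus_iff minus_diff_eq)
    show False using that UV[of v w] UV[of w v] d d' by (auto simp: mult.commute)
  qed
  have np: "p \<le> card {v \<in> U \<union> V. \<not> parallel p 1 y x v w}" if "w \<in> U \<union> V" for w
  proof (cases "w \<in> U")
    case True
    hence "card V \<le> card {v \<in> U \<union> V. \<not> parallel p 1 y x v w}"
      using par finUV by (intro card_mono) auto
    thus ?thesis using V(2) by simp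
  next
    case False
    hence "card U \<le> card {v \<in> U \<union> V. \<not> parallel p 1 y x v w}"
      using par finUV that by (intro card_mono) auto
    thus ?thesis using U(2) by simp
  qed
  have big: "(q - 1) * (1 + 1) < p * (P - 1) + 1 * (q - 1) + 1 * m" if "p \<le> m" for m
  proof -
    have "(q - 1) * (1 + 1) = (q - 1) + (q - 1)" by (simp only: distrib_left mult_1_right)
    thus ?thesis unfolding mult_1 using that pP p0 by linarith
  qed
  have "U \<noteq> {}" using U(2) p0 by auto
  then obtain u where u: "u \<in> U \<union> V" by auto
  have all: "card {v \<in> U \<union> V. \<not> parallel p 1 y x v u} \<le> card (U \<union> V)"
    using finUV by (intro card_mono) auto
  show "natgood p q I y x"
  proof (rule greedy[OF p(1) _ _ p0(2) _ _ _ low])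
    show "finite (B \<union> C)" "finite (U \<union> V)" using B C finUV by auto
    show "(B \<union> C) \<inter> (U \<union> V) = {}"
      using B C U(1) V(1) class_sets(5,7,9)[of p I x y] by blast
    show "p * (P - 1) \<le> q - 1" using pP p0 by linarith
    show "(q - 1) * (1 + 1) < p * (P - 1) + 1 * (q - 1) + 1 * card {v \<in> U \<union> V. \<not> parallel p 1 y x v w}"
      if "w \<in> U \<union> V" for w by (rule big[OF np[OF that]])
    show "(q - 1) * (1 + 1) < p * (P - 1) + 1 * (q - 1) + 1 * card (U \<union> V)"
      by (rule big) (use np[OF u] all in linarith)
    fix W' w1 w2
    assume W': "W' \<subseteq> U \<union> V" "w1 \<in> U \<union> V - W'" "w2 \<in> U \<union> V - W'" "\<not> parallel p 1 y x w1 w2"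
      and top: "\<not> int p dvd pcoeff y x (B \<union> C \<union> W') (q - 1) (q - 1)"
      and rest: "\<And>l m. l \<le> q - 1 \<Longrightarrow> m \<le> q - 1 \<Longrightarrow> (l, m) \<noteq> (q - 1, q - 1) \<Longrightarrow>
          int p dvd pcoeff y x (B \<union> C \<union> W') l m"
    have sub: "U \<union> V \<subseteq> I" using U(1) V(1) class_sets(1,2)[of p I x y] by blast
    have disj: "(U \<union> V) \<inter> (B \<union> C) = {}"
      using B C U(1) V(1) class_sets(5,7,9)[of p I x y] by blast
    show ?thesis
    proof (rule natgood_of_top[OF p(1) q(1) I _ _ _ _ top rest])
      show "B \<union> C \<union> W' \<subseteq> I" using B C W' sub class_sets(1,4)[of p I x y] by blast
      show "w1 \<in> I - (B \<union> C \<union> W')" "w2 \<in> I - (B \<union> C \<union> W')" using W' sub disj by blast+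
      show "\<not> int p dvd int (y w1) * int (x w2) - int (y w2) * int (x w1)"
        using W'(4) by (simp add: parallel_def)
    qed auto
  qed auto
qed

text \<open>All of \<open>D0\<close> and the chosen vectors divisible by p fit into the box as pure
  monomials. The vectors of \<open>N0\<close> then act as linear forms in \<open>greedy\<close>, and
  \<open>many\<close> says that those not parallel to a given one already push the degree past 2(q -
  1).\<close>

lemma case_level_zero:
  fixes x y :: "'i \<Rightarrow> nat"
  assumes p: "prime p" "p \<ge> 5" and q: "q = p ^ e" "q = p * P" "P > 0" and I: "finite I"
    and D: "card (D0 p I x y) + p * card (D1 p I x y) < q"
    and E: "E \<le> card (N1 p I x y) + card (D1 p I x y)" "E < P"
    and many: "\<And>w. w \<in> N0 p I x y \<Longrightarrow> 2 * q - 1 \<le> p * E + card (D0 p I x y) +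
      card {v \<in> N0 p I x y. \<not> int p dvd int (x v) * int (y w) - int (x w) * int (y v)}"
    and ne: "N0 p I x y \<noteq> {}"
  shows "natgood p q I x y"
proof (rule good_swap)
  let ?N0 = "N0 p I x y" and ?D0 = "D0 p I x y" and ?N1 = "N1 p I x y" and ?D1 = "D1 p I x y"
  have fin: "finite ?N0" "finite ?D0" "finite ?N1" "finite ?D1" using I by (auto simp: class_defs)
  have p0: "p > 0" "q > 0" using p q by auto
  have pP: "p * (P - 1) + p = q" using q(2,3) mult_Suc_right[of p "P - 1"] by simp
  have "card (?N1 \<union> ?D1) = card ?N1 + card ?D1"
    using fin class_sets(10)[of p I x y] by (intro card_Un_disjoint) auto
  hence le: "E \<le> card (?N1 \<union> ?D1)" using E by simp
  obtain A where A: "A \<subseteq> ?N1 \<union> ?D1" "card A = E" "finite A" by (rule obtain_sub[OF le])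
  let ?B = "A \<inter> ?D1" and ?C = "A \<inter> ?N1"
  have AE: "card ?B + card ?C = E"
  proof -
    have "A = ?B \<union> ?C" using A by auto
    moreover have "?B \<inter> ?C = {}" using class_sets(10)[of p I x y] by auto
    ultimately show ?thesis using card_Un_disjoint[of ?B ?C] A by auto
  qed
  have BC: "p * card ?B + p * card ?C = p * E" using AE by (metis distrib_left)
  have "p * card ?B \<le> p * card ?D1" using fin by (intro mult_le_mono2 card_mono) auto
  hence L: "card ?D0 + p * card ?B \<le> q - 1" using D by linarith
  have "p * card ?C \<le> p * (P - 1)" using AE E by (intro mult_le_mono2) linarith
  hence M: "p * card ?C \<le> q - 1" using pP p0 by linarith
  have l0: "lowest p 1 (pcoeff y x {}) 0 0" by (rule lowest_empty[OF p(1)])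
  have l1: "lowest p 1 (pcoeff y x ({} \<union> ?D0)) (0 + card ?D0 * 1) (0 + card ?D0 * 0)"
    by (rule lowest_union[OF p(1) _ _ _ _ l0]; (rule leads_X1)?)
       (use fin p in \<open>auto simp: D0_def\<close>)
  have l2: "lowest p 1 (pcoeff y x ({} \<union> ?D0 \<union> ?B)) (0 + card ?D0 * 1 + card ?B * p) (0 + card ?D0 * 0 + card ?B * 0)"
    by (rule lowest_union[OF p(1) _ _ _ _ l1]; (rule leads_Xp)?)
       (use A fin p class_sets(9)[of p I x y] in \<open>auto simp: D1_def\<close>)
  have l3: "lowest p 1 (pcoeff y x ({} \<union> ?D0 \<union> ?B \<union> ?C)) (0 + card ?D0 * 1 + card ?B * p + card ?C * 0)
     (0 + card ?D0 * 0 + card ?B * 0 + card ?C * p)"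
    by (rule lowest_union[OF p(1) _ _ _ _ l2]; (rule leads_Yp)?)
       (use A fin p class_sets(8,10)[of p I x y] in \<open>auto simp: N1_def\<close>)
  let ?W = "?D0 \<union> ?B \<union> ?C"
  have low: "lowest p 1 (pcoeff y x ?W) (card ?D0 + p * card ?B) (p * card ?C)"
    using l3 by (simp add: mult.commute)
  have par: "parallel p 1 y x v w \<longleftrightarrow> int p dvd int (x v) * int (y w) - int (x w) * int (y v)" for v w
  proof -
    have "int (y v) * int (x w) - int (y w) * int (x v) = - (int (x v) * int (y w) - int (x w) * int (y v))"
      by (simp add: mult.commute)
    thus ?thesis unfolding parallel_def choose_one by (metis dvd_minus_iff)
  qed
  have big: "(q - 1) * (1 + 1) < card ?D0 + p * card ?B + 1 * (p * card ?C) + 1 * m"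
    if "2 * q - 1 \<le> p * E + card ?D0 + m" for m
  proof -
    have "(q - 1) * (1 + 1) = (q - 1) + (q - 1)" by (simp only: distrib_left mult_1_right)
    thus ?thesis unfolding mult_1 using that BC p0 by linarith
  qed
  show "natgood p q I y x"
  proof (rule greedy[OF p(1) _ _ p0(2) _ fin(1) _ low L M])
    show "finite ?W" using A fin by auto
    show "?W \<inter> ?N0 = {}" using class_sets(5,6,7)[of p I x y] by blast
    show "(q - 1) * (1 + 1) < card ?D0 + p * card ?B + 1 * (p * card ?C) + 1 * card {v \<in> ?N0. \<not> parallel p 1 y x v w}"
      if "w \<in> ?N0" for w unfolding par by (rule big[OF many[OF that]])
    obtain w where w: "w \<in> ?N0" using ne by auto
    have "card {v \<in> ?N0. \<not> int p dvd int (x v) * int (y w) - int (x w) * int (y v)} \<le> card ?N0"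
      using fin by (intro card_mono) auto
    thus "(q - 1) * (1 + 1) < card ?D0 + p * card ?B + 1 * (p * card ?C) + 1 * card ?N0"
      by (intro big) (use many[OF w] in linarith)
    fix W' w1 w2
    assume W': "W' \<subseteq> ?N0" "w1 \<in> ?N0 - W'" "w2 \<in> ?N0 - W'" "\<not> parallel p 1 y x w1 w2"
      and top: "\<not> int p dvd pcoeff y x (?W \<union> W') (q - 1) (q - 1)"
      and rest: "\<And>l m. l \<le> q - 1 \<Longrightarrow> m \<le> q - 1 \<Longrightarrow> (l, m) \<noteq> (q - 1, q - 1) \<Longrightarrow>
          int p dvd pcoeff y x (?W \<union> W') l m"
    show ?thesis
    proof (rule natgood_of_top[OF p(1) q(1) I _ _ _ _ top rest])
      show "?W \<union> W' \<subseteq> I" using W' class_sets(1-4)[of p I x y] by blast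
      show "w1 \<in> I - (?W \<union> W')" "w2 \<in> I - (?W \<union> W')"
        using W' class_sets(1,5,6,7)[of p I x y] by blast+
      show "\<not> int p dvd int (y w1) * int (x w2) - int (y w2) * int (x w1)"
        using W'(4) by (simp add: parallel_def)
    qed auto
  qed auto
qed

section \<open>Zero sums in normalised systems\<close>

text \<open>Binomial coefficients call for natural exponents; the zero-sum condition and the classes
  depend only on residues modulo q.\<close>

definition red :: "nat \<Rightarrow> ('i \<Rightarrow> int) \<Rightarrow> 'i \<Rightarrow> nat" where
  "red q x i = nat (x i mod int q)"

lemma int_red: "q > 0 \<Longrightarrow> int (red q x i) = x i mod int q"
  by (simp add: red_def)

lemma red_dvd_iff:
  assumes "q > 0" "m dvd q" shows "m dvd red q x i \<longleftrightarrow> int m dvd x i"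
proof -
  have "m dvd red q x i \<longleftrightarrow> int m dvd x i mod int q"
    using int_red[OF assms(1), of x i] by (metis int_dvd_int_iff)
  thus ?thesis using assms(2) by (simp add: dvd_mod_iff)
qed

lemma red_det_dvd_iff:
  assumes "q > 0" "m dvd q"
  shows "int m dvd int (red q x i) * int (red q y j) - int (red q x j) * int (red q y i) \<longleftrightarrow>
    int m dvd x i * y j - x j * y i"
proof -
  have c: "[int (red q z u) = z u] (mod int m)" for z :: "'a \<Rightarrow> int" and u
    unfolding int_red[OF assms(1)] using assms(2) by (simp add: cong_def mod_mod_cancel)
  have "[int (red q x i) * int (red q y j) - int (red q x j) * int (red q y i) = x i * y j - x j * y i] (mod int m)"
    by (intro cong_diff cong_mult c)
  thus ?thesis by (rule cong_dvd_iff)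
qed

lemma red_class:
  assumes "q > 0" "p\<^sup>2 dvd q"
  shows "N0 p I (red q x) (red q y) = N0 p I x y" "D0 p I (red q x) (red q y) = D0 p I x y"
    "N1 p I (red q x) (red q y) = N1 p I x y" "D1 p I (red q x) (red q y) = D1 p I x y"
proof -
  have "p dvd q" using assms(2) by (metis dvd_mult_left power2_eq_square)
  note 1 = red_dvd_iff[OF assms(1) this] and 2 = red_dvd_iff[OF assms]
  show "N0 p I (red q x) (red q y) = N0 p I x y" "D0 p I (red q x) (red q y) = D0 p I x y"
    "N1 p I (red q x) (red q y) = N1 p I x y" "D1 p I (red q x) (red q y) = D1 p I x y"
    unfolding class_defs by (auto simp: 1 2)
qed

lemma good_of_natgood:
  assumes "q > 0" "p dvd q" and g: "natgood p q I (red q x) (red q y)"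
  shows "good p q I x y"
proof -
  obtain S i j where S: "S \<subseteq> I" "int q dvd (\<Sum>i\<in>S. int (red q x i))" "int q dvd (\<Sum>i\<in>S. int (red q y i))"
    "i \<in> S" "j \<in> S"
    "\<not> int p dvd int (red q x i) * int (red q y j) - int (red q x j) * int (red q y i)"
    using g unfolding good_def by blast
  have "int q dvd sum z S \<longleftrightarrow> int q dvd (\<Sum>i\<in>S. int (red q z i))" for z :: "'a \<Rightarrow> int"
    unfolding int_red[OF assms(1)] by (simp add: dvd_eq_mod_eq_0 mod_sum_eq)
  thus ?thesis using S unfolding good_def red_det_dvd_iff[OF assms(1,2)] by blast
qed

text \<open>Unimodular coordinates in which the direction \<^term>\<open>d\<close> of the projective line modulo
  \<^term>\<open>p\<close> (spanned by \<^term>\<open>(1, d)\<close>, or by \<^term>\<open>(0, 1)\<close> for \<^term>\<open>d = p\<close>) becomes the second axis.\<close>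

definition dirx :: "nat \<Rightarrow> nat \<Rightarrow> ('i \<Rightarrow> int) \<Rightarrow> ('i \<Rightarrow> int) \<Rightarrow> 'i \<Rightarrow> int" where
  "dirx p d a b i = (if d = p then a i else b i - int d * a i)"

definition diry :: "nat \<Rightarrow> nat \<Rightarrow> ('i \<Rightarrow> int) \<Rightarrow> ('i \<Rightarrow> int) \<Rightarrow> 'i \<Rightarrow> int" where
  "diry p d a b i = (if d = p then b i else a i)"

lemma dir_det_dvd_iff:
  "m dvd dirx p d a b i * diry p d a b j - dirx p d a b j * diry p d a b i \<longleftrightarrow> m dvd a i * b j - a j * b i"
proof (cases "d = p")
  case False
  hence "dirx p d a b i * diry p d a b j - dirx p d a b j * diry p d a b i = - (a i * b j - a j * b i)"
    by (simp add: dirx_def diry_def algebra_simps)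
  thus ?thesis by (metis dvd_minus_iff)
qed (simp add: dirx_def diry_def)

lemma dir_dvd_iff:
  "m dvd dirx p d a b i \<and> m dvd diry p d a b i \<longleftrightarrow> m dvd a i \<and> m dvd b i"
proof -
  have "m dvd b i" if "m dvd b i - int d * a i" "m dvd a i"
    using that by (metis diff_add_cancel dvd_add dvd_mult)
  thus ?thesis by (auto simp: dirx_def diry_def)
qed

lemma good_of_dir:
  assumes "good p q I (dirx p d a b) (diry p d a b)" shows "good p q I a b"
proof (cases "d = p")
  case True
  have "dirx p d a b = a" "diry p d a b = b" by (auto simp: fun_eq_iff dirx_def diry_def True)
  thus ?thesis using assms by simp
next
  case False
  have e: "dirx p d a b = (\<lambda>i. b i + (- int d) * a i)" "diry p d a b = a"
    using False by (auto simp: fun_eq_iff dirx_def diry_def)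
  have "good p q I b a" using assms unfolding e by (rule good_shear)
  thus ?thesis by (rule good_swap)
qed

lemma good_of_natgood_dir:
  assumes "q > 0" "p dvd q" "natgood p q I (red q (dirx p d a b)) (red q (diry p d a b))"
  shows "good p q I a b"
  by (rule good_of_dir, rule good_of_natgood[OF assms])

lemma direction_exists:
  assumes p: "prime p" and "\<not> (int p dvd u \<and> int p dvd v)"
  obtains d where "d \<le> p" "int p dvd (if d = p then u else v - int d * u)"
    "\<not> int p dvd (if d = p then v else u)"
proof (cases "int p dvd u")
  case True
  thus ?thesis using assms by (intro that[of p]) auto
next
  case False
  have p0: "int p > 0" using p prime_gt_0_nat by simp
  have "coprime u (int p)" using prime_imp_coprime[of "int p" u] False p by (simp add: coprime_commute)
  then obtain z where z: "[u * z = 1] (mod int p)" using cong_solve_coprime_int by blast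
  define d where "d = nat ((v * z) mod int p)"
  have d: "int d = (v * z) mod int p" using p0 by (simp add: d_def)
  hence "int d < int p" using p0 by simp
  have "[int d * u = (v * z) * u] (mod int p)" by (intro cong_mult cong_refl) (simp add: d cong_def)
  also have "(v * z) * u = v * (u * z)" by simp
  also have "[v * (u * z) = v * 1] (mod int p)" by (intro cong_mult cong_refl z)
  finally have "[v = int d * u] (mod int p)" by (simp add: cong_sym_eq)
  hence "int p dvd v - int d * u" by (simp add: cong_iff_dvd_diff)
  thus ?thesis using \<open>int d < int p\<close> False by (intro that[of d]) auto
qed

lemma pigeonhole_directions:
  fixes p m :: nat
  assumes "finite A" "\<And>i. i \<in> A \<Longrightarrow> \<exists>d\<le>p. i \<in> B d" "(p + 1) * m < card A"
    and "\<And>d. d \<le> p \<Longrightarrow> finite (B d)"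
  shows "\<exists>d\<le>p. m < card (B d)"
proof (rule ccontr)
  assume "\<not> ?thesis"
  hence le: "card (B d) \<le> m" if "d \<le> p" for d using that by (meson not_less)
  have "card A \<le> card (\<Union>d\<in>{..p}. B d)" using assms by (intro card_mono) auto
  also have "\<dots> \<le> (\<Sum>d\<le>p. card (B d))" by (rule card_UN_le) simp
  also have "\<dots> \<le> (\<Sum>d\<le>p. m)" using le by (intro sum_mono) auto
  finally show False using assms(3) by simp
qed

theorem good_of_normalised:
  fixes a b :: "'i \<Rightarrow> int"
  assumes p: "prime p" "p \<ge> 5" and q: "q = p ^ e" "q = p * P" "P = p * h" "h > 0" and I: "finite I"
    and level0: "2 * (q - P) < card {i \<in> I. \<not> (int p dvd a i \<and> int p dvd b i)}"
    and level1: "4 * (q - P) < card {i \<in> I. \<not> ((int p)\<^sup>2 dvd a i \<and> (int p)\<^sup>2 dvd b i)}"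
    and form0: "\<And>\<alpha> \<beta>. \<not> (int p dvd \<alpha> \<and> int p dvd \<beta>) \<Longrightarrow>
      q - P < card {i \<in> I. \<not> int p dvd \<alpha> * a i + \<beta> * b i}"
    and form1: "\<And>\<alpha> \<beta>. \<not> (int p dvd \<alpha> \<and> int p dvd \<beta>) \<Longrightarrow>
      2 * (q - P) < card {i \<in> I. \<not> (int p)\<^sup>2 dvd \<alpha> * a i + \<beta> * b i}"
  shows "good p q I a b"
proof -
  let ?x = "\<lambda>d. dirx p d a b" and ?y = "\<lambda>d. diry p d a b"
  let ?N0 = "\<lambda>d. N0 p I (?x d) (?y d)" and ?D0 = "\<lambda>d. D0 p I (?x d) (?y d)"
  let ?N1 = "\<lambda>d. N1 p I (?x d) (?y d)" and ?D1 = "\<lambda>d. D1 p I (?x d) (?y d)"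
  define A0 where "A0 = {i \<in> I. \<not> (int p dvd a i \<and> int p dvd b i)}"
  define A1 where "A1 = {i \<in> I. int p dvd a i \<and> int p dvd b i \<and> \<not> ((int p)\<^sup>2 dvd a i \<and> (int p)\<^sup>2 dvd b i)}"
  have fin: "finite (?N0 d)" "finite (?D0 d)" "finite (?N1 d)" "finite (?D1 d)" "finite A0" "finite A1" for d
    using I by (auto simp: class_defs A0_def A1_def)
  have q0: "q > 0" "p dvd q" "p\<^sup>2 dvd q" "P > 0"
    using p q(4) by (auto simp: q(2,3) power2_eq_square)
  note red = red_class[OF q0(1,3), of I]
  have ph: "5 * P \<le> q" "5 * h \<le> P" "p \<le> P" unfolding q(2) using p(2) q(3,4) by (auto intro: mult_le_mono1)
  have ph2: "P \<le> q" using ph by linarith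
  have pP: "p * (P - 1) + p = q"
    using ph p q(2) mult_Suc_right[of p "P - 1"] by simp
  have psq: "int p dvd z" if "(int p)\<^sup>2 dvd z" for z
    using that by (metis dvd_mult_left power2_eq_square)
  have A0: "A0 = ?N0 d \<union> ?D0 d" for d
    unfolding A0_def class_defs using dir_dvd_iff[of "int p" p d a b] by auto
  have A1: "A1 = ?N1 d \<union> ?D1 d" for d
  proof (rule Set.set_eqI)
    fix i show "i \<in> A1 \<longleftrightarrow> i \<in> ?N1 d \<union> ?D1 d"
      unfolding A1_def class_defs
      using dir_dvd_iff[of "int p" p d a b i] dir_dvd_iff[of "(int p)\<^sup>2" p d a b i] psq by auto
  qed
  have cA0: "card A0 = card (?N0 d) + card (?D0 d)" for d
    unfolding A0[of d] using fin class_sets(5) by (intro card_Un_disjoint)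
  have cA1: "card A1 = card (?N1 d) + card (?D1 d)" for d
    unfolding A1[of d] using fin class_sets(10) by (intro card_Un_disjoint)
  have lev0: "2 * (q - P) < card A0" using level0 by (simp add: A0_def)
  have lev1: "4 * (q - P) < card A0 + card A1"
  proof -
    have "{i \<in> I. \<not> ((int p)\<^sup>2 dvd a i \<and> (int p)\<^sup>2 dvd b i)} = A0 \<union> A1"
      using psq by (auto simp: A0_def A1_def)
    moreover have "card (A0 \<union> A1) \<le> card A0 + card A1" by (rule card_Un_le)
    ultimately show ?thesis using level1 by simp
  qed
  have dir0: "\<exists>d\<le>p. i \<in> ?D0 d" if "i \<in> A0" for i
  proof -
    have "\<not> (int p dvd a i \<and> int p dvd b i)" using that by (simp add: A0_def)
    then obtain d where d: "d \<le> p" "int p dvd (if d = p then a i else b i - int d * a i)"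
      "\<not> int p dvd (if d = p then b i else a i)"
      using direction_exists[OF p(1)] by blast
    hence "i \<in> ?D0 d" using that by (simp add: A0_def D0_def dirx_def diry_def)
    thus ?thesis using d(1) by blast
  qed
  have dir1: "\<exists>d\<le>p. i \<in> ?D1 d" if i: "i \<in> A1" for i
  proof -
    obtain u v where uv: "a i = int p * u" "b i = int p * v" using i unfolding A1_def dvd_def by blast
    have pp: "int p \<noteq> 0" using p by simp
    have sq: "(int p)\<^sup>2 dvd int p * z \<longleftrightarrow> int p dvd z" for z using pp by (simp add: power2_eq_square)
    have "\<not> (int p dvd u \<and> int p dvd v)" using i uv sq by (auto simp: A1_def)
    then obtain d where d: "d \<le> p" "int p dvd (if d = p then u else v - int d * u)"
      "\<not> int p dvd (if d = p then v else u)"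
      using direction_exists[OF p(1)] by blast
    have "dirx p d a b i = int p * (if d = p then u else v - int d * u)"
      "diry p d a b i = int p * (if d = p then v else u)"
      by (auto simp: dirx_def diry_def uv algebra_simps)
    hence "i \<in> ?D1 d" using d i sq by (auto simp: D1_def A1_def)
    thus ?thesis using d by blast
  qed
  have form: "q - P < card (?N0 d)" for d
  proof (cases "d = p")
    case True
    have "?N0 d = {i \<in> I. \<not> int p dvd 1 * a i + 0 * b i}" by (auto simp: N0_def dirx_def True)
    thus ?thesis using form0[of 1 0] p by simp
  next
    case False
    hence "?N0 d = {i \<in> I. \<not> int p dvd (- int d) * a i + 1 * b i}" by (auto simp: N0_def dirx_def algebra_simps)
    thus ?thesis using form0[of "- int d" 1] p by simp
  qed
  \<comment> \<open>Pigeonhole over p + 1 directions, as (p + 1)(p - 1) \<le> 2 P (p - 1) = 2(q -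
    P).\<close>
  have "\<exists>d\<le>p. p \<le> card (?D0 d)"
  proof -
    have "(p + 1) * (p - 1) \<le> 2 * p * (p - 1)" using p by (intro mult_le_mono1) simp
    also have "\<dots> \<le> 2 * P * (p - 1)" using ph by (intro mult_le_mono1) simp
    also have "\<dots> = 2 * (q - P)" unfolding q(2) by (simp add: algebra_simps diff_mult_distrib diff_mult_distrib2)
    finally have "(p + 1) * (p - 1) < card A0" using lev0 by linarith
    from pigeonhole_directions[OF fin(5) dir0 this fin(2)] obtain d where "d \<le> p" "p - 1 < card (?D0 d)" by blast
    thus ?thesis by (intro exI[of _ d]) auto
  qed
  then obtain d1 where d1: "d1 \<le> p" "p \<le> card (?D0 d1)" by blast
  show ?thesis
  proof (cases "\<exists>d\<le>p. p \<le> card (?D0 d) \<and> q \<le> card (?D0 d) + p * card (?D1 d)")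
    case True
    then obtain d where d: "p \<le> card (?D0 d)" "q \<le> card (?D0 d) + p * card (?D1 d)" by blast
    show ?thesis
    proof (cases "q \<le> card (?N0 d) + p * card (?N1 d)")
      case True
      have "natgood p q I (red q (?x d)) (red q (?y d))"
        by (rule case_rich[OF p(1) _ q(1,2) q0(4) I]; (unfold red)?) (use d True form[of d] ph p in linarith)+
      thus ?thesis by (rule good_of_natgood_dir[OF q0(1,2)])
    next
      case False
      have lift: "2 * (q - P) < card {i \<in> I. \<not> (int p)\<^sup>2 dvd ?x d i * ?y d j - ?x d j * ?y d i}"
        if "j \<in> ?D0 d" for j
      proof -
        have "j \<in> A0" using that A0 by blast
        \<comment> \<open>The determinant with \<open>j\<close> is the linear form with coefficients
          \<open>b j\<close> and \<open>- a j\<close>, primitive since \<open>j\<close> is nonzero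
          modulo p.\<close>
        hence "\<not> (int p dvd b j \<and> int p dvd - a j)" by (auto simp: A0_def)
        from form1[OF this] show ?thesis unfolding dir_det_dvd_iff by (simp add: mult.commute)
      qed
      have sq: "(int p)\<^sup>2 = int (p\<^sup>2)" by simp
      have "natgood p q I (red q (?x d)) (red q (?y d))"
        by (rule case_concentrated[OF p q I]; (unfold red sq red_det_dvd_iff[OF q0(1,3)])?)
           (use d False form[of d] lift lev1 cA0[of d] cA1[of d] in \<open>simp_all\<close>)
      thus ?thesis by (rule good_of_natgood_dir[OF q0(1,2)])
    qed
  next
    case False
    hence poor: "card (?D0 d) < p \<or> card (?D0 d) + p * card (?D1 d) < q" if "d \<le> p" for d
      using that by (meson not_le)
    show ?thesis
    \<comment> \<open>The threshold leaves room on both sides: below it \<open>A1\<close> has more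
      than (p + 1)(P - 1) elements, above it \<open>p * E + card A0\<close> reaches 3q - 2. If
      \<open>card A1 \<ge> P - 1\<close>, the latter rests on 5P + p \<le> q + 5, an equality for p
      = 5.\<close>
    proof (cases "card A0 + 5 * P \<le> 3 * q + 3")
      case True
      have "(p + 1) * (P - 1) = q - p + (P - 1)" using pP by (simp add: distrib_right)
      hence "(p + 1) * (P - 1) < card A1" using True lev1 ph p by linarith
      from pigeonhole_directions[OF fin(6) dir1 this fin(4)]
      obtain d0 where d0: "d0 \<le> p" "P - 1 < card (?D1 d0)" by blast
      have "p * P \<le> p * card (?D1 d0)" using d0 by (intro mult_le_mono2) linarith
      \<comment> \<open>P vectors of \<open>D1\<close> alone account for q, so \<open>d0\<close> can
        be poor only by having few vectors in \<open>D0\<close>.\<close>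
      hence c0: "card (?D0 d0) < p" using poor[OF d0(1)] q(2) by linarith
      have "p \<le> card (?N0 d1)" using form[of d1] ph by linarith
      then obtain U where U: "U \<subseteq> ?N0 d1" "card U = p" "finite U" by (rule obtain_sub)
      obtain V where V: "V \<subseteq> ?D0 d1" "card V = p" "finite V"
        by (rule obtain_sub[OF d1(2)])
      have UV: "\<not> int p dvd ?x d0 i * ?y d0 j - ?x d0 j * ?y d0 i" if "i \<in> U" "j \<in> V" for i j
        using det_unit[OF p(1), of i I "?x d1" "?y d1" j] that U V unfolding dir_det_dvd_iff by blast
      have UV0: "U \<subseteq> ?N0 d0 \<union> ?D0 d0" "V \<subseteq> ?N0 d0 \<union> ?D0 d0"
        using U V A0[of d0] A0[of d1] by blast+
      have nn: "q + 2 * p \<le> card (?N0 d0)" using cA0[of d0] c0 lev0 ph p by linarith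
      have "natgood p q I (red q (?x d0)) (red q (?y d0))"
        by (rule case_level_one[OF p q(1,2) q0(4) I _ _ _ U(2) _ V(2)]; (unfold red red_det_dvd_iff[OF q0(1,2)])?)
           (use d0 nn UV UV0 in auto)
      thus ?thesis by (rule good_of_natgood_dir[OF q0(1,2)])
    next
      case False
      define E where "E = min (card A1) (P - 1)"
      have small: "card (?D0 d) < q" if "d \<le> p" for d using poor[OF that] ph by linarith
      have poor1: "card (?D0 d1) + p * card (?D1 d1) < q" using poor[OF d1(1)] d1(2) by linarith
      have many: "2 * q - 1 \<le> p * E + card (?D0 d1) +
        card {v \<in> ?N0 d1. \<not> int p dvd ?x d1 v * ?y d1 w - ?x d1 w * ?y d1 v}" if w: "w \<in> ?N0 d1" for w
      proof -
        have "w \<in> A0" using w A0 by blast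
        \<comment> \<open>The vectors parallel to \<open>w\<close> modulo p all lie in its direction
          \<open>d2\<close>, which holds fewer than q of them.\<close>
        then obtain d2 where d2: "d2 \<le> p" "w \<in> ?D0 d2" using dir0 by blast
        let ?R = "{v \<in> ?N0 d1. \<not> int p dvd ?x d1 v * ?y d1 w - ?x d1 w * ?y d1 v}"
        have "?N0 d1 - ?D0 d2 \<subseteq> ?R"
        proof
          fix v assume v: "v \<in> ?N0 d1 - ?D0 d2"
          hence "v \<in> ?N0 d2" using A0[of d1] A0[of d2] by blast
          from det_unit[OF p(1) this d2(2)] show "v \<in> ?R"
            using v unfolding dir_det_dvd_iff by blast
        qed
        hence "card (?N0 d1 - ?D0 d2) \<le> card ?R" using fin by (intro card_mono) auto
        moreover have "card (?N0 d1) - card (?D0 d2) \<le> card (?N0 d1 - ?D0 d2)"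
          using fin by (intro diff_card_le_card_Diff) auto
        ultimately have R: "card (?N0 d1) \<le> card ?R + (q - 1)" using small[OF d2(1)] by linarith
        have "3 * q - 2 \<le> p * E + card A0"
        proof (cases "card A1 \<ge> P - 1")
          case True
          hence "p * E = p * (P - 1)" by (simp add: E_def)
          moreover have "5 * P + p \<le> q + 5"
          proof (cases "p = 5")
            case False
            hence "6 * P \<le> q" unfolding q(2) using p by (intro mult_le_mono1) simp
            thus ?thesis using ph by linarith
          qed (use q(2) in simp)
          ultimately show ?thesis using pP False by linarith
        next
          case f: False
          hence "card A1 \<le> p * E" using p by (simp add: E_def)
          thus ?thesis using lev1 ph by linarith
        qed
        thus ?thesis using R cA0[of d1] q0(1) by linarith
      qed
      have ne: "?N0 d1 \<noteq> {}" using form[of d1] by auto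
      have E: "E \<le> card (?N1 d1) + card (?D1 d1)" "E < P" using cA1[of d1] q0(4) by (auto simp: E_def)
      have "natgood p q I (red q (?x d1)) (red q (?y d1))"
        by (rule case_level_zero[OF p q(1,2) q0(4) I, where E = E]; (unfold red red_det_dvd_iff[OF q0(1,2)])?)
           (use poor1 E many ne in auto)
      thus ?thesis by (rule good_of_natgood_dir[OF q0(1,2)])
    qed
  qed
qed

section \<open>Lifting zero sums to p-adic solutions\<close>

lemma power_add_mod_square:
  fixes A h :: int
  shows "h\<^sup>2 dvd (A + h) ^ m - A ^ m - int m * h * A ^ (m - 1)"
proof (induction m)
  case (Suc m)
  have "(A + h) ^ Suc m - A ^ Suc m - int (Suc m) * h * A ^ (Suc m - 1)
      = (A + h) * ((A + h) ^ m - A ^ m - int m * h * A ^ (m - 1)) + h\<^sup>2 * (int m * A ^ (m - 1))"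
    by (cases m) (simp_all add: algebra_simps power2_eq_square)
  thus ?case using Suc by (metis dvd_add dvd_mult dvd_triv_left)
qed simp

text \<open>In the binomial expansion the terms with 1 < i < p gain a factor p from the binomial
  coefficient; the term i = p is small enough because n p \<ge> n + 2 for p \<ge> 3.\<close>

lemma power_prime_add_mod:
  fixes x t :: int
  assumes "prime p" "p \<ge> 3" "n \<ge> 1"
  shows "int p ^ (n + 2) dvd (x + int p ^ n * t) ^ p - x ^ p - int p ^ (n + 1) * t * x ^ (p - 1)"
proof -
  define h where "h = int p ^ n * t"
  let ?f = "\<lambda>i. of_nat (p choose i) * h ^ i * x ^ (p - i)"
  have "(x + h) ^ p = (\<Sum>i\<le>p. ?f i)"
    using binomial_ring[of h x p] by (simp add: add.commute)
  also have "\<dots> = ?f 0 + (?f 1 + (\<Sum>i\<in>{..p} - {0} - {1}. ?f i))"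
    using assms(2) by (subst sum.remove[of _ 0], simp, simp, subst sum.remove[of _ 1]) auto
  finally have e: "(x + h) ^ p - x ^ p - int p ^ (n + 1) * t * x ^ (p - 1) = (\<Sum>i\<in>{..p} - {0} - {1}. ?f i)"
    by (simp add: h_def algebra_simps)
  have "int p ^ (n + 2) dvd ?f i" if i: "i \<in> {..p} - {0} - {1}" for i
  proof (cases "i = p")
    case True
    have "3 * n \<le> n * p" using assms(2) by simp
    hence "n + 2 \<le> n * p" using assms(3) by linarith
    hence "int p ^ (n + 2) dvd (int p ^ n) ^ p" unfolding power_mult[symmetric] by (rule le_imp_power_dvd)
    thus ?thesis by (simp add: True h_def power_mult_distrib)
  next
    case False
    hence "p dvd (p choose i)" using i dvd_binomial_prime_power[OF assms(1), of 1 p i] by auto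
    hence 1: "int p dvd int (p choose i)" by simp
    have "2 * n \<le> n * i" using i by auto
    hence "n + 1 \<le> n * i" using assms(3) by linarith
    hence "int p ^ (n + 1) dvd (int p ^ n) ^ i" unfolding power_mult[symmetric] by (rule le_imp_power_dvd)
    hence "int p ^ (n + 1) dvd h ^ i" by (simp add: h_def power_mult_distrib)
    with 1 have "int p * int p ^ (n + 1) dvd int (p choose i) * h ^ i" by (rule mult_dvd_mono)
    thus ?thesis by simp
  qed
  hence "int p ^ (n + 2) dvd (\<Sum>i\<in>{..p} - {0} - {1}. ?f i)" by (rule dvd_sum)
  thus ?thesis using e by (simp add: h_def)
qed

lemma power_prime_power_add_mod:
  fixes x t :: int
  assumes "prime p" "p \<ge> 3" "n \<ge> 1"
  shows "int p ^ (n + \<tau> + 1) dvd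
           (x + int p ^ n * t) ^ (p ^ \<tau>) - x ^ (p ^ \<tau>) - int p ^ (n + \<tau>) * t * x ^ (p ^ \<tau> - 1)"
proof (induction \<tau>)
  case (Suc \<tau>)
  let ?P = "p ^ \<tau>" and ?y = "(x + int p ^ n * t) ^ (p ^ \<tau>)"
  obtain c where c: "?y - x ^ ?P - int p ^ (n + \<tau>) * t * x ^ (?P - 1) = int p ^ (n + \<tau> + 1) * c"
    using Suc by (auto elim: dvdE)
  define t' where "t' = t * x ^ (?P - 1) + int p * c"
  have y: "?y = x ^ ?P + int p ^ (n + \<tau>) * t'" using c by (simp add: t'_def algebra_simps)
  have "int p ^ (n + \<tau> + 2) dvd ?y ^ p - (x ^ ?P) ^ p - int p ^ (n + \<tau> + 1) * t' * (x ^ ?P) ^ (p - 1)"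
    unfolding y by (rule power_prime_add_mod) (use assms in auto)
  moreover have "int p ^ (n + \<tau> + 1) * t' * (x ^ ?P) ^ (p - 1)
      = int p ^ (n + \<tau> + 1) * t * x ^ (p ^ Suc \<tau> - 1) + int p ^ (n + \<tau> + 2) * (c * (x ^ ?P) ^ (p - 1))"
  proof -
    have P0: "?P > 0" using assms prime_gt_0_nat by simp
    have "?P * p = ?P * (p - 1) + ?P" using assms(2) mult_Suc_right[of ?P "p - 1"] by simp
    moreover have "p ^ Suc \<tau> = ?P * p" by simp
    ultimately have "(?P - 1) + ?P * (p - 1) = p ^ Suc \<tau> - 1" using P0 by linarith
    hence "x ^ (?P - 1) * (x ^ ?P) ^ (p - 1) = x ^ (p ^ Suc \<tau> - 1)"
      by (metis power_add power_mult)
    thus ?thesis by (simp add: t'_def algebra_simps)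
  qed
  ultimately have "int p ^ (n + \<tau> + 2) dvd (?y ^ p - (x ^ ?P) ^ p - int p ^ (n + \<tau> + 1) * t * x ^ (p ^ Suc \<tau> - 1))
       - int p ^ (n + \<tau> + 2) * (c * (x ^ ?P) ^ (p - 1))"
    by (simp add: algebra_simps)
  hence "int p ^ (n + \<tau> + 2) dvd ?y ^ p - (x ^ ?P) ^ p - int p ^ (n + \<tau> + 1) * t * x ^ (p ^ Suc \<tau> - 1)"
    by (metis dvd_diff_commute dvd_diff_right_iff dvd_triv_left)
  thus ?case by (simp add: mult.commute flip: power_mult)
qed simp

text \<open>Each p-th power shifts the first-order term by one power of p, so an increment divisible
  by p^n is felt in x^k only from p^(n + \<tau>) on. With n = 1 this is the origin of the modulus
  p^(\<tau> + 1).\<close>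

lemma power_add_mod:
  fixes x t :: int
  assumes "prime p" "p \<ge> 3" "n \<ge> 1" "k = p ^ \<tau> * m" "m > 0"
  shows "int p ^ (n + \<tau> + 1) dvd
           (x + int p ^ n * t) ^ k - x ^ k - int p ^ (n + \<tau>) * (int m * t * x ^ (k - 1))"
proof -
  let ?P = "p ^ \<tau>" and ?y = "(x + int p ^ n * t) ^ (p ^ \<tau>)"
  obtain c where c: "?y - x ^ ?P - int p ^ (n + \<tau>) * t * x ^ (?P - 1) = int p ^ (n + \<tau> + 1) * c"
    using power_prime_power_add_mod[OF assms(1-3), of \<tau> x t] by (auto elim: dvdE)
  define h where "h = int p ^ (n + \<tau>) * t * x ^ (?P - 1) + int p ^ (n + \<tau> + 1) * c"
  have y: "?y = x ^ ?P + h" using c by (simp add: h_def)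
  have P0: "?P > 0" using assms prime_gt_0_nat by simp
  have "h = int p ^ (n + \<tau>) * (t * x ^ (?P - 1) + int p * c)" by (simp add: h_def algebra_simps)
  hence hd: "int p ^ (n + \<tau>) dvd h" by (rule dvdI)
  have "int p ^ (n + \<tau>) * int p ^ (n + \<tau>) dvd h\<^sup>2"
    unfolding power2_eq_square by (rule mult_dvd_mono[OF hd hd])
  moreover have "int p ^ (n + \<tau> + 1) dvd int p ^ (n + \<tau>) * int p ^ (n + \<tau>)"
    unfolding power_add[symmetric] using assms(3) by (intro le_imp_power_dvd) simp
  ultimately have "int p ^ (n + \<tau> + 1) dvd h\<^sup>2" by (rule dvd_trans[rotated])
  hence "int p ^ (n + \<tau> + 1) dvd ?y ^ m - (x ^ ?P) ^ m - int m * h * (x ^ ?P) ^ (m - 1)"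
    unfolding y using power_add_mod_square dvd_trans by blast
  moreover have "int m * h * (x ^ ?P) ^ (m - 1) = int p ^ (n + \<tau>) * (int m * t * x ^ (k - 1)) +
      int p ^ (n + \<tau> + 1) * (int m * c * (x ^ ?P) ^ (m - 1))"
  proof -
    have "?P * m = ?P * (m - 1) + ?P" using assms(5) mult_Suc_right[of ?P "m - 1"] by simp
    hence "(?P - 1) + ?P * (m - 1) = k - 1" using P0 assms(4) by linarith
    hence "x ^ (?P - 1) * (x ^ ?P) ^ (m - 1) = x ^ (k - 1)"
      by (metis power_add power_mult)
    thus ?thesis by (simp add: h_def algebra_simps)
  qed
  ultimately have "int p ^ (n + \<tau> + 1) dvd (?y ^ m - (x ^ ?P) ^ m - int p ^ (n + \<tau>) * (int m * t * x ^ (k - 1)))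
      - int p ^ (n + \<tau> + 1) * (int m * c * (x ^ ?P) ^ (m - 1))"
    by (simp add: algebra_simps)
  hence "int p ^ (n + \<tau> + 1) dvd ?y ^ m - (x ^ ?P) ^ m - int p ^ (n + \<tau>) * (int m * t * x ^ (k - 1))"
    by (metis dvd_diff_commute dvd_diff_right_iff dvd_triv_left)
  thus ?thesis by (simp add: assms(4) flip: power_mult)
qed

text \<open>Hensel's iteration from the start value 1 for a k-th root of N / D, with the denominator
  kept on the left. Fixing \<open>x n\<close> modulo p^(n + 1) goes with divisibility of D x^k - N
  by p^(n + 1 + \<tau>): the extra \<tau> is the valuation of k, lost in each division by the
  derivative.\<close>

lemma root_approximation:
  fixes D N :: int
  assumes p: "prime p" "p \<ge> 3" and k: "k = p ^ \<tau> * m" "\<not> p dvd m"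
    and D: "\<not> int p dvd D" and N: "int p ^ (\<tau> + 1) dvd D - N"
  obtains x :: "nat \<Rightarrow> int" where "\<And>n. int p ^ (n + 1) dvd D * x n ^ k - N"
    "\<And>n. int p ^ (n + 1) dvd x (Suc n) - x n" "\<And>n. \<not> int p dvd x n"
proof -
  have pp: "prime (int p)" using p by simp
  have m0: "m > 0" using k(2) by (cases m) auto
  define Q where "Q n x \<longleftrightarrow> int p ^ (n + 1 + \<tau>) dvd D * x ^ k - N \<and> \<not> int p dvd x" for n and x :: int
  have "Q 0 1" using N p by (simp add: Q_def add.commute)
  hence base: "\<exists>x. Q 0 x" by blast
  have step: "\<exists>y. Q (Suc n) y \<and> int p ^ (n + 1) dvd y - x" if "Q n x" for n x
  proof -
    obtain r where r: "D * x ^ k - N = int p ^ (n + 1 + \<tau>) * r" using \<open>Q n x\<close> by (auto simp: Q_def elim: dvdE)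
    define u where "u = D * int m * x ^ (k - 1)"
    have "\<not> int p dvd x ^ (k - 1)" using \<open>Q n x\<close> prime_dvd_power[OF pp] by (auto simp: Q_def)
    hence "\<not> int p dvd u" using D k(2) pp by (auto simp: u_def prime_dvd_mult_iff)
    hence "coprime u (int p)" using prime_imp_coprime[OF pp, of u] by (simp add: coprime_commute)
    then obtain z where z: "[u * z = 1] (mod int p)" using cong_solve_coprime_int by blast
    define t where "t = - r * z"
    have "r + u * t = - r * (u * z - 1)" by (simp add: t_def algebra_simps)
    hence rt: "int p dvd r + u * t" using z by (simp add: cong_iff_dvd_diff)
    define y where "y = x + int p ^ (n + 1) * t"
    have "int p ^ (n + 1 + \<tau> + 1) dvd D * (y ^ k - x ^ k - int p ^ (n + 1 + \<tau>) * (int m * t * x ^ (k - 1)))"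
      unfolding y_def by (rule dvd_mult[OF power_add_mod[OF p _ k(1) m0]]) simp
    moreover have "int p ^ (n + 1 + \<tau> + 1) dvd int p ^ (n + 1 + \<tau>) * (r + u * t)"
      using rt by simp
    ultimately have "int p ^ (n + 1 + \<tau> + 1) dvd
      D * (y ^ k - x ^ k - int p ^ (n + 1 + \<tau>) * (int m * t * x ^ (k - 1))) + int p ^ (n + 1 + \<tau>) * (r + u * t)"
      by (rule dvd_add)
    also have "\<dots> = D * y ^ k - D * x ^ k + int p ^ (n + 1 + \<tau>) * r" by (simp add: u_def algebra_simps)
    also have "\<dots> = D * y ^ k - N" using r by simp
    finally have "int p ^ (Suc n + 1 + \<tau>) dvd D * y ^ k - N" by simp
    moreover have "\<not> int p dvd y" using \<open>Q n x\<close> by (simp add: Q_def y_def dvd_add_left_iff)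
    ultimately show ?thesis by (intro exI[of _ y]) (simp add: Q_def y_def)
  qed
  obtain x where x: "\<And>n. Q n (x n)" "\<And>n. int p ^ (n + 1) dvd x (Suc n) - x n"
    using dependent_nat_choice[of Q "\<lambda>n x y. int p ^ (n + 1) dvd y - x"] base step by metis
  show ?thesis
  proof (rule that[of x])
    show "int p ^ (n + 1) dvd D * x n ^ k - N" for n
    proof (rule dvd_trans)
      show "int p ^ (n + 1) dvd int p ^ (n + 1 + \<tau>)" by (rule le_imp_power_dvd) simp
      show "int p ^ (n + 1 + \<tau>) dvd D * x n ^ k - N" using x(1)[of n] by (simp add: Q_def)
    qed
    show "\<not> int p dvd x n" for n using x(1)[of n] by (simp add: Q_def)
  qed (rule x(2))
qed

section \<open>Integer sequences as p-adic numbers\<close>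

lemma padic_abs_of_int_le:
  assumes p: "prime p" and "int p ^ n dvd z"
  shows "padic_abs p (of_int z) \<le> 1 / real p ^ n"
proof (cases "z = 0")
  case False
  have p1: "real p > 1" using p_real[OF p] .
  have "n \<le> multiplicity (int p) z"
    using assms False p_int[OF p] by (intro multiplicity_geI) auto
  moreover have "padic_abs p (of_int z) = real p powi (- int (multiplicity (int p) z))"
    using padic_abs_frac[OF p False, of 1] by simp
  ultimately have "padic_abs p (of_int z) \<le> real p powi (- int n)"
    using p1 by (simp add: power_int_increasing)
  thus ?thesis using p1 by (simp add: power_int_minus divide_inverse)
qed (use prime_gt_0_nat[OF p] in simp)

lemma small_inverse_power:
  assumes "prime p" "e > 0" obtains N where "\<And>n. n \<ge> N \<Longrightarrow> 1 / real p ^ n < e"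
proof -
  have p1: "real p > 1" using p_real[OF assms(1)] .
  obtain N where N: "1 / e < real p ^ N" using real_arch_pow[OF p1] by blast
  have "1 / real p ^ n < e" if "n \<ge> N" for n
  proof -
    have "real p ^ N \<le> real p ^ n" using p1 that by (intro power_increasing) auto
    hence "1 / e < real p ^ n" using N by linarith
    thus ?thesis using assms(2) p1 by (simp add: field_simps)
  qed
  thus ?thesis using that by blast
qed

lemma padic_null_of_int:
  assumes "prime p" "\<And>n. int p ^ n dvd f n" shows "padic_null p (\<lambda>n. of_int (f n))"
  unfolding padic_null_iff[OF assms(1)]
proof (intro allI impI)
  fix e :: real assume "e > 0"
  then obtain N where "\<And>n. n \<ge> N \<Longrightarrow> 1 / real p ^ n < e" using small_inverse_power[OF assms(1)] by blast
  thus "\<exists>N. \<forall>n\<ge>N. padic_abs p (of_int (f n)) < e"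
    using padic_abs_of_int_le[OF assms(1) assms(2)] by (meson le_less_trans)
qed

lemma padic_Cauchy_of_int:
  assumes p: "prime p" and f: "\<And>n. int p ^ n dvd f (Suc n) - f n"
  shows "padic_Cauchy p (\<lambda>n. of_int (f n))"
  unfolding padic_Cauchy_def
proof (intro allI impI)
  fix e :: real assume "e > 0"
  then obtain N where N: "\<And>n. n \<ge> N \<Longrightarrow> 1 / real p ^ n < e" using small_inverse_power[OF p] by blast
  have d: "int p ^ N dvd f n - f N" if "n \<ge> N" for n
    using that
  proof (induction n rule: dec_induct)
    case (step n)
    have "int p ^ N dvd f (Suc n) - f n" using f[of n] step(1) by (meson dvd_trans le_imp_power_dvd)
    hence "int p ^ N dvd (f (Suc n) - f n) + (f n - f N)" using step by (intro dvd_add)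
    thus ?case by simp
  qed simp
  have "padic_abs p (of_int (f m) - of_int (f n)) < e" if "m \<ge> N" "n \<ge> N" for m n
  proof -
    have "int p ^ N dvd (f m - f N) - (f n - f N)" using d[OF that(1)] d[OF that(2)] by (rule dvd_diff)
    hence "padic_abs p (of_int (f m - f n)) \<le> 1 / real p ^ N" by (intro padic_abs_of_int_le[OF p]) simp
    thus ?thesis using N[of N] by simp
  qed
  thus "\<exists>N. \<forall>m\<ge>N. \<forall>n\<ge>N. padic_abs p (of_int (f m) - of_int (f n)) < e" by blast
qed

lemma not_padic_null_unit:
  assumes p: "prime p" and "\<And>n. \<not> int p dvd f n"
  shows "\<not> padic_null p (\<lambda>n. of_int (f n))"
proof -
  have "padic_abs p (of_int (f n)) = 1" for n
  proof -
    have "f n \<noteq> 0" using assms(2)[of n] by auto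
    moreover have "multiplicity (int p) (f n) = 0" using assms(2)[of n] by (rule not_dvd_imp_multiplicity_0)
    ultimately show ?thesis using padic_abs_frac[OF p, of "f n" 1] by simp
  qed
  thus ?thesis by (simp add: padic_null_def LIMSEQ_const_iff)
qed

text \<open>Solutions are kept as Cauchy sequences of rationals, so all computations are pointwise
  until the final passage to the quotient.\<close>

definition padic_solvable :: "nat \<Rightarrow> nat \<Rightarrow> 'i set \<Rightarrow> ('i \<Rightarrow> int) \<Rightarrow> ('i \<Rightarrow> int) \<Rightarrow> bool" where
  "padic_solvable p k I a b \<longleftrightarrow> (\<exists>X. (\<forall>i\<in>I. padic_Cauchy p (X i)) \<and> (\<exists>i\<in>I. \<not> padic_null p (X i)) \<and>
     padic_null p (\<lambda>n. \<Sum>i\<in>I. of_int (a i) * X i n ^ k) \<and>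
     padic_null p (\<lambda>n. \<Sum>i\<in>I. of_int (b i) * X i n ^ k))"

text \<open>Two independent vectors of a zero sum modulo \<^term>\<open>p ^ (\<tau> + 1)\<close> leave room to correct the sum
  to zero by Cramer's rule, since every \<^term>\<open>c\<close> congruent to 1 modulo \<^term>\<open>p ^ (\<tau> + 1)\<close>
  is a \<^term>\<open>k\<close>-th power.\<close>

lemma padic_solvable_of_good:
  assumes p: "prime p" "p \<ge> 3" and k: "k = p ^ \<tau> * m" "\<not> p dvd m" and I: "finite I"
    and g: "good p (p ^ (\<tau> + 1)) I a b"
  shows "padic_solvable p k I a b"
proof -
  let ?q = "int p ^ (\<tau> + 1)"
  obtain S i j where S: "S \<subseteq> I" "?q dvd sum a S" "?q dvd sum b S" "i \<in> S" "j \<in> S"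
    and det: "\<not> int p dvd a i * b j - a j * b i"
    using g unfolding good_def by (metis of_nat_power)
  define D where "D = a i * b j - a j * b i"
  define A B where "A = sum a S" and "B = sum b S"
  \<comment> \<open>Replacing the ones at \<open>i\<close> and \<open>j\<close> by the k-th powers
    Ni / D and Nj / D has to cancel \<open>A\<close> and \<open>B\<close>: a i (Ni - D) + a j (Nj -
    D) = - A D, and similarly for b and \<open>B\<close>.\<close>
  define Ni Nj where "Ni = D + (B * a j - A * b j)" and "Nj = D + (A * b i - B * a i)"
  have k0: "k > 0" using k p by (cases m) auto
  have ij: "i \<noteq> j" using det by auto
  have "?q dvd D - Ni" "?q dvd D - Nj" using S(2,3) by (auto simp: Ni_def Nj_def A_def B_def)
  note root = root_approximation[OF p k det[folded D_def]]
  obtain x where x: "\<And>n. int p ^ (n + 1) dvd D * x n ^ k - Ni"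
    "\<And>n. int p ^ (n + 1) dvd x (Suc n) - x n" "\<And>n. \<not> int p dvd x n"
    using root[OF \<open>?q dvd D - Ni\<close>] by metis
  obtain y where y: "\<And>n. int p ^ (n + 1) dvd D * y n ^ k - Nj"
    "\<And>n. int p ^ (n + 1) dvd y (Suc n) - y n" "\<And>n. \<not> int p dvd y n"
    using root[OF \<open>?q dvd D - Nj\<close>] by metis
  define Y where "Y l n = (if l = i then x n else if l = j then y n else if l \<in> S then 1 else 0)" for l n
  define X where "X l n = (of_int (Y l n) :: rat)" for l n
  have fS: "finite S" using S(1) I finite_subset by blast
  have sumY: "(\<Sum>l\<in>I. c l * Y l n ^ k) = sum c S - c i - c j + c i * x n ^ k + c j * y n ^ k" for c n
  proof -
    have "(\<Sum>l\<in>I. c l * Y l n ^ k) = (\<Sum>l\<in>S. c l * Y l n ^ k)"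
      using S I k0 by (intro sum.mono_neutral_right) (auto simp: Y_def)
    also have "\<dots> = c i * Y i n ^ k + (c j * Y j n ^ k + (\<Sum>l\<in>S - {i} - {j}. c l * Y l n ^ k))"
      using S fS ij by (simp add: sum.remove[of S i] sum.remove[of "S - {i}" j])
    also have "(\<Sum>l\<in>S - {i} - {j}. c l * Y l n ^ k) = (\<Sum>l\<in>S - {i} - {j}. c l)"
      by (rule sum.cong) (auto simp: Y_def)
    also have "\<dots> = sum c S - c i - c j"
      using S fS ij by (simp add: sum.remove[of S i] sum.remove[of "S - {i}" j])
    finally show ?thesis using ij by (simp add: Y_def)
  qed
  have zero: "int p ^ n dvd (\<Sum>l\<in>I. c l * Y l n ^ k)"
    if c: "D * sum c S - D * c i - D * c j + c i * Ni + c j * Nj = 0" for c n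
  proof -
    have "int p ^ n dvd c i * (D * x n ^ k - Ni) + c j * (D * y n ^ k - Nj)"
      using x(1)[of n] y(1)[of n] by (intro dvd_add dvd_mult) (auto elim: dvd_mult_right)
    also have "\<dots> = D * (\<Sum>l\<in>I. c l * Y l n ^ k)"
      using c unfolding sumY by (simp add: algebra_simps)
    finally have "int p ^ n dvd D * (\<Sum>l\<in>I. c l * Y l n ^ k)" .
    moreover have "coprime (int p ^ n) D"
      using det p by (simp add: D_def prime_imp_coprime)
    ultimately show ?thesis using coprime_dvd_mult_right_iff by blast
  qed
  have za: "D * sum a S - D * a i - D * a j + a i * Ni + a j * Nj = 0"
    "D * sum b S - D * b i - D * b j + b i * Ni + b j * Nj = 0"
    unfolding A_def[symmetric] B_def[symmetric] by (simp_all add: Ni_def Nj_def D_def algebra_simps)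
  have sumX: "(\<Sum>l\<in>I. of_int (c l) * X l n ^ k) = of_int (\<Sum>l\<in>I. c l * Y l n ^ k)" for c n
    by (simp add: X_def)
  have "padic_Cauchy p (X l)" for l
  proof -
    have "int p ^ n dvd Y l (Suc n) - Y l n" for n
      using x(2)[of n] y(2)[of n] by (auto simp: Y_def elim: dvd_mult_right)
    thus ?thesis using padic_Cauchy_of_int[OF p(1), of "Y l"] by (simp add: X_def[abs_def])
  qed
  moreover have "\<not> padic_null p (X i)"
    using not_padic_null_unit[OF p(1) x(3)] by (simp add: X_def[abs_def] Y_def)
  moreover have "padic_null p (\<lambda>n. \<Sum>l\<in>I. of_int (a l) * X l n ^ k)"
    "padic_null p (\<lambda>n. \<Sum>l\<in>I. of_int (b l) * X l n ^ k)"
    unfolding sumX using zero[OF za(1)] zero[OF za(2)] by (intro padic_null_of_int[OF p(1)]; blast)+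
  ultimately show ?thesis unfolding padic_solvable_def using S by blast
qed

section \<open>Normalisation\<close>

lemma padic_abs_powi:
  assumes p: "prime p" shows "padic_abs p (of_nat p powi n) = real p powi (- n)"
proof (cases "n \<ge> 0")
  case True
  then obtain m where m: "n = int m" using nonneg_int_cases by blast
  have "(of_nat p powi n :: rat) = of_int (int p ^ m) / of_int 1" by (simp add: m)
  also have "padic_abs p \<dots> = real p powi (- n)"
    using padic_abs_frac[OF p, of "int p ^ m" 1] p_int[OF p] prime_gt_0_nat[OF p]
    by (simp add: m multiplicity_same_power)
  finally show ?thesis .
next
  case False
  then obtain m where m: "n = - int m" using neg_int_cases[of n] by (metis not_le)
  have "(of_nat p powi n :: rat) = of_int 1 / of_int (int p ^ m)"
    by (simp add: m power_int_minus divide_inverse)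
  also have "padic_abs p \<dots> = real p powi (- n)"
    using padic_abs_frac[OF p, of 1 "int p ^ m"] p_int[OF p] prime_gt_0_nat[OF p]
    by (simp add: m multiplicity_same_power)
  finally show ?thesis .
qed

lemma padic_abs_unit_over_power:
  assumes p: "prime p" and "\<not> int p dvd z"
  shows "padic_abs p (of_int z / of_nat p ^ r) = real p powi (int r)"
proof -
  have "z \<noteq> 0" using assms(2) by auto
  moreover have "multiplicity (int p) z = 0" using assms(2) by (rule not_dvd_imp_multiplicity_0)
  ultimately show ?thesis
    using padic_abs_frac[OF p, of z "int p ^ r"] p_int[OF p] prime_gt_0_nat[OF p]
    by (simp add: multiplicity_same_power)
qed

text \<open>\<^term>\<open>(A, B)\<close> arises from \<^term>\<open>(a, b)\<close> by a linear substitution of the two equations and by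
  scaling the variables with powers of \<^term>\<open>p\<close>; \<^term>\<open>G\<close> records its cost.\<close>

definition equivalent_system ::
  "nat \<Rightarrow> nat \<Rightarrow> 'i set \<Rightarrow> ('i \<Rightarrow> int) \<Rightarrow> ('i \<Rightarrow> int) \<Rightarrow> ('i \<Rightarrow> int) \<Rightarrow> ('i \<Rightarrow> int) \<Rightarrow> int \<Rightarrow> bool" where
  "equivalent_system p k I a b A B G \<longleftrightarrow>
     (\<exists>g11 g12 g21 g22 v e. padic_abs p (g11 * g22 - g12 * g21) = real p powi (- v) \<and>
        G = 2 * int k * sum e I + int (card I) * v \<and>
        (\<forall>i\<in>I. of_int (A i) = of_nat p powi (int k * e i) * (g11 * of_int (a i) + g12 * of_int (b i)) \<and>
               of_int (B i) = of_nat p powi (int k * e i) * (g21 * of_int (a i) + g22 * of_int (b i))))"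

lemma equivalent_system_refl:
  assumes "prime p" shows "equivalent_system p k I a b a b 0"
  unfolding equivalent_system_def
  by (rule exI[of _ 1], rule exI[of _ 0], rule exI[of _ 0], rule exI[of _ 1], rule exI[of _ 0], rule exI[of _ "\<lambda>_. 0"])
     (use assms in simp)

lemma equivalent_system_step:
  assumes p: "prime p" and I: "finite I" "J \<subseteq> I" and es: "equivalent_system p k I a b A B G"
    and h: "padic_abs p (h11 * h22 - h12 * h21) = real p powi (- w)"
    and A': "\<And>i. i \<in> I \<Longrightarrow>
      of_int (A' i) = (if i \<in> J then of_nat p ^ k else 1) * (h11 * of_int (A i) + h12 * of_int (B i))"
    and B': "\<And>i. i \<in> I \<Longrightarrow>
      of_int (B' i) = (if i \<in> J then of_nat p ^ k else 1) * (h21 * of_int (A i) + h22 * of_int (B i))"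
  shows "equivalent_system p k I a b A' B' (G + 2 * int k * int (card J) + int (card I) * w)"
proof -
  obtain g11 g12 g21 g22 v e where g: "padic_abs p (g11 * g22 - g12 * g21) = real p powi (- v)"
    "G = 2 * int k * sum e I + int (card I) * v"
    "\<And>i. i \<in> I \<Longrightarrow> of_int (A i) = of_nat p powi (int k * e i) * (g11 * of_int (a i) + g12 * of_int (b i))"
    "\<And>i. i \<in> I \<Longrightarrow> of_int (B i) = of_nat p powi (int k * e i) * (g21 * of_int (a i) + g22 * of_int (b i))"
    using es unfolding equivalent_system_def by blast
  have p0: "(of_nat p :: rat) \<noteq> 0" "real p \<noteq> 0" using prime_gt_0_nat[OF p] by auto
  define e' where "e' i = e i + (if i \<in> J then 1 else 0)" for i
  define m11 m12 m21 m22 where "m11 = h11 * g11 + h12 * g21" and "m12 = h11 * g12 + h12 * g22"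
    and "m21 = h21 * g11 + h22 * g21" and "m22 = h21 * g12 + h22 * g22"
  have mdet: "m11 * m22 - m12 * m21 = (h11 * h22 - h12 * h21) * (g11 * g22 - g12 * g21)"
    by (simp add: m11_def m12_def m21_def m22_def algebra_simps)
  have det: "padic_abs p (m11 * m22 - m12 * m21) = real p powi (- (v + w))"
    unfolding mdet padic_abs_mult[OF p] g(1) h using p0
    by (simp add: power_int_add[symmetric] algebra_simps)
  have "sum e' I = sum e I + int (card J)"
    using I by (simp add: e'_def sum.distrib sum.If_cases Int_absorb1)
  hence G: "G + 2 * int k * int (card J) + int (card I) * w = 2 * int k * sum e' I + int (card I) * (v + w)"
    by (simp add: g(2) algebra_simps)
  have e': "of_nat p powi (int k * e' i) = (if i \<in> J then of_nat p ^ k else 1) * (of_nat p powi (int k * e i) :: rat)" for i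
    using p0 by (simp add: e'_def power_int_add distrib_left)
  have "of_int (A' i) = of_nat p powi (int k * e' i) * (m11 * of_int (a i) + m12 * of_int (b i))"
    "of_int (B' i) = of_nat p powi (int k * e' i) * (m21 * of_int (a i) + m22 * of_int (b i))" if "i \<in> I" for i
    unfolding A'[OF that] B'[OF that] e' g(3)[OF that] g(4)[OF that]
    by (simp_all add: m11_def m12_def m21_def m22_def algebra_simps)
  thus ?thesis unfolding equivalent_system_def using det G by blast
qed

text \<open>Integrality of the determinants bounds k e i + k e j + v from below for non-proportional
  columns. If the smallest term 2 k e i1 + v equals -t with t \<ge> 0, all columns not proportional
  to \<open>i1\<close> have terms at least t - 2C. They make up at least half, so the t cancel in
  the sum.\<close>

lemma equivalent_system_bounded_below:
  fixes a b :: "'i \<Rightarrow> int"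
  assumes p: "prime p" and I: "finite I" "I \<noteq> {}"
    and half: "\<And>i. i \<in> I \<Longrightarrow> 2 * card {j \<in> I. a i * b j = a j * b i} \<le> card I"
  obtains C where "\<And>A B G. equivalent_system p k I a b A B G \<Longrightarrow> - C \<le> G"
proof -
  define C where "C = (\<Sum>i\<in>I. \<Sum>j\<in>I. int (multiplicity (int p) (a i * b j - a j * b i)))"
  have p1: "real p > 1" using p_real[OF p] .
  have C: "int (multiplicity (int p) (a i * b j - a j * b i)) \<le> C" if "i \<in> I" "j \<in> I" for i j
  proof -
    have "int (multiplicity (int p) (a i * b j - a j * b i)) \<le> (\<Sum>j\<in>I. int (multiplicity (int p) (a i * b j - a j * b i)))"
      using I that by (intro member_le_sum) auto
    also have "\<dots> \<le> C" unfolding C_def using I that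
      by (intro member_le_sum[of i I "\<lambda>i. \<Sum>j\<in>I. int (multiplicity (int p) (a i * b j - a j * b i))"] sum_nonneg) auto
    finally show ?thesis .
  qed
  have C0: "C \<ge> 0" by (auto simp: C_def intro!: sum_nonneg)
  have "- (2 * C * int (card I)) \<le> G" if es: "equivalent_system p k I a b A B G" for A B G
  proof -
    obtain g11 g12 g21 g22 v e where g: "padic_abs p (g11 * g22 - g12 * g21) = real p powi (- v)"
      "G = 2 * int k * sum e I + int (card I) * v"
      "\<And>i. i \<in> I \<Longrightarrow> of_int (A i) = of_nat p powi (int k * e i) * (g11 * of_int (a i) + g12 * of_int (b i))"
      "\<And>i. i \<in> I \<Longrightarrow> of_int (B i) = of_nat p powi (int k * e i) * (g21 * of_int (a i) + g22 * of_int (b i))"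
      using es unfolding equivalent_system_def by blast
    have pair: "- C \<le> int k * e i + int k * e j + v"
      if ij: "i \<in> I" "j \<in> I" "a i * b j \<noteq> a j * b i" for i j
    proof -
      let ?d = "a i * b j - a j * b i"
      have "of_int (A i * B j - A j * B i) =
        (of_nat p powi (int k * e i) * of_nat p powi (int k * e j)) * (g11 * g22 - g12 * g21) * of_int ?d"
        unfolding of_int_diff of_int_mult g(3)[OF ij(1)] g(3)[OF ij(2)] g(4)[OF ij(1)] g(4)[OF ij(2)]
        by (simp add: algebra_simps)
      hence "padic_abs p (of_int (A i * B j - A j * B i)) =
        real p powi (- (int k * e i)) * real p powi (- (int k * e j)) * real p powi (- v) * padic_abs p (of_int ?d)"
        by (simp only: padic_abs_mult[OF p] padic_abs_powi[OF p] g(1))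
      also have "padic_abs p (of_int ?d) = real p powi (- int (multiplicity (int p) ?d))"
        using padic_abs_frac[OF p, of ?d 1] ij(3) by simp
      also have "real p powi (- (int k * e i)) * real p powi (- (int k * e j)) * real p powi (- v) * real p powi (- int (multiplicity (int p) ?d))
         = real p powi (- (int k * e i + int k * e j + v + int (multiplicity (int p) ?d)))"
        using p1 by (simp add: power_int_add[symmetric] algebra_simps)
      finally have eq: "padic_abs p (of_int (A i * B j - A j * B i)) = \<dots>" .
      have "padic_abs p (of_int (A i * B j - A j * B i)) \<le> 1"
        using padic_abs_of_int_le[OF p, of 0 "A i * B j - A j * B i"] by simp
      hence "\<not> - (int k * e i + int k * e j + v + int (multiplicity (int p) ?d)) > 0"
        using p1 unfolding eq by (metis not_less one_less_power_int)
      thus ?thesis using C[OF ij(1,2)] by linarith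
    qed
    have "\<exists>i1\<in>I. \<forall>j\<in>I. e i1 \<le> e j"
      using I by (metis (mono_tags) arg_min_if_finite(1) arg_min_least)
    then obtain i1 where i1: "i1 \<in> I" "\<And>j. j \<in> I \<Longrightarrow> e i1 \<le> e j" by blast
    define t where "t = - (2 * int k * e i1 + v)"
    let ?f = "\<lambda>j. 2 * int k * e j + v" and ?K = "{j \<in> I. a i1 * b j = a j * b i1}"
    have G: "G = (\<Sum>j\<in>I. ?f j)" by (simp add: g(2) sum.distrib sum_distrib_left)
    have f: "- t \<le> ?f j" if "j \<in> I" for j
    proof -
      have "2 * int k * e i1 \<le> 2 * int k * e j" using i1(2)[OF that] by (intro mult_left_mono) auto
      thus ?thesis by (simp add: t_def)
    qed
    show ?thesis
    proof (cases "t \<ge> 0")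
      case False
      have "(\<Sum>j\<in>I. 0) \<le> (\<Sum>j\<in>I. ?f j)" by (rule sum_mono) (use f False in force)
      moreover have "0 \<le> 2 * C * int (card I)" using C0 by simp
      ultimately show ?thesis using G by simp
    next
      case True
      have f2: "t - 2 * C \<le> ?f j" if "j \<in> I - ?K" for j
        using pair[of i1 j] i1(1) that by (simp add: t_def algebra_simps)
      have "(\<Sum>j\<in>I. ?f j) = (\<Sum>j\<in>I - ?K. ?f j) + (\<Sum>j\<in>?K. ?f j)"
        using I by (intro sum.subset_diff) auto
      moreover have "(\<Sum>j\<in>I - ?K. t - 2 * C) \<le> (\<Sum>j\<in>I - ?K. ?f j)" by (rule sum_mono) (rule f2)
      moreover have "(\<Sum>j\<in>?K. - t) \<le> (\<Sum>j\<in>?K. ?f j)" by (rule sum_mono) (use f in auto)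
      ultimately have "int (card (I - ?K)) * (t - 2 * C) + int (card ?K) * (- t) \<le> G" using G by simp
      moreover have "int (card (I - ?K)) = int (card I) - int (card ?K)"
        using I by (subst card_Diff_subset) (auto simp: of_nat_diff card_mono)
      ultimately have "(int (card I) - 2 * int (card ?K)) * t - 2 * C * int (card I) + 2 * C * int (card ?K) \<le> G"
        by (simp add: algebra_simps)
      moreover have "0 \<le> (int (card I) - 2 * int (card ?K)) * t"
        using half[OF i1(1)] True by (intro mult_nonneg_nonneg) auto
      moreover have "0 \<le> 2 * C * int (card ?K)" using C0 by simp
      ultimately show ?thesis by linarith
    qed
  qed
  thus ?thesis using that by blast
qed

lemma padic_null_cmult:
  assumes "prime p" "padic_null p f" shows "padic_null p (\<lambda>n. c * f n)"
  by (rule padic_null_mult[OF assms padic_Cauchy_const[OF assms(1)]])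

lemma padic_solvable_of_equivalent:
  assumes p: "prime p" and es: "equivalent_system p k I a b A B G"
    and sol: "padic_solvable p k I A B"
  shows "padic_solvable p k I a b"
proof -
  obtain g11 g12 g21 g22 v e where g: "padic_abs p (g11 * g22 - g12 * g21) = real p powi (- v)"
    "\<And>i. i \<in> I \<Longrightarrow> of_int (A i) = of_nat p powi (int k * e i) * (g11 * of_int (a i) + g12 * of_int (b i))"
    "\<And>i. i \<in> I \<Longrightarrow> of_int (B i) = of_nat p powi (int k * e i) * (g21 * of_int (a i) + g22 * of_int (b i))"
    using es unfolding equivalent_system_def by blast
  let ?d = "g11 * g22 - g12 * g21"
  have d0: "?d \<noteq> 0" using g(1) prime_gt_0_nat[OF p] by auto
  obtain X where X: "\<And>i. i \<in> I \<Longrightarrow> padic_Cauchy p (X i)" "\<exists>i\<in>I. \<not> padic_null p (X i)"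
    "padic_null p (\<lambda>n. \<Sum>i\<in>I. of_int (A i) * X i n ^ k)"
    "padic_null p (\<lambda>n. \<Sum>i\<in>I. of_int (B i) * X i n ^ k)"
    using sol unfolding padic_solvable_def by blast
  have p0: "(of_nat p :: rat) \<noteq> 0" using prime_gt_0_nat[OF p] by auto
  define Y where "Y i n = of_nat p powi e i * X i n" for i n
  have Yk: "Y i n ^ k = of_nat p powi (int k * e i) * X i n ^ k" for i n
    by (simp add: Y_def power_mult_distrib power_int_power' mult.commute)
  let ?a = "\<lambda>n. \<Sum>i\<in>I. of_int (a i) * Y i n ^ k" and ?b = "\<lambda>n. \<Sum>i\<in>I. of_int (b i) * Y i n ^ k"
  have S1: "(\<Sum>i\<in>I. of_int (A i) * X i n ^ k) = g11 * ?a n + g12 * ?b n" for n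
    by (simp add: sum_distrib_left Yk g(2) algebra_simps flip: sum.distrib)
  have S2: "(\<Sum>i\<in>I. of_int (B i) * X i n ^ k) = g21 * ?a n + g22 * ?b n" for n
    by (simp add: sum_distrib_left Yk g(3) algebra_simps flip: sum.distrib)
  have n1: "padic_null p (\<lambda>n. g11 * ?a n + g12 * ?b n)" and n2: "padic_null p (\<lambda>n. g21 * ?a n + g22 * ?b n)"
    using X(3,4) unfolding S1 S2 .
  have "padic_null p ?a"
  proof -
    have "padic_null p (\<lambda>n. (g22 / ?d) * (g11 * ?a n + g12 * ?b n) + (- g12 / ?d) * (g21 * ?a n + g22 * ?b n))"
      by (intro padic_null_add[OF p] padic_null_cmult[OF p] n1 n2)
    moreover have "(g22 / ?d) * (g11 * u + g12 * w) + (- g12 / ?d) * (g21 * u + g22 * w) = u" for u w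
    proof -
      have "(g22 / ?d) * (g11 * u + g12 * w) + (- g12 / ?d) * (g21 * u + g22 * w) =
        (g22 * (g11 * u + g12 * w) - g12 * (g21 * u + g22 * w)) / ?d" by (simp add: diff_divide_distrib)
      also have "g22 * (g11 * u + g12 * w) - g12 * (g21 * u + g22 * w) = ?d * u" by (simp add: algebra_simps)
      finally show ?thesis using d0 by (metis nonzero_mult_div_cancel_left)
    qed
    ultimately show ?thesis by simp
  qed
  moreover have "padic_null p ?b"
  proof -
    have "padic_null p (\<lambda>n. (- g21 / ?d) * (g11 * ?a n + g12 * ?b n) + (g11 / ?d) * (g21 * ?a n + g22 * ?b n))"
      by (intro padic_null_add[OF p] padic_null_cmult[OF p] n1 n2)
    moreover have "(- g21 / ?d) * (g11 * u + g12 * w) + (g11 / ?d) * (g21 * u + g22 * w) = w" for u w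
    proof -
      have "(- g21 / ?d) * (g11 * u + g12 * w) + (g11 / ?d) * (g21 * u + g22 * w) =
        (g11 * (g21 * u + g22 * w) - g21 * (g11 * u + g12 * w)) / ?d" by (simp add: diff_divide_distrib)
      also have "g11 * (g21 * u + g22 * w) - g21 * (g11 * u + g12 * w) = ?d * w" by (simp add: algebra_simps)
      finally show ?thesis using d0 by (metis nonzero_mult_div_cancel_left)
    qed
    ultimately show ?thesis by simp
  qed
  moreover have "padic_Cauchy p (Y i)" if "i \<in> I" for i
    unfolding Y_def by (rule padic_Cauchy_mult[OF p padic_Cauchy_const[OF p] X(1)[OF that]])
  moreover obtain i where i: "i \<in> I" "\<not> padic_null p (X i)" using X(2) by blast
  moreover have "\<not> padic_null p (Y i)"
  proof
    assume "padic_null p (Y i)"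
    hence "padic_null p (\<lambda>n. of_nat p powi (- e i) * Y i n)" by (rule padic_null_cmult[OF p])
    moreover have "of_nat p powi (- e i) * Y i n = X i n" for n
      using p0 by (simp add: Y_def power_int_minus)
    ultimately show False using i by simp
  qed
  ultimately show ?thesis unfolding padic_solvable_def by blast
qed

lemma minimal_equivalent_system:
  assumes p: "prime p" and I: "finite I" "I \<noteq> {}"
    and half: "\<And>i. i \<in> I \<Longrightarrow> 2 * card {j \<in> I. a i * b j = a j * b i} \<le> card I"
  obtains A B G where "equivalent_system p k I a b A B G"
    "\<And>A' B' G'. equivalent_system p k I a b A' B' G' \<Longrightarrow> G \<le> G'"
proof -
  obtain C where C: "\<And>A B G. equivalent_system p k I a b A B G \<Longrightarrow> - C \<le> G"
    using equivalent_system_bounded_below[OF assms] by blast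
  define Q where "Q z \<longleftrightarrow> (\<exists>A B. equivalent_system p k I a b A B (int z - C))" for z
  have Q: "Q (nat (G + C))" if "equivalent_system p k I a b A B G" for A B G
    using that C[OF that] unfolding Q_def by auto
  have "Q (LEAST z. Q z)" using Q[OF equivalent_system_refl[OF p]] by (rule LeastI)
  then obtain A B where AB: "equivalent_system p k I a b A B (int (LEAST z. Q z) - C)"
    unfolding Q_def by blast
  have "int (LEAST z. Q z) - C \<le> G'" if "equivalent_system p k I a b A' B' G'" for A' B' G'
    using Least_le[of Q, OF Q[OF that]] C[OF that] by linarith
  thus ?thesis using AB that by blast
qed

lemma padic_solvable_balanced:
  fixes a b :: "'i \<Rightarrow> int"
  assumes p: "prime p" "p \<ge> 5" and \<tau>: "\<tau> \<ge> 1" and k: "k = p ^ \<tau> * (p - 1)"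
    and I: "finite I" and s: "2 * k\<^sup>2 < card I"
    and half: "\<And>i. i \<in> I \<Longrightarrow> 2 * card {j \<in> I. a i * b j = a j * b i} \<le> card I"
  shows "padic_solvable p k I a b"
proof -
  have "I \<noteq> {}" using s by auto
  then obtain A B G where es: "equivalent_system p k I a b A B G"
    and min: "\<And>A' B' G'. equivalent_system p k I a b A' B' G' \<Longrightarrow> G \<le> G'"
    using minimal_equivalent_system[OF p(1) I _ half] by metis
  have p0: "(of_nat p :: rat) \<noteq> 0" using p by simp
  have "p ^ 1 \<le> p ^ \<tau>" using \<tau> p by (intro power_increasing) auto
  hence "5 \<le> p ^ \<tau>" using p by simp
  hence "5 * 4 \<le> p ^ \<tau> * (p - 1)" using p by (intro mult_le_mono) auto
  hence k2: "k \<ge> 2" using k by simp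
  \<comment> \<open>Lowering the valuation of the determinant by n while multiplying the columns in
    \<open>J\<close> by p^k changes the cost by 2 k |J| - s n. Minimality makes this nonnegative,
    and s > 2 k^2 yields the bound.\<close>
  have count: "n * k < card J"
    if J: "J \<subseteq> I" "n > 0" and det: "padic_abs p (h11 * h22 - h12 * h21) = real p powi (int n)"
    and A': "\<And>i. i \<in> I \<Longrightarrow>
      of_int (A' i) = (if i \<in> J then of_nat p ^ k else 1) * (h11 * of_int (A i) + h12 * of_int (B i))"
    and B': "\<And>i. i \<in> I \<Longrightarrow>
      of_int (B' i) = (if i \<in> J then of_nat p ^ k else 1) * (h21 * of_int (A i) + h22 * of_int (B i))"
    for J n h11 h12 h21 h22 A' B'
  proof -
    have "padic_abs p (h11 * h22 - h12 * h21) = real p powi (- (- int n))" using det by simp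
    from min[OF equivalent_system_step[OF p(1) I J(1) es this A' B']]
    have "int (card I) * int n \<le> 2 * int k * int (card J)" by simp
    hence "card I * n \<le> 2 * k * card J" by (metis of_nat_le_iff of_nat_mult of_nat_numeral)
    moreover have "2 * k\<^sup>2 * n < card I * n" using s J(2) by simp
    moreover have "2 * k * (n * k) = 2 * k\<^sup>2 * n" by (simp add: power2_eq_square)
    ultimately have "2 * k * (n * k) < 2 * k * card J" by linarith
    thus ?thesis by simp
  qed
  \<comment> \<open>The new coefficients remain integers: outside \<open>J\<close> the division by
    p^r is exact, on \<open>J\<close> the factor p^k absorbs it.\<close>
  define sc :: "'i set \<Rightarrow> nat \<Rightarrow> 'i \<Rightarrow> int \<Rightarrow> int" where "sc J r i z = (if i \<in> J then int p ^ (k - r) * z else z div int p ^ r)" for J r i z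
  have sc: "of_int (sc J r i z) = (if i \<in> J then of_nat p ^ k else 1) * (of_int z / of_nat p ^ r :: rat)"
    if dvd: "i \<notin> J \<Longrightarrow> int p ^ r dvd z" and r: "r \<le> k" for J r z and i :: 'i
  proof (cases "i \<in> J")
    case True
    have "(of_nat p ^ k :: rat) = of_nat p ^ (k - r) * of_nat p ^ r" using r by (simp flip: power_add)
    thus ?thesis using True p0 by (simp add: sc_def)
  next
    case False
    then obtain c where "z = int p ^ r * c" using dvd unfolding dvd_def by blast
    thus ?thesis using False p p0 by (simp add: sc_def)
  qed
  \<comment> \<open>Dividing both equations by p^r lowers the valuation of the determinant by
    2r.\<close>
  have scaling: "2 * r * k < card {i \<in> I. \<not> (int p ^ r dvd A i \<and> int p ^ r dvd B i)}" (is "_ < card ?J")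
    if r: "r \<in> {1, 2}" for r
  proof (rule count)
    show "?J \<subseteq> I" "2 * r > 0" using r by auto
    have "\<not> int p dvd 1" using p by simp
    from padic_abs_unit_over_power[OF p(1) this, of "2 * r"]
    show "padic_abs p (1 / of_nat p ^ r * (1 / of_nat p ^ r) - 0 * 0) = real p powi int (2 * r)"
      by (simp add: power_mult power2_eq_square power_mult_distrib mult.commute[of 2])
    show "of_int (sc ?J r i (A i)) = (if i \<in> ?J then of_nat p ^ k else 1) *
      (1 / of_nat p ^ r * of_int (A i) + 0 * of_int (B i) :: rat)" if "i \<in> I" for i
      using that r k2 by (subst sc) auto
    show "of_int (sc ?J r i (B i)) = (if i \<in> ?J then of_nat p ^ k else 1) *
      (0 * of_int (A i) + 1 / of_nat p ^ r * of_int (B i) :: rat)" if "i \<in> I" for i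
      using that r k2 by (subst sc) auto
  qed
  have form: "r * k < card {i \<in> I. \<not> int p ^ r dvd \<alpha> * A i + \<beta> * B i}" (is "_ < card ?J")
    if r: "r \<in> {1, 2}" and \<alpha>\<beta>: "\<not> (int p dvd \<alpha> \<and> int p dvd \<beta>)" for r \<alpha> \<beta>
  proof -
    have J: "?J \<subseteq> I" "r > 0" using r by auto
    have new: "of_int (sc ?J r i (\<alpha> * A i + \<beta> * B i)) = (if i \<in> ?J then of_nat p ^ k else 1) *
      (of_int \<alpha> / of_nat p ^ r * of_int (A i) + of_int \<beta> / of_nat p ^ r * of_int (B i) :: rat)" if "i \<in> I" for i
      using that r k2 by (subst sc) (auto simp: add_divide_distrib)
    show ?thesis
    \<comment> \<open>The divided form is completed by whichever original equation makes the
      determinant a unit over p^r.\<close>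
    proof (cases "int p dvd \<alpha>")
      case False
      have det: "padic_abs p (of_int \<alpha> / of_nat p ^ r * 1 - of_int \<beta> / of_nat p ^ r * 0) = real p powi int r"
        using padic_abs_unit_over_power[OF p(1) False, of r] by simp
      show ?thesis
        by (rule count[OF J det new, where B' = "\<lambda>i. (if i \<in> ?J then int p ^ k else 1) * B i"]) auto
    next
      case True
      hence "\<not> int p dvd - \<beta>" using \<alpha>\<beta> by simp
      from padic_abs_unit_over_power[OF p(1) this, of r]
      have det: "padic_abs p (of_int \<alpha> / of_nat p ^ r * 0 - of_int \<beta> / of_nat p ^ r * 1) = real p powi int r"
        by simp
      show ?thesis
        by (rule count[OF J det new, where B' = "\<lambda>i. (if i \<in> ?J then int p ^ k else 1) * A i"]) auto
    qed
  qed
  let ?q = "p ^ (\<tau> + 1)" and ?P = "p ^ \<tau>" and ?h = "p ^ (\<tau> - 1)"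
  have qk: "?q - ?P = k" using k by (simp add: diff_mult_distrib2 mult.commute)
  have "good p ?q I A B"
  proof (rule good_of_normalised[OF p, where e = "\<tau> + 1" and P = ?P and h = ?h]; (unfold qk)?)
    show "?P = p * ?h" using \<tau> by (simp flip: power_Suc)
    show "2 * k < card {i \<in> I. \<not> (int p dvd A i \<and> int p dvd B i)}" using scaling[of 1] by simp
    show "4 * k < card {i \<in> I. \<not> ((int p)\<^sup>2 dvd A i \<and> (int p)\<^sup>2 dvd B i)}" using scaling[of 2] by simp
    show "k < card {i \<in> I. \<not> int p dvd \<alpha> * A i + \<beta> * B i}" if "\<not> (int p dvd \<alpha> \<and> int p dvd \<beta>)" for \<alpha> \<beta>
      using form[of 1, OF _ that] by simp
    show "2 * k < card {i \<in> I. \<not> (int p)\<^sup>2 dvd \<alpha> * A i + \<beta> * B i}" if "\<not> (int p dvd \<alpha> \<and> int p dvd \<beta>)" for \<alpha> \<beta>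
      using form[of 2, OF _ that] by simp
  qed (use p I in auto)
  moreover have "\<not> p dvd p - 1"
    using p dvd_imp_le[of p "p - 1"] by auto
  ultimately have "padic_solvable p k I A B"
    using padic_solvable_of_good[OF p(1) _ k _ I] p by simp
  thus ?thesis by (rule padic_solvable_of_equivalent[OF p(1) es])
qed

lemma padic_solvableE:
  assumes "padic_solvable p k I a b"
  obtains X where "\<And>i. i \<in> I \<Longrightarrow> padic_Cauchy p (X i)" "\<exists>i\<in>I. \<not> padic_null p (X i)"
    "padic_null p (\<lambda>n. \<Sum>i\<in>I. of_int (a i) * X i n ^ k)"
    "padic_null p (\<lambda>n. \<Sum>i\<in>I. of_int (b i) * X i n ^ k)"
  using assms unfolding padic_solvable_def by blast

text \<open>If more than half of the coefficient vectors are proportional, a single equation has to be solved;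
  two copies of it in separate variables form a balanced pair.\<close>

lemma padic_solvable_pair:
  fixes a b :: "'i \<Rightarrow> int"
  assumes p: "prime p" "p \<ge> 5" and \<tau>: "\<tau> \<ge> 1" and k: "k = p ^ \<tau> * (p - 1)"
    and I: "finite I" and s: "2 * k\<^sup>2 < card I"
  shows "padic_solvable p k I a b"
proof (cases "\<forall>i\<in>I. 2 * card {j \<in> I. a i * b j = a j * b i} \<le> card I")
  case True
  thus ?thesis using padic_solvable_balanced[OF p \<tau> k I s] by blast
next
  case False
  have k0: "k > 0" using k p by simp
  obtain i where i: "i \<in> I" "card I < 2 * card {j \<in> I. a i * b j = a j * b i}"
    using False by force
  have const: "padic_null p (\<lambda>_. 0 :: rat)" "\<not> padic_null p (\<lambda>_. 1)"
    by (auto simp: padic_null_def LIMSEQ_const_iff padic_abs_1[OF p(1)])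
  show ?thesis
  proof (cases "\<exists>j\<in>I. a j = 0 \<and> b j = 0")
    case True
    then obtain j where j: "j \<in> I" "a j = 0" "b j = 0" by auto
    define X :: "'i \<Rightarrow> nat \<Rightarrow> rat" where "X l n = (if l = j then 1 else 0)" for l n
    have z: "of_int (a l) * X l n ^ k = 0" "of_int (b l) * X l n ^ k = 0" for l n
      using j k0 by (auto simp: X_def)
    have "padic_Cauchy p (X l)" for l
      using padic_Cauchy_const[OF p(1), of "if l = j then 1 else 0"] by (simp add: X_def[abs_def])
    moreover have "\<not> padic_null p (X j)" using const by (simp add: X_def[abs_def])
    moreover have "padic_null p (\<lambda>n. \<Sum>l\<in>I. of_int (a l) * X l n ^ k)"
      "padic_null p (\<lambda>n. \<Sum>l\<in>I. of_int (b l) * X l n ^ k)"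
      using const(1) by (simp_all only: z sum.neutral_const)
    ultimately show ?thesis unfolding padic_solvable_def using j by blast
  next
    case nz: False
    define K where "K = {j \<in> I. a i * b j = a j * b i}"
    \<comment> \<open>Columns in \<open>K\<close> are multiples of column \<open>i\<close>;
      \<open>c\<close> is chosen so that both equations restricted to \<open>K\<close> become
      multiples of the single one with coefficients \<open>c\<close>.\<close>
    define c where "c j = (if a i \<noteq> 0 then a j else b j)" for j
    have "\<exists>u v :: rat. \<forall>j\<in>K. of_int (a j) = u * of_int (c j) \<and> of_int (b j) = v * of_int (c j) \<and> c j \<noteq> 0"
    proof (cases "a i = 0")
      case True
      hence "b i \<noteq> 0" using nz i by auto
      hence "a j = 0" if "j \<in> K" for j using that True by (auto simp: K_def)
      moreover have "b j \<noteq> 0" if "j \<in> K" for j using that nz calculation[OF that] by (auto simp: K_def)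
      ultimately show ?thesis using True by (intro exI[of _ 0] exI[of _ 1]) (simp add: c_def)
    next
      case False
      have b: "of_int (b j) = (of_int (b i) / of_int (a i)) * (of_int (a j) :: rat)" if "j \<in> K" for j
      proof -
        have "of_int (a i * b j) = (of_int (a j * b i) :: rat)" using that by (simp add: K_def)
        thus ?thesis using False by (simp add: field_simps)
      qed
      have "a j \<noteq> 0" if "j \<in> K" for j
      proof
        assume "a j = 0"
        hence "b j = 0" using that False by (simp add: K_def)
        thus False using nz that \<open>a j = 0\<close> by (auto simp: K_def)
      qed
      thus ?thesis using b False
        by (intro exI[of _ 1] exI[of _ "of_int (b i) / of_int (a i)"]) (simp add: c_def)
    qed
    then obtain u v :: rat where uv0:
      "\<forall>j\<in>K. of_int (a j) = u * of_int (c j) \<and> of_int (b j) = v * of_int (c j) \<and> c j \<noteq> 0" by blast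
    have uv: "of_int (a j) = u * of_int (c j)" "of_int (b j) = v * of_int (c j)" "c j \<noteq> 0" if "j \<in> K" for j
      using bspec[OF uv0 that] by blast+
    have K: "finite K" "K \<subseteq> I" using I by (auto simp: K_def)
    let ?I = "K \<times> (UNIV :: bool set)"
    let ?a = "\<lambda>(j, t). if t then c j else 0" and ?b = "\<lambda>(j, t). if t then 0 else c j"
    have cI: "card ?I = 2 * card K" by (simp add: card_cartesian_product)
    \<comment> \<open>Doubling restores the number of variables, 2 |K| > s, and each column is
      parallel to exactly half of them.\<close>
    have "padic_solvable p k ?I ?a ?b"
    proof (rule padic_solvable_balanced[OF p \<tau> k])
      show "finite ?I" using K by simp
      show "2 * k\<^sup>2 < card ?I" using i s cI by (simp add: K_def)
      fix z assume "z \<in> ?I"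
      then obtain j t where z: "z = (j, t)" "j \<in> K" by auto
      have "{w \<in> ?I. ?a z * ?b w = ?a w * ?b z} = K \<times> {t}"
        using z uv(3) by (cases t) (auto split: if_splits)
      thus "2 * card {w \<in> ?I. ?a z * ?b w = ?a w * ?b z} \<le> card ?I"
        by (simp add: cI card_cartesian_product)
    qed
    then obtain X where X: "\<And>z. z \<in> ?I \<Longrightarrow> padic_Cauchy p (X z)" "\<exists>z\<in>?I. \<not> padic_null p (X z)"
      "padic_null p (\<lambda>n. \<Sum>z\<in>?I. of_int (?a z) * X z n ^ k)"
      "padic_null p (\<lambda>n. \<Sum>z\<in>?I. of_int (?b z) * X z n ^ k)"
      by (rule padic_solvableE) (rule that)
    have S: "(\<Sum>z\<in>?I. f z) = (\<Sum>j\<in>K. f (j, True) + f (j, False))" for f :: "'i \<times> bool \<Rightarrow> rat"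
    proof -
      have "(\<Sum>z\<in>?I. f z) = (\<Sum>j\<in>K. \<Sum>t\<in>UNIV. f (j, t))"
        using K by (simp add: sum.cartesian_product)
      thus ?thesis by (simp add: UNIV_bool add.commute)
    qed
    \<comment> \<open>The copy \<open>t\<close> containing a nonzero entry is by itself a nontrivial
      solution of the single equation.\<close>
    obtain j t where jt: "j \<in> K" "\<not> padic_null p (X (j, t))" using X(2) by auto
    have nt: "padic_null p (\<lambda>n. \<Sum>j\<in>K. of_int (c j) * X (j, t) n ^ k)"
      using X(3,4) unfolding S by (cases t) simp_all
    define Y :: "'i \<Rightarrow> nat \<Rightarrow> rat" where "Y l = (if l \<in> K then X (l, t) else (\<lambda>_. 0))" for l
    have sumY: "(\<Sum>l\<in>I. of_int (f l) * Y l n ^ k) = w * (\<Sum>j\<in>K. of_int (c j) * X (j, t) n ^ k)"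
      if "\<And>j. j \<in> K \<Longrightarrow> of_int (f j) = w * of_int (c j)" for f w n
    proof -
      have "(\<Sum>l\<in>I. of_int (f l) * Y l n ^ k) = (\<Sum>l\<in>K. of_int (f l) * Y l n ^ k)"
        using I K k0 by (intro sum.mono_neutral_right) (auto simp: Y_def)
      also have "\<dots> = (\<Sum>l\<in>K. w * (of_int (c l) * X (l, t) n ^ k))"
        using that by (intro sum.cong) (auto simp: Y_def)
      finally show ?thesis by (simp add: sum_distrib_left)
    qed
    have "padic_null p (\<lambda>n. \<Sum>l\<in>I. of_int (a l) * Y l n ^ k)"
      by (subst sumY, erule uv(1)) (rule padic_null_cmult[OF p(1) nt])
    moreover have "padic_null p (\<lambda>n. \<Sum>l\<in>I. of_int (b l) * Y l n ^ k)"
      by (subst sumY, erule uv(2)) (rule padic_null_cmult[OF p(1) nt])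
    moreover have "padic_Cauchy p (Y l)" for l
      using X(1)[of "(l, t)"] padic_Cauchy_const[OF p(1), of 0] by (simp add: Y_def)
    moreover have "j \<in> I" "\<not> padic_null p (Y j)" using jt K by (auto simp: Y_def)
    ultimately show ?thesis unfolding padic_solvable_def by blast
  qed
qed

section \<open>Passage to the field of p-adic numbers\<close>

lemma padic_field_zero: "\<zero>\<^bsub>padic_field p\<^esub> = {x. padic_null p x}"
  by (simp add: padic_field_def FactRing_def)

text \<open>The quotient map is a ring homomorphism whose kernel consists of the null sequences, and
  powers, integer multiples and sums in the Cauchy ring are pointwise.\<close>

lemma padic_field_solution:
  fixes a b :: "'i \<Rightarrow> int"
  assumes p: "prime p" and I: "finite I" and sol: "padic_solvable p k I a b"
  shows "\<exists>x \<in> I \<rightarrow> carrier (padic_field p).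
           (\<exists>i\<in>I. x i \<noteq> \<zero>\<^bsub>padic_field p\<^esub>) \<and>
           (\<Oplus>\<^bsub>padic_field p\<^esub>i\<in>I. [a i] \<cdot>\<^bsub>padic_field p\<^esub> (x i [^]\<^bsub>padic_field p\<^esub> k)) = \<zero>\<^bsub>padic_field p\<^esub> \<and>
           (\<Oplus>\<^bsub>padic_field p\<^esub>i\<in>I. [b i] \<cdot>\<^bsub>padic_field p\<^esub> (x i [^]\<^bsub>padic_field p\<^esub> k)) = \<zero>\<^bsub>padic_field p\<^esub>"
proof -
  let ?C = "padic_Cauchy_ring p" and ?F = "padic_field p" and ?N = "{x. padic_null p x}"
  interpret C: cring ?C by (rule cring_padic_Cauchy_ring[OF p])
  interpret M: maximalideal ?N ?C by (rule maximalideal_padic_null[OF p])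
  interpret h: ring_hom_cring ?C ?F "(+>\<^bsub>?C\<^esub>) ?N"
    unfolding padic_field_def by (rule M.rcos_ring_hom_cring[OF C.cring_axioms])
  note hom_nat_pow = ring_hom_ring.hom_nat_pow[OF M.rcos_ring_hom_ring[folded padic_field_def]]
  let ?h = "(+>\<^bsub>?C\<^esub>) ?N"
  have carr: "x \<in> carrier ?C \<longleftrightarrow> padic_Cauchy p x" for x by (simp add: padic_Cauchy_ring_def)
  have zero: "?h x = \<zero>\<^bsub>?F\<^esub> \<longleftrightarrow> padic_null p x" if "x \<in> carrier ?C" for x
  proof -
    have "?h x = ?N \<longleftrightarrow> x \<in> ?N"
      using M.rcos_const_imp_mem[OF that] C.a_rcos_zero[OF M.is_ideal, of x] by blast
    thus ?thesis unfolding padic_field_zero by simp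
  qed
  have pow: "x [^]\<^bsub>?C\<^esub> m = (\<lambda>n. x n ^ m)" for x and m :: nat
    by (induction m) (auto simp: padic_Cauchy_ring_def mult.commute)
  have nat_mult: "[m] \<cdot>\<^bsub>?C\<^esub> x = (\<lambda>n. of_nat m * x n)" for x and m :: nat
    by (induction m) (auto simp: padic_Cauchy_ring_def add_pow_def algebra_simps)
  have neg: "\<ominus>\<^bsub>?C\<^esub> x = (\<lambda>n. - x n)" if "padic_Cauchy p x" for x
    using that by (intro C.minus_equality) (auto simp: padic_Cauchy_ring_def padic_Cauchy_minus[OF p])
  have cmult: "padic_Cauchy p (\<lambda>n. c * x n)" if "padic_Cauchy p x" for c x
    by (rule padic_Cauchy_mult[OF p padic_Cauchy_const[OF p] that])
  have int_mult: "[m] \<cdot>\<^bsub>?C\<^esub> x = (\<lambda>n. of_int m * x n)" if "padic_Cauchy p x" for x and m :: int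
  proof (cases "m \<ge> 0")
    case True
    thus ?thesis by (simp add: add_pow_int_ge nat_mult)
  next
    case False
    hence "[m] \<cdot>\<^bsub>?C\<^esub> x = \<ominus>\<^bsub>?C\<^esub> ([nat (- m)] \<cdot>\<^bsub>?C\<^esub> x)" by (simp add: add_pow_int_lt)
    also have "\<dots> = (\<lambda>n. - (of_nat (nat (- m)) * x n))"
      unfolding nat_mult by (rule neg[OF cmult[OF that]])
    finally show ?thesis using False by simp
  qed
  have fsum: "(\<Oplus>\<^bsub>?C\<^esub>i\<in>J. f i) = (\<lambda>n. \<Sum>i\<in>J. f i n)"
    if "finite J" "\<And>i. i \<in> J \<Longrightarrow> f i \<in> carrier ?C" for J :: "'i set" and f
    using that
  proof (induction J rule: finite_induct)
    case empty
    show ?case unfolding C.finsum_empty by (simp add: padic_Cauchy_ring_def)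
  next
    case (insert i J)
    have "(\<Oplus>\<^bsub>?C\<^esub>i\<in>insert i J. f i) = f i \<oplus>\<^bsub>?C\<^esub> (\<Oplus>\<^bsub>?C\<^esub>i\<in>J. f i)"
      using insert by (intro C.finsum_insert) auto
    thus ?case using insert by (simp add: padic_Cauchy_ring_def)
  qed
  have hom_add: "?h \<in> hom (add_monoid ?C) (add_monoid ?F)"
    by (rule homI) (auto simp: h.hom_add)
  have hom_int: "?h ([m] \<cdot>\<^bsub>?C\<^esub> x) = [m] \<cdot>\<^bsub>?F\<^esub> (?h x)" if "x \<in> carrier ?C" for x and m :: int
    using hom_int_pow[OF hom_add _ C.a_group h.S.a_group, of x m] that by (simp add: add_pow_def)
  obtain X where X: "\<And>i. i \<in> I \<Longrightarrow> X i \<in> carrier ?C" "\<exists>i\<in>I. \<not> padic_null p (X i)"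
    "padic_null p (\<lambda>n. \<Sum>i\<in>I. of_int (a i) * X i n ^ k)"
    "padic_null p (\<lambda>n. \<Sum>i\<in>I. of_int (b i) * X i n ^ k)"
    using sol unfolding padic_solvable_def carr by blast
  have eq: "(\<Oplus>\<^bsub>?F\<^esub>i\<in>I. [c i] \<cdot>\<^bsub>?F\<^esub> (?h (X i) [^]\<^bsub>?F\<^esub> k)) = \<zero>\<^bsub>?F\<^esub>"
    if c: "padic_null p (\<lambda>n. \<Sum>i\<in>I. of_int (c i) * X i n ^ k)" for c :: "'i \<Rightarrow> int"
  proof -
    have t: "[c i] \<cdot>\<^bsub>?C\<^esub> (X i [^]\<^bsub>?C\<^esub> k) = (\<lambda>n. of_int (c i) * X i n ^ k)" if "i \<in> I" for i
      using int_mult[of "X i [^]\<^bsub>?C\<^esub> k"] C.nat_pow_closed[OF X(1)[OF that], of k] carr by (simp add: pow)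
    have tc: "[c i] \<cdot>\<^bsub>?C\<^esub> (X i [^]\<^bsub>?C\<^esub> k) \<in> carrier ?C" if "i \<in> I" for i
      using X(1)[OF that] by (simp add: C.add.int_pow_closed)
    have "(\<Oplus>\<^bsub>?F\<^esub>i\<in>I. [c i] \<cdot>\<^bsub>?F\<^esub> (?h (X i) [^]\<^bsub>?F\<^esub> k)) =
        (\<Oplus>\<^bsub>?F\<^esub>i\<in>I. ?h ([c i] \<cdot>\<^bsub>?C\<^esub> (X i [^]\<^bsub>?C\<^esub> k)))"
    proof (rule h.S.finsum_cong')
      show "(\<lambda>i. ?h ([c i] \<cdot>\<^bsub>?C\<^esub> (X i [^]\<^bsub>?C\<^esub> k))) \<in> I \<rightarrow> carrier ?F" using tc by auto
      show "[c i] \<cdot>\<^bsub>?F\<^esub> (?h (X i) [^]\<^bsub>?F\<^esub> k) = ?h ([c i] \<cdot>\<^bsub>?C\<^esub> (X i [^]\<^bsub>?C\<^esub> k))" if "i \<in> I" for i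
        using X(1)[OF that] by (simp add: hom_int hom_nat_pow)
    qed simp
    also have "\<dots> = ?h (\<Oplus>\<^bsub>?C\<^esub>i\<in>I. [c i] \<cdot>\<^bsub>?C\<^esub> (X i [^]\<^bsub>?C\<^esub> k))"
      using h.hom_finsum[of "\<lambda>i. [c i] \<cdot>\<^bsub>?C\<^esub> (X i [^]\<^bsub>?C\<^esub> k)" I] tc by (simp add: comp_def Pi_def)
    also have "\<dots> = \<zero>\<^bsub>?F\<^esub>"
    proof (subst zero)
      show "(\<Oplus>\<^bsub>?C\<^esub>i\<in>I. [c i] \<cdot>\<^bsub>?C\<^esub> (X i [^]\<^bsub>?C\<^esub> k)) \<in> carrier ?C" using tc by (intro C.finsum_closed) auto
      show "padic_null p (\<Oplus>\<^bsub>?C\<^esub>i\<in>I. [c i] \<cdot>\<^bsub>?C\<^esub> (X i [^]\<^bsub>?C\<^esub> k))"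
        using c by (subst fsum[OF I tc]) (simp_all add: t cong: sum.cong)
    qed
    finally show ?thesis .
  qed
  have "(\<lambda>i. ?h (X i)) \<in> I \<rightarrow> carrier ?F" using X(1) by auto
  moreover have "\<exists>i\<in>I. ?h (X i) \<noteq> \<zero>\<^bsub>?F\<^esub>" using X(1,2) zero by blast
  ultimately show ?thesis using eq[OF X(3)] eq[OF X(4)] by (intro bexI[of _ "\<lambda>i. ?h (X i)"]) auto
qed

theorem mainTheorem1:
  fixes p \<tau> k s :: nat and a b :: "nat \<Rightarrow> int"
  assumes "prime p" and "p \<ge> 5" and "\<tau> \<ge> 1" and "k = p ^ \<tau> * (p - 1)"
    and "s > 2 * k ^ 2"
  shows "\<exists>x \<in> {1..s} \<rightarrow> carrier (padic_field p).
           (\<exists>i\<in>{1..s}. x i \<noteq> \<zero>\<^bsub>padic_field p\<^esub>) \<and>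
           (\<Oplus>\<^bsub>padic_field p\<^esub>i\<in>{1..s}. [a i] \<cdot>\<^bsub>padic_field p\<^esub> (x i [^]\<^bsub>padic_field p\<^esub> k)) = \<zero>\<^bsub>padic_field p\<^esub> \<and>
           (\<Oplus>\<^bsub>padic_field p\<^esub>i\<in>{1..s}. [b i] \<cdot>\<^bsub>padic_field p\<^esub> (x i [^]\<^bsub>padic_field p\<^esub> k)) = \<zero>\<^bsub>padic_field p\<^esub>"
  by (rule padic_field_solution[OF assms(1) _ padic_solvable_pair[OF assms(1-4)]]) (use assms(5) in simp_all)

end
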